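(* There are absolute constants $0<c,C<\infty$ such that for every $n\ge 1$ $$c\sqrt n\le w_3^{(s)}(n)\le C\sqrt n\,\log(n+1).$$
   Context: For a finite-dimensional real Banach space $X$ with closed unit ball $B_X$ and $f\in C(B_X)$ (continuous real-valued), let $E_3(f;B_X)=\inf_\varphi\max_{x\in B_X}|f(x)-\varphi(x)|$, the infimum over all real polynomials $\varphi$ on $X$ of total degree at most $2$; let $\Delta_h^3(f;x)=\sum_{j=0}^3(-1)^{3-j}\binom 3j f(x+jh)$ and $\omega_3(f;B_X)=\sup|\Delta_h^3(f;x)|$, the supremum over all $x,h\in X$ with $x,x+h,x+2h,x+3h\in B_X$. The Whitney constant is $w_3(X)=\sup\{E_3(f;B_X): f\in C(B_X),\ \omega_3(f;B_X)\le1\}$, and $w_3^{(s)}(n)=\sup_{\dim X=n}w_3(X)$, the supremum over all $n$-dimensional real Banach spaces $X$. *)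

theory Defs
  imports Complex_Main "HOL-Library.Extended_Real" "Jordan_Normal_Form.Matrix"
begin

text \<open>
  An \<open>n\<close>-dimensional real Banach space is represented by a norm \<open>N\<close> on \<open>carrier_vec n\<close>, that is,
  on the coordinate space of real vectors of length \<open>n\<close>. Choosing a basis identifies every such
  space isometrically with one of this form (completeness is automatic), and all the quantities
  below are invariant under linear isometries. Values of \<open>N\<close> and \<open>f\<close> outside \<open>carrier_vec n\<close> play
  no role. Suprema and infima are taken in \<open>ereal\<close>, so that none of them needs a side condition
  of boundedness.
\<close>

definition norm_on :: "nat \<Rightarrow> (real vec \<Rightarrow> real) \<Rightarrow> bool" where
  "norm_on n N \<longleftrightarrow>
     (\<forall>x\<in>carrier_vec n. 0 \<le> N x \<and> (N x = 0 \<longleftrightarrow> x = 0\<^sub>v n)) \<and>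
     (\<forall>a. \<forall>x\<in>carrier_vec n. N (a \<cdot>\<^sub>v x) = \<bar>a\<bar> * N x) \<and>
     (\<forall>x\<in>carrier_vec n. \<forall>y\<in>carrier_vec n. N (x + y) \<le> N x + N y)"

definition unit_ball :: "nat \<Rightarrow> (real vec \<Rightarrow> real) \<Rightarrow> real vec set" where
  "unit_ball n N = {x \<in> carrier_vec n. N x \<le> 1}"

definition cont_on_ball :: "nat \<Rightarrow> (real vec \<Rightarrow> real) \<Rightarrow> (real vec \<Rightarrow> real) \<Rightarrow> bool" where
  "cont_on_ball n N f \<longleftrightarrow>
     (\<forall>x\<in>unit_ball n N. \<forall>\<epsilon>>0. \<exists>\<delta>>0. \<forall>y\<in>unit_ball n N.
        N (y - x) < \<delta> \<longrightarrow> \<bar>f y - f x\<bar> < \<epsilon>)"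

text \<open>Multi-indices \<open>\<alpha>\<close> in \<open>n\<close> variables of total degree at most \<open>d\<close>.\<close>

definition multi_indices :: "nat \<Rightarrow> nat \<Rightarrow> (nat \<Rightarrow> nat) set" where
  "multi_indices n d = {\<alpha>. (\<forall>i\<ge>n. \<alpha> i = 0) \<and> (\<Sum>i<n. \<alpha> i) \<le> d}"

lemma finite_multi_indices: "finite (multi_indices n d)"
proof (rule finite_subset)
  show "multi_indices n d \<subseteq> {\<alpha>. \<forall>i. (i \<in> {..<n} \<longrightarrow> \<alpha> i \<in> {..d}) \<and> (i \<notin> {..<n} \<longrightarrow> \<alpha> i = 0)}"
  proof (clarsimp simp: multi_indices_def)
    fix \<alpha> :: "nat \<Rightarrow> nat" and i
    assume "sum \<alpha> {..<n} \<le> d" "i < n"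
    then show "\<alpha> i \<le> d"
      using member_le_sum[of i "{..<n}" \<alpha>] by simp
  qed
qed (rule finite_set_of_finite_funs; simp)

definition polynomials :: "nat \<Rightarrow> nat \<Rightarrow> (real vec \<Rightarrow> real) set" where
  "polynomials n d =
     {\<lambda>x. \<Sum>\<alpha>\<in>multi_indices n d. a \<alpha> * (\<Prod>i<n. (x $ i) ^ \<alpha> i) | a. True}"

definition E3 :: "nat \<Rightarrow> (real vec \<Rightarrow> real) \<Rightarrow> (real vec \<Rightarrow> real) \<Rightarrow> ereal" where
  "E3 n N f = (INF \<phi>\<in>polynomials n 2. SUP x\<in>unit_ball n N. ereal \<bar>f x - \<phi> x\<bar>)"

definition Delta3 :: "(real vec \<Rightarrow> real) \<Rightarrow> real vec \<Rightarrow> real vec \<Rightarrow> real" where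
  "Delta3 f h x = (\<Sum>j=0..3. (-1) ^ (3 - j) * real (3 choose j) * f (x + real j \<cdot>\<^sub>v h))"

definition omega3 :: "nat \<Rightarrow> (real vec \<Rightarrow> real) \<Rightarrow> (real vec \<Rightarrow> real) \<Rightarrow> ereal" where
  "omega3 n N f =
     (SUP (x, h) \<in> {(x, h). x \<in> carrier_vec n \<and> h \<in> carrier_vec n \<and>
                            (\<forall>j\<in>{0..3::nat}. x + real j \<cdot>\<^sub>v h \<in> unit_ball n N)}.
        ereal \<bar>Delta3 f h x\<bar>)"

definition w3 :: "nat \<Rightarrow> (real vec \<Rightarrow> real) \<Rightarrow> ereal" where
  "w3 n N = Sup {E3 n N f | f. cont_on_ball n N f \<and> omega3 n N f \<le> 1}"

definition w3s :: "nat \<Rightarrow> ereal" where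
  "w3s n = Sup {w3 n N | N. norm_on n N}"

end

theory Submission
  imports Defs "HOL-Library.Function_Algebras" "Jordan_Normal_Form.Determinant"
begin

text \<open>
The upper bound. Let \<open>f\<close> have third differences at most 1 on the unit ball. Then its mixed third
differences are bounded near the centre (\<open>mixed_difference_bound\<close>). For the odd part of \<open>f\<close> this means
that it is almost additive there. An almost additive function is near a linear one, with an error of
order \<open>ln (n + 1)\<close> (\<open>almost_linear_near_linear\<close>): summation along binary trees bounds its deviation from
additivity on sums of \<open>n + 1\<close> vectors, Caratheodory's theorem reduces longer sums to these, and the
Hahn-Banach theorem supplies the linear function.

For the even part, polarization gives a symmetric function \<open>b x y\<close> that is almost additive in each
variable, hence near functions \<open>T y x\<close> that are linear in \<open>x\<close>. To make them linear in \<open>y\<close> as well, write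
each \<open>y\<close> of the unit ball as \<open>\<Sum> \<alpha>\<^sub>j(y) y\<^sub>j\<close> with fixed points \<open>y\<^sub>j\<close> of the unit ball, linear coefficients
\<open>\<alpha>\<^sub>j\<close>, and \<open>\<Sum> \<bar>\<alpha>\<^sub>j(y)\<bar> \<le> 3 \<surd>n\<close> (\<open>short_linear_expansions\<close>, a form of the theorem of Kadec and Snobar, proved
by nearly maximizing a determinant). The form \<open>\<Sum> \<alpha>\<^sub>j(y) T y\<^sub>j x\<close> is bilinear and near \<open>b\<close>, with an error
of order \<open>\<surd>n ln (n + 1)\<close>. Comparing \<open>f (2 u)\<close> with \<open>f u\<close> carries the estimates to the whole ball.

The lower bound. The obstruction to replacing almost bilinear functions by bilinear ones is a badly
complemented subspace. The matrix of the discrete sine transform is symmetric and orthogonal, and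
its entries are at most \<open>1 / s\<close> with \<open>s = \<surd>((n + 1) / 2)\<close>. Let \<open>P\<close> and \<open>Q\<close> be the projections to its
eigenspaces for \<open>- 1\<close> and \<open>1\<close>. The unit ball is the sum of the image of the cube under \<open>P\<close> and of the
image of the cross-polytope under \<open>Q\<close>. For each \<open>x\<close> in the ball choose continuously a bounded vector
\<open>l x\<close> with \<open>P (l x) = P x\<close> (\<open>continuous_selection\<close>), and let \<open>f x\<close> be the inner product of \<open>x\<close> with
\<open>l x - P x\<close>. Third differences of \<open>f\<close> involve only combinations of values of \<open>l\<close> that lie in the kernel
of \<open>P\<close>, where the inner product with a point of the ball is controlled by the maximum norm, so they
are bounded. If \<open>f\<close> were near a quadratic polynomial, its bilinear part would nearly produce a linear
choice of \<open>l\<close>, and the trace of \<open>P\<close>, which is about \<open>n / 2\<close>, shows that a linear choice has norm at least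
of order \<open>s\<close> (\<open>pairing_far_from_quadratic\<close>).
\<close>

section \<open>Real functions as vectors, and seminorms\<close>

text \<open>
Coordinate vectors are functions on \<open>nat\<close>, and a norm on the first \<open>n\<close> coordinates becomes a seminorm
on all functions. One type then serves every dimension, without carrier sets; two functions
that agree below \<open>n\<close> differ by a vector of seminorm 0.
\<close>

instantiation "fun" :: (type, real_vector) real_vector
begin
definition scaleR_fun_def: "scaleR c f = (\<lambda>x. c *\<^sub>R f x)"
instance
  by standard (simp_all add: scaleR_fun_def fun_eq_iff scaleR_add_right scaleR_add_left)
end

lemma scaleR_fun_apply [simp]: "(c *\<^sub>R f) x = c *\<^sub>R f x"
  by (simp add: scaleR_fun_def)

lemma sum_fun_apply: "(\<Sum>a\<in>A. f a) x = (\<Sum>a\<in>A. f a x)" 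
  by (induction A rule: infinite_finite_induct) auto

locale seminorm =
  fixes N :: "'a::real_vector \<Rightarrow> real"
  assumes triangle: "N (x + y) \<le> N x + N y"
    and scale: "N (c *\<^sub>R x) = \<bar>c\<bar> * N x"
begin

lemma zero [simp]: "N 0 = 0"
  using scale[of 0 0] by simp

lemma minus [simp]: "N (- x) = N x"
  using scale[of "-1" x] by simp

lemma nonneg [simp]: "0 \<le> N x"
  using triangle[of x "- x"] by simp

lemma triangle_diff: "N (x - y) \<le> N x + N y"
  using triangle[of x "- y"] by simp

lemma eq_if_null_diff: "N (x - y) = 0 \<Longrightarrow> N x = N y"
  using triangle[of y "x - y"] triangle[of x "y - x"] minus[of "x - y"] by simp

lemma sum_list_le: "N (sum_list xs) \<le> (\<Sum>x\<leftarrow>xs. N x)"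
proof (induction xs)
  case (Cons x xs)
  then show ?case using triangle[of x "sum_list xs"] by simp
qed simp

lemma sum_le: "N (sum g A) \<le> (\<Sum>x\<in>A. N (g x))"
proof (induction A rule: infinite_finite_induct)
  case (insert x F)
  then show ?case using triangle[of "g x" "sum g F"] by simp
qed simp_all

end

section \<open>Third differences and mixed third differences\<close>

definition third_difference :: "('a::real_vector \<Rightarrow> real) \<Rightarrow> 'a \<Rightarrow> 'a \<Rightarrow> real" where
  "third_difference f h x = f (x + 3 *\<^sub>R h) - 3 * f (x + 2 *\<^sub>R h) + 3 * f (x + h) - f x"

definition mixed_difference :: "('a::real_vector \<Rightarrow> real) \<Rightarrow> 'a \<Rightarrow> 'a \<Rightarrow> 'a \<Rightarrow> 'a \<Rightarrow> real" where
  "mixed_difference f a b c x =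
     f (x + a + b + c) - f (x + a + b) - f (x + a + c) - f (x + b + c)
     + f (x + a) + f (x + b) + f (x + c) - f x"

text \<open>
This is an identity of Djokovic. Let \<open>h\<^sub>1, h\<^sub>2, h\<^sub>3\<close> be \<open>a, b, c\<close>. For a set \<open>E\<close> of indices, start at
\<open>x + (\<Sum>r\<in>E. h\<^sub>r)\<close> and take the third difference with step \<open>- (\<Sum>r\<in>E. h\<^sub>r / r)\<close>. Its term number \<open>r > 0\<close>
does not involve \<open>h\<^sub>r\<close>, so it cancels in the alternating sum over all \<open>E\<close>, and the terms with number 0
form the mixed difference.
\<close>

lemma mixed_difference_eq:
  fixes f :: "'a::real_vector \<Rightarrow> real"
  shows "mixed_difference f a b c x =
     - third_difference f (- a) (x + a)
     - third_difference f (- (1/2) *\<^sub>R b) (x + b)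
     - third_difference f (- (1/3) *\<^sub>R c) (x + c)
     + third_difference f (- a - (1/2) *\<^sub>R b) (x + a + b)
     + third_difference f (- a - (1/3) *\<^sub>R c) (x + a + c)
     + third_difference f (- (1/2) *\<^sub>R b - (1/3) *\<^sub>R c) (x + b + c)
     - third_difference f (- a - (1/2) *\<^sub>R b - (1/3) *\<^sub>R c) (x + a + b + c)"
proof -
  define F where "F r s t = f (x + r *\<^sub>R a + s *\<^sub>R b + t *\<^sub>R c)" for r s t
  have T: "third_difference f (u *\<^sub>R a + v *\<^sub>R b + w *\<^sub>R c) (x + r *\<^sub>R a + s *\<^sub>R b + t *\<^sub>R c) =
     F (r + 3 * u) (s + 3 * v) (t + 3 * w) - 3 * F (r + 2 * u) (s + 2 * v) (t + 2 * w)
     + 3 * F (r + u) (s + v) (t + w) - F r s t" for u v w r s t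
    unfolding F_def third_difference_def by (simp add: algebra_simps)
  have M: "mixed_difference f a b c x = F 1 1 1 - F 1 1 0 - F 1 0 1 - F 0 1 1 + F 1 0 0 + F 0 1 0 + F 0 0 1 - F 0 0 0"
    unfolding F_def mixed_difference_def by simp
  show ?thesis
    unfolding M
    using T[of "-1" 0 0 1 0 0] T[of 0 "-1/2" 0 0 1 0] T[of 0 0 "-1/3" 0 0 1]
      T[of "-1" "-1/2" 0 1 1 0] T[of "-1" 0 "-1/3" 1 0 1] T[of 0 "-1/2" "-1/3" 0 1 1]
      T[of "-1" "-1/2" "-1/3" 1 1 1]
    by simp
qed

locale small_third_difference = seminorm N for N :: "'a::real_vector \<Rightarrow> real" +
  fixes f :: "'a \<Rightarrow> real"
  assumes third_difference_le:
    "\<lbrakk>N x \<le> 1; N (x + h) \<le> 1; N (x + 2 *\<^sub>R h) \<le> 1; N (x + 3 *\<^sub>R h) \<le> 1\<rbrakk>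
      \<Longrightarrow> \<bar>third_difference f h x\<bar> \<le> 1"
begin

text \<open>
The ball is convex, so it suffices that the two ends of the progression lie in it.
\<close>

lemma third_difference_bound:
  assumes "N x \<le> 1" "N (x + 3 *\<^sub>R h) \<le> 1"
  shows "\<bar>third_difference f h x\<bar> \<le> 1"
proof (rule third_difference_le)
  have "x + h = (2/3) *\<^sub>R x + (1/3) *\<^sub>R (x + 3 *\<^sub>R h)"
    by (simp add: algebra_simps flip: scaleR_add_left)
  then show "N (x + h) \<le> 1"
    using triangle[of "(2/3) *\<^sub>R x" "(1/3) *\<^sub>R (x + 3 *\<^sub>R h)"] assms
    by (simp add: scale)
  have "x + 2 *\<^sub>R h = (1/3) *\<^sub>R x + (2/3) *\<^sub>R (x + 3 *\<^sub>R h)"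
    by (simp add: algebra_simps flip: scaleR_add_left)
  then show "N (x + 2 *\<^sub>R h) \<le> 1"
    using triangle[of "(1/3) *\<^sub>R x" "(2/3) *\<^sub>R (x + 3 *\<^sub>R h)"] assms
    by (simp add: scale)
qed (use assms in auto)

text \<open>
All seven progressions in Djokovic's identity consist of points \<open>x + r a + s b + t c\<close> with
\<open>\<bar>r\<bar> \<le> 2\<close>, \<open>\<bar>s\<bar> \<le> 1\<close> and \<open>\<bar>t\<bar> \<le> 1\<close>; this explains the weights of the norms.
\<close>

lemma mixed_difference_bound:
  assumes "N x + 2 * N a + N b + N c \<le> 1"
  shows "\<bar>mixed_difference f a b c x\<bar> \<le> 7"
proof -
  have comb: "N (x + r *\<^sub>R a + s *\<^sub>R b + t *\<^sub>R c) \<le> 1" 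
    if "\<bar>r\<bar> \<le> 2" "\<bar>s\<bar> \<le> 1" "\<bar>t\<bar> \<le> 1" for r s t
  proof -
    have "N (x + r *\<^sub>R a + s *\<^sub>R b + t *\<^sub>R c) \<le> N x + \<bar>r\<bar> * N a + \<bar>s\<bar> * N b + \<bar>t\<bar> * N c"
      using triangle[of "x + r *\<^sub>R a + s *\<^sub>R b" "t *\<^sub>R c"] triangle[of "x + r *\<^sub>R a" "s *\<^sub>R b"]
        triangle[of x "r *\<^sub>R a"] by (simp add: scale)
    also have "\<dots> \<le> N x + 2 * N a + 1 * N b + 1 * N c"
      using that by (intro add_mono mult_right_mono) auto
    finally show ?thesis using assms by simp
  qed
  have T: "\<bar>third_difference f (u *\<^sub>R a + v *\<^sub>R b + w *\<^sub>R c) (x + r *\<^sub>R a + s *\<^sub>R b + t *\<^sub>R c)\<bar> \<le> 1" 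
    if "\<bar>r\<bar> \<le> 2" "\<bar>s\<bar> \<le> 1" "\<bar>t\<bar> \<le> 1" "\<bar>r + 3 * u\<bar> \<le> 2" "\<bar>s + 3 * v\<bar> \<le> 1" "\<bar>t + 3 * w\<bar> \<le> 1"
    for u v w r s t
  proof (rule third_difference_bound)
    show "N (x + r *\<^sub>R a + s *\<^sub>R b + t *\<^sub>R c) \<le> 1" by (rule comb) (use that in auto)
    have "x + r *\<^sub>R a + s *\<^sub>R b + t *\<^sub>R c + 3 *\<^sub>R (u *\<^sub>R a + v *\<^sub>R b + w *\<^sub>R c) = 
       x + (r + 3 * u) *\<^sub>R a + (s + 3 * v) *\<^sub>R b + (t + 3 * w) *\<^sub>R c"
      by (simp add: algebra_simps)
    then show "N (x + r *\<^sub>R a + s *\<^sub>R b + t *\<^sub>R c + 3 *\<^sub>R (u *\<^sub>R a + v *\<^sub>R b + w *\<^sub>R c)) \<le> 1"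
      using comb[of "r + 3 * u" "s + 3 * v" "t + 3 * w"] that by (simp only:)
  qed
  show ?thesis
    unfolding mixed_difference_eq
    using T[of 1 0 0 "-1" 0 0] T[of 0 1 0 0 "-1/2" 0] T[of 0 0 1 0 0 "-1/3"]
      T[of 1 1 0 "-1" "-1/2" 0] T[of 1 0 1 "-1" 0 "-1/3"] T[of 0 1 1 0 "-1/2" "-1/3"]
      T[of 1 1 1 "-1" "-1/2" "-1/3"]
    by simp
qed

text \<open>
The progression \<open>- u, 0, u, 2 u\<close>: for odd \<open>f\<close> it compares \<open>f (2 u)\<close> with \<open>2 f u\<close>, for even \<open>f\<close> with
\<open>f 0 = 0\<close> it compares \<open>f (2 u)\<close> with \<open>4 f u\<close>. These relations extend estimates from a small ball to
the unit ball.
\<close>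

lemma doubling_bound:
  assumes "N (2 *\<^sub>R u) \<le> 1"
  shows "\<bar>f (2 *\<^sub>R u) - 3 * f u + 3 * f 0 - f (- u)\<bar> \<le> 1"
proof -
  have "N (- u) \<le> 1" using assms nonneg[of u] by (simp add: scale)
  moreover have "- u + 3 *\<^sub>R u = 2 *\<^sub>R u" "- u + 2 *\<^sub>R u = u"
    by (simp_all add: algebra_simps scaleR_2 flip: scaleR_add_left)
       (metis (no_types, opaque_lifting) add.commute diff_eq_eq one_add_one numeral_Bit1 numeral_One scaleR_add_left scaleR_one)
  ultimately show ?thesis
    using third_difference_bound[of "- u" u] assms by (simp add: third_difference_def)
qed

end

section \<open>Almost linear functions and their homogenization\<close>

text \<open>
Subtract the linear function with the same value at 1. A bound \<open>M\<close> for the rest improves to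
\<open>(M + D) / 2\<close> on \<open>[0, 1/2]\<close> by doubling, and then to \<open>(M + D) / 2 + D\<close> on \<open>[1/2, 1]\<close> by reflection in
\<open>1/2\<close>; for the least bound this gives \<open>M \<le> 3 D\<close>. That some bound exists is essential: without it
the statement fails for additive functions that are not linear.
\<close>

lemma almost_additive_real:
  fixes k :: "real \<Rightarrow> real"
  assumes add: "\<And>s t. 0 \<le> s \<Longrightarrow> 0 \<le> t \<Longrightarrow> s + t \<le> 1 \<Longrightarrow> \<bar>k (s + t) - k s - k t\<bar> \<le> D"
    and bdd: "\<And>t. 0 \<le> t \<Longrightarrow> t \<le> 1 \<Longrightarrow> \<bar>k t\<bar> \<le> B"
    and t: "0 \<le> t" "t \<le> 1"
  shows "\<bar>k t - t * k 1\<bar> \<le> 3 * D"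
proof -
  define l where "l t = k t - t * k 1" for t
  define S where "S = (\<lambda>t. \<bar>l t\<bar>) ` {0..1}"
  have ladd: "\<bar>l (s + t) - l s - l t\<bar> \<le> D" if "0 \<le> s" "0 \<le> t" "s + t \<le> 1" for s t
    using add[OF that] by (simp add: l_def algebra_simps)
  have "\<bar>l t\<bar> \<le> 2 * B" if "0 \<le> t" "t \<le> 1" for t
  proof -
    have "\<bar>t * k 1\<bar> \<le> 1 * B"
      unfolding abs_mult by (rule mult_mono) (use that bdd[of 1] in auto)
    then show ?thesis using bdd[OF that] by (simp add: l_def)
  qed
  then have bddS: "bdd_above S"
    unfolding S_def by (intro bdd_aboveI[of _ "2 * B"]) auto
  have le: "\<bar>l t\<bar> \<le> Sup S" if "0 \<le> t" "t \<le> 1" for t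
    by (rule cSup_upper[OF _ bddS]) (use that in \<open>auto simp: S_def\<close>)
  have half: "\<bar>l t\<bar> \<le> (Sup S + D) / 2" if "0 \<le> t" "t \<le> 1 / 2" for t
    using ladd[of t t] le[of "t + t"] that by simp
  have "Sup S \<le> (Sup S + D) / 2 + D"
  proof (rule cSup_least)
    fix y assume "y \<in> S"
    then obtain t where t: "0 \<le> t" "t \<le> 1" and y: "y = \<bar>l t\<bar>" by (auto simp: S_def)
    have D: "0 \<le> D" using add[of 0 0] by (simp add: abs_le_iff)
    show "y \<le> (Sup S + D) / 2 + D"
    proof (cases "t \<le> 1 / 2")
      case True then show ?thesis using half[of t] t(1) y D by linarith
    next
      case False
      have "l (t + (1 - t)) = 0" by (simp add: l_def)
      moreover have "\<bar>l (1 - t)\<bar> \<le> (Sup S + D) / 2" using half[of "1 - t"] t False by simp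
      moreover have "\<bar>l (t + (1 - t)) - l t - l (1 - t)\<bar> \<le> D" using ladd[of t "1 - t"] t by simp
      ultimately show ?thesis using y by linarith
    qed
  qed (auto simp: S_def)
  then have "Sup S \<le> 3 * D" by (simp add: field_simps)
  with le[OF t] show ?thesis by (simp add: l_def)
qed

locale almost_linear = seminorm N for N :: "'a::real_vector \<Rightarrow> real" +
  fixes h :: "'a \<Rightarrow> real" and D :: real
  assumes odd: "h (- x) = - h x"
    and almost_additive: "\<lbrakk>N x \<le> 1; N y \<le> 1\<rbrakk> \<Longrightarrow> \<bar>h (x + y) - h x - h y\<bar> \<le> D"
    and segment_bounded: "N x \<le> 1 \<Longrightarrow> \<exists>B. \<forall>t. 0 \<le> t \<longrightarrow> t \<le> 1 \<longrightarrow> \<bar>h (t *\<^sub>R x)\<bar> \<le> B"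
    and null: "N x = 0 \<Longrightarrow> h x = 0"
begin

lemma D_nonneg: "0 \<le> D"
  using almost_additive[of 0 0] by (simp add: abs_le_iff)

lemma almost_homogeneous:
  assumes "N x \<le> 1" "0 \<le> t" "t \<le> 1"
  shows "\<bar>h (t *\<^sub>R x) - t * h x\<bar> \<le> 3 * D"
proof -
  obtain B where B: "\<And>t. 0 \<le> t \<Longrightarrow> t \<le> 1 \<Longrightarrow> \<bar>h (t *\<^sub>R x)\<bar> \<le> B"
    using segment_bounded[OF assms(1)] by blast
  have "\<bar>h ((s + t) *\<^sub>R x) - h (s *\<^sub>R x) - h (t *\<^sub>R x)\<bar> \<le> D" if "0 \<le> s" "0 \<le> t" "s + t \<le> 1" for s t
    unfolding scaleR_add_left
    by (rule almost_additive) (use that assms(1) in \<open>auto simp: scale mult_le_one\<close>)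
  from almost_additive_real[of "\<lambda>t. h (t *\<^sub>R x)", OF this B assms(2,3)] show ?thesis by simp
qed

definition homogenization :: "'a \<Rightarrow> real" where
  "homogenization x = N x * h (inverse (N x) *\<^sub>R x)"

lemma homogenization_null: "N x = 0 \<Longrightarrow> homogenization x = 0"
  by (simp add: homogenization_def)

lemma homogenization_scale: "0 \<le> c \<Longrightarrow> homogenization (c *\<^sub>R x) = c * homogenization x"
proof -
  assume c: "0 \<le> c"
  have inv: "inverse (N (c *\<^sub>R x)) *\<^sub>R c *\<^sub>R x = inverse (N x) *\<^sub>R x" if "c \<noteq> 0"
  proof -
    have "inverse (c * N x) * c = inverse (N x)" using that by (simp add: field_simps)
    then show ?thesis using c by (simp only: scale scaleR_scaleR abs_of_nonneg)
  qed
  then show ?thesis using c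
    by (cases "c = 0") (simp_all only: homogenization_def inv not_False_eq_True, simp_all add: scale)
qed

lemma homogenization_minus: "homogenization (- x) = - homogenization x"
  by (simp add: homogenization_def odd)

lemma homogenization_close:
  assumes "N x \<le> 1"
  shows "\<bar>homogenization x - h x\<bar> \<le> 3 * D"
proof (cases "N x = 0")
  case True then show ?thesis using D_nonneg by (simp add: homogenization_null null)
next
  case False
  then have "N (inverse (N x) *\<^sub>R x) \<le> 1" by (simp add: scale)
  from almost_homogeneous[OF this, of "N x"] show ?thesis
    using False assms by (simp add: homogenization_def abs_minus_commute)
qed

text \<open>
Both sides are positively homogeneous, so the vectors can be scaled until \<open>N x + N y = 1\<close>. There the
homogenization is within \<open>3 D\<close> of \<open>h\<close> at the three points.
\<close>

lemma homogenization_almost_additive: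
  "\<bar>homogenization (x + y) - homogenization x - homogenization y\<bar> \<le> 10 * D * (N x + N y)"
proof (cases "N x + N y = 0")
  case True
  then have "N x = 0" "N y = 0" using nonneg[of x] nonneg[of y] by linarith+
  moreover from this have "N (x + y) = 0" using triangle[of x y] nonneg[of "x + y"] by linarith
  ultimately show ?thesis by (simp add: homogenization_null)
next
  case False
  define s where "s = N x + N y"
  have s: "s > 0" using False nonneg[of x] nonneg[of y] unfolding s_def by linarith
  let ?F = homogenization
  define x' y' where "x' = inverse s *\<^sub>R x" and "y' = inverse s *\<^sub>R y"
  have N': "N x' \<le> 1" "N y' \<le> 1" "N (x' + y') \<le> 1"
  proof -
    show "N x' \<le> 1" "N y' \<le> 1" using s by (auto simp: x'_def y'_def scale s_def field_simps)
    have "N x' + N y' = inverse s * s" using s by (simp add: x'_def y'_def scale s_def algebra_simps)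
    then have "N x' + N y' = 1" using s by simp
    then show "N (x' + y') \<le> 1" using triangle[of x' y'] by simp
  qed
  have xy: "x = s *\<^sub>R x'" "y = s *\<^sub>R y'" "x + y = s *\<^sub>R (x' + y')"
    using s by (auto simp: x'_def y'_def scaleR_add_right)
  have "\<bar>?F (x' + y') - ?F x' - ?F y'\<bar> \<le> 10 * D"
    using homogenization_close[OF N'(1)] homogenization_close[OF N'(2)] homogenization_close[OF N'(3)]
      almost_additive[OF N'(1,2)] by linarith
  then have "s * \<bar>?F (x' + y') - ?F x' - ?F y'\<bar> \<le> s * (10 * D)"
    using s by (intro mult_left_mono) auto
  moreover have "?F (x + y) - ?F x - ?F y = s * (?F (x' + y') - ?F x' - ?F y')"
    unfolding xy(3) unfolding xy(1,2) using s by (simp only: homogenization_scale less_imp_le right_diff_distrib)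
  ultimately show ?thesis using s by (simp add: abs_mult mult_ac flip: s_def)
qed

end

text \<open>
The list is summed along a binary tree. Each of the \<open>k\<close> levels adds an error of at most \<open>c\<close> times the
sum of the norms of all entries, so the error grows with the logarithm of the length.
\<close>

lemma (in seminorm) almost_additive_sum_list:
  fixes F :: "'a \<Rightarrow> real"
  assumes add: "\<And>x y. \<bar>F (x + y) - F x - F y\<bar> \<le> c * (N x + N y)" and F0: "F 0 = 0" and "0 \<le> c"
  shows "length xs \<le> 2 ^ k \<Longrightarrow> \<bar>F (sum_list xs) - (\<Sum>x\<leftarrow>xs. F x)\<bar> \<le> c * real k * (\<Sum>x\<leftarrow>xs. N x)"
proof (induction k arbitrary: xs)
  case 0
  then have "length xs = 0 \<or> length xs = 1" by (auto simp: le_Suc_eq)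
  then have "xs = [] \<or> (\<exists>x. xs = [x])" by (auto simp: length_Suc_conv)
  then show ?case using F0 by auto
next
  case (Suc k)
  define ys zs where "ys = take (2 ^ k) xs" and "zs = drop (2 ^ k) xs"
  have xs: "xs = ys @ zs" by (simp add: ys_def zs_def)
  have "length ys \<le> 2 ^ k" "length zs \<le> 2 ^ k" using Suc.prems by (auto simp: ys_def zs_def)
  then have IH: "\<bar>F (sum_list ys) - (\<Sum>x\<leftarrow>ys. F x)\<bar> \<le> c * real k * (\<Sum>x\<leftarrow>ys. N x)"
    "\<bar>F (sum_list zs) - (\<Sum>x\<leftarrow>zs. F x)\<bar> \<le> c * real k * (\<Sum>x\<leftarrow>zs. N x)"
    using Suc.IH by blast+
  have "\<bar>F (sum_list ys + sum_list zs) - F (sum_list ys) - F (sum_list zs)\<bar>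
      \<le> c * (N (sum_list ys) + N (sum_list zs))" by (rule add)
  also have "\<dots> \<le> c * ((\<Sum>x\<leftarrow>ys. N x) + (\<Sum>x\<leftarrow>zs. N x))"
    using sum_list_le \<open>0 \<le> c\<close> by (intro mult_left_mono add_mono) auto
  finally show ?case using IH by (simp add: xs algebra_simps)
qed

section \<open>Vanishing sums with few terms\<close>

lemma exists_linear_dependency:
  fixes a :: "nat \<Rightarrow> nat \<Rightarrow> real"
  assumes "m < k"
  shows "\<exists>d. (\<exists>j<k. d j \<noteq> 0) \<and> (\<forall>i<m. (\<Sum>j<k. a i j * d j) = 0)"
proof -
  define A where "A = mat k k (\<lambda>(i, j). if i < m then a i j else 0)"
  have A: "A \<in> carrier_mat k k" by (simp add: A_def)
  have "A = mat\<^sub>r k k (\<lambda>i. if i = m then 0\<^sub>v k else row A i)"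
    using assms by (intro eq_matI) (auto simp: A_def)
  then have "det A = 0" using det_row_0[OF assms, of "row A"] A by auto
  then obtain v where v: "v \<in> carrier_vec k" "v \<noteq> 0\<^sub>v k" "A *\<^sub>v v = 0\<^sub>v k"
    using det_0_iff_vec_prod_zero[OF A] by blast
  have "\<exists>j<k. v $ j \<noteq> 0" using v(1,2) by (metis carrier_vecD eq_vecI index_zero_vec)
  moreover have "(\<Sum>j<k. a i j * v $ j) = 0" if "i < m" for i
  proof -
    have "(A *\<^sub>v v) $ i = (\<Sum>j<k. a i j * v $ j)"
      using that assms v(1) by (auto simp: A_def scalar_prod_def lessThan_atLeast0 intro!: sum.cong)
    then show ?thesis using v(3) that assms by simp
  qed
  ultimately show ?thesis by blast
qed

text \<open>
One step of the proof of Caratheodory's theorem for cones. The \<open>n\<close> coordinates and the values of \<open>v\<close>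
impose \<open>n + 1\<close> linear conditions on the weights of at least \<open>n + 2\<close> vectors. Hence the weights can
be moved from 1 along a line on which the sum and the total value of \<open>v\<close> stay constant, until one
of them vanishes.
\<close>

lemma remove_term_of_null_sum:
  fixes v :: "(nat \<Rightarrow> real) \<Rightarrow> real"
  assumes hom: "\<And>c x. 0 \<le> c \<Longrightarrow> v (c *\<^sub>R x) = c * v x"
    and null: "\<forall>i<n. sum_list xs i = 0" and len: "n + 2 \<le> length xs"
  shows "\<exists>ys. length ys < length xs \<and> (\<forall>i<n. sum_list ys i = 0) \<and> (\<Sum>y\<leftarrow>ys. v y) = (\<Sum>x\<leftarrow>xs. v x)"
proof -
  define k where "k = length xs"
  define a where "a i j = (if i < n then (xs ! j) i else v (xs ! j))" for i j
  obtain d0 where d0: "\<exists>j<k. d0 j \<noteq> 0" "\<forall>i<n+1. (\<Sum>j<k. a i j * d0 j) = 0"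
    using exists_linear_dependency[of "n + 1" k a] len by (auto simp: k_def)
  \<comment> \<open>With a negative coefficient present, moving the weights from 1 in the direction of the dependency makes one of them vanish.\<close>
  obtain d where d: "\<exists>j<k. d j < 0" "\<forall>i<n+1. (\<Sum>j<k. a i j * d j) = 0"
  proof -
    from d0(1) obtain j where j: "j < k" "d0 j \<noteq> 0" by blast
    show ?thesis
    proof (cases "d0 j < 0")
      case True then show ?thesis using that[of d0] d0 j by blast
    next
      case False
      then have "- d0 j < 0" using j by simp
      then show ?thesis using that[of "\<lambda>j. - d0 j"] d0(2) j(1) by (auto simp: sum_negf)
    qed
  qed
  define J where "J = {j. j < k \<and> d j < 0}"
  have J: "finite J" "J \<noteq> {}" using d(1) by (auto simp: J_def)
  \<comment> \<open>The first time at which a weight reaches 0; up to then all of them are nonnegative.\<close>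
  define t where "t = Min ((\<lambda>j. 1 / - d j) ` J)"
  have "t \<in> (\<lambda>j. 1 / - d j) ` J" unfolding t_def using J by (intro Min_in) auto
  then obtain j0 where j0: "j0 \<in> J" "t = 1 / - d j0" by blast
  define c where "c j = 1 + t * d j" for j
  have t: "0 \<le> t" unfolding j0(2) using j0(1) by (simp add: J_def)
  have c0: "c j0 = 0" using j0 by (auto simp: c_def J_def)
  have c: "0 \<le> c j" if "j < k" for j
  proof (cases "d j < 0")
    case True
    then have "t \<le> 1 / - d j" unfolding t_def using that J by (intro Min_le) (auto simp: J_def)
    then show ?thesis using True by (simp add: c_def field_simps)
  qed (use t in \<open>simp add: c_def\<close>)
  define zs where "zs = map (\<lambda>j. c j *\<^sub>R (xs ! j)) [0..<k]"
  define ys where "ys = remove1 0 zs"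
  have z0: "0 \<in> set zs" using j0(1) c0 by (auto simp: zs_def J_def image_iff intro!: bexI[of _ j0])
  have "length ys < length xs" using z0 by (simp add: ys_def length_remove1 zs_def k_def) (use len in auto)
  moreover have "sum_list ys i = 0" if "i < n" for i
  proof -
    have "sum_list ys = sum_list zs" using sum_list_map_remove1[OF z0, of "\<lambda>x. x"] by (simp add: ys_def)
    also have "\<dots> = (\<Sum>j<k. c j *\<^sub>R (xs ! j))"
      by (simp add: zs_def interv_sum_list_conv_sum_set_nat lessThan_atLeast0)
    finally have "sum_list ys i = (\<Sum>j<k. c j *\<^sub>R (xs ! j)) i" by (rule arg_cong)
    also have "\<dots> = (\<Sum>j<k. (xs ! j) i) + t * (\<Sum>j<k. a i j * d j)"
      using that by (simp add: sum_fun_apply c_def algebra_simps a_def sum.distrib sum_distrib_left)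
    also have "(\<Sum>j<k. (xs ! j) i) = (\<Sum>j<k. xs ! j) i" by (simp add: sum_fun_apply)
    also have "(\<Sum>j<k. xs ! j) = sum_list xs" by (simp add: sum_list_sum_nth k_def lessThan_atLeast0)
    finally show ?thesis using null d(2) that by simp
  qed
  moreover have "(\<Sum>y\<leftarrow>ys. v y) = (\<Sum>x\<leftarrow>xs. v x)"
  proof -
    have "v 0 = 0" using hom[of 0 0] by simp
    then have "(\<Sum>y\<leftarrow>ys. v y) = (\<Sum>y\<leftarrow>zs. v y)" using sum_list_map_remove1[OF z0, of v] by (simp add: ys_def)
    also have "\<dots> = (\<Sum>j<k. v (c j *\<^sub>R (xs ! j)))"
      by (simp add: zs_def interv_sum_list_conv_sum_set_nat lessThan_atLeast0 o_def)
    also have "\<dots> = (\<Sum>j<k. c j * v (xs ! j))" using c hom by (intro sum.cong) auto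
    also have "\<dots> = (\<Sum>j<k. v (xs ! j)) + t * (\<Sum>j<k. a n j * d j)"
      by (simp add: c_def algebra_simps a_def sum.distrib sum_distrib_left)
    also have "\<dots> = (\<Sum>j<k. v (xs ! j))" using d(2) by simp
    also have "\<dots> = (\<Sum>x\<leftarrow>xs. v x)" by (simp add: sum_list_sum_nth k_def lessThan_atLeast0)
    finally show ?thesis .
  qed
  ultimately show ?thesis by blast
qed

lemma shorten_null_sum:
  fixes v :: "(nat \<Rightarrow> real) \<Rightarrow> real"
  assumes hom: "\<And>c x. 0 \<le> c \<Longrightarrow> v (c *\<^sub>R x) = c * v x"
    and null: "\<forall>i<n. sum_list xs i = 0"
  shows "\<exists>ys. length ys \<le> n + 1 \<and> (\<forall>i<n. sum_list ys i = 0) \<and> (\<Sum>y\<leftarrow>ys. v y) = (\<Sum>x\<leftarrow>xs. v x)"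
  using null
proof (induction "length xs" arbitrary: xs rule: less_induct)
  case less
  show ?case
  proof (cases "length xs \<le> n + 1")
    case True then show ?thesis using less.prems by blast
  next
    case False
    then obtain zs where "length zs < length xs" "\<forall>i<n. sum_list zs i = 0"
      "(\<Sum>y\<leftarrow>zs. v y) = (\<Sum>x\<leftarrow>xs. v x)"
      using remove_term_of_null_sum[OF hom, of n xs] less.prems by auto
    with less.hyps[of zs] show ?thesis by auto
  qed
qed

section \<open>Sublinear functions and the Hahn-Banach theorem in finite dimension\<close>

definition sublinear :: "('a::real_vector \<Rightarrow> real) \<Rightarrow> bool" where
  "sublinear p \<longleftrightarrow> (\<forall>x y. p (x + y) \<le> p x + p y) \<and> (\<forall>c x. 0 \<le> c \<longrightarrow> p (c *\<^sub>R x) = c * p x)"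

lemma sublinearI:
  assumes "\<And>x y. p (x + y) \<le> p x + p y" and hom: "\<And>c x. 0 < c \<Longrightarrow> p (c *\<^sub>R x) \<le> c * p x" and "p 0 = 0"
  shows "sublinear p"
  unfolding sublinear_def
proof (intro conjI allI impI)
  fix c :: real and x assume "0 \<le> c"
  show "p (c *\<^sub>R x) = c * p x"
  proof (cases "c = 0")
    case False
    with \<open>0 \<le> c\<close> have c: "0 < c" by simp
    have "p x = p (inverse c *\<^sub>R c *\<^sub>R x)" using c by simp
    also have "\<dots> \<le> inverse c * p (c *\<^sub>R x)" using c by (intro hom) simp
    finally have "c * p x \<le> p (c *\<^sub>R x)" using c by (simp add: field_simps)
    with hom[OF c] show ?thesis by (simp add: order_antisym)
  qed (simp add: assms(3))
qed (use assms in auto)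

lemma sublinear_add: "sublinear p \<Longrightarrow> p (x + y) \<le> p x + p y"
  and sublinear_scale: "sublinear p \<Longrightarrow> 0 \<le> c \<Longrightarrow> p (c *\<^sub>R x) = c * p x"
  by (simp_all add: sublinear_def)

lemma sublinear_zero: "sublinear p \<Longrightarrow> p 0 = 0"
  using sublinear_scale[of p 0 0] by simp

lemma sublinear_minus: "sublinear p \<Longrightarrow> - p (- x) \<le> p x"
  using sublinear_add[of p x "- x"] by (simp add: sublinear_zero)

text \<open>
The minorant \<open>q\<close> satisfies \<open>q (- e) \<le> - p e \<le> - q e\<close>, where the first inequality is the term with
\<open>t = 1\<close> of the infimum that defines \<open>q\<close>. Sublinearity gives the reverse inequality.
\<close>

lemma sublinear_linear_along:
  assumes p: "sublinear p"
  shows "\<exists>q. sublinear q \<and> (\<forall>x. q x \<le> p x) \<and> q (- e) = - q e"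
proof -
  \<comment> \<open>Replacing p by this infimum forces linearity along e and never undoes linearity along another vector.\<close>
  define S where "S x = (\<lambda>t. p (x + t *\<^sub>R e) - t * p e) ` {0..}" for x
  define q where "q x = Inf (S x)" for x
  have ne: "S x \<noteq> {}" for x by (auto simp: S_def)
  have lower: "- p (- x) \<le> p (x + t *\<^sub>R e) - t * p e" if "0 \<le> t" for x t
    using sublinear_add[OF p, of "x + t *\<^sub>R e" "- x"] sublinear_scale[OF p that, of e] by simp
  have bdd: "bdd_below (S x)" for x
    unfolding S_def by (rule bdd_belowI[of _ "- p (- x)"]) (use lower in auto)
  have le: "q x \<le> p (x + t *\<^sub>R e) - t * p e" if "0 \<le> t" for x t
    unfolding q_def by (rule cInf_lower[OF _ bdd]) (use that in \<open>auto simp: S_def\<close>)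
  have ge: "a \<le> q x" if "\<And>t. 0 \<le> t \<Longrightarrow> a \<le> p (x + t *\<^sub>R e) - t * p e" for a x
    unfolding q_def by (rule cInf_greatest[OF ne]) (use that in \<open>auto simp: S_def\<close>)
  have q: "sublinear q"
  proof (rule sublinearI)
    fix x y
    have "q (x + y) - q y \<le> q x"
    proof (rule ge)
      fix s :: real assume s: "0 \<le> s"
      have "q (x + y) - (p (x + s *\<^sub>R e) - s * p e) \<le> q y"
      proof (rule ge)
        fix t :: real assume t: "0 \<le> t"
        have "q (x + y) \<le> p ((x + y) + (s + t) *\<^sub>R e) - (s + t) * p e" using s t by (intro le) auto
        also have "p ((x + y) + (s + t) *\<^sub>R e) \<le> p (x + s *\<^sub>R e) + p (y + t *\<^sub>R e)"
          using sublinear_add[OF p, of "x + s *\<^sub>R e" "y + t *\<^sub>R e"] by (simp add: algebra_simps)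
        finally show "q (x + y) - (p (x + s *\<^sub>R e) - s * p e) \<le> p (y + t *\<^sub>R e) - t * p e"
          by (simp add: algebra_simps)
      qed
      then show "q (x + y) - q y \<le> p (x + s *\<^sub>R e) - s * p e" by simp
    qed
    then show "q (x + y) \<le> q x + q y" by simp
  next
    fix c :: real and x assume c: "0 < c"
    have "q (c *\<^sub>R x) / c \<le> q x"
    proof (rule ge)
      fix t :: real assume t: "0 \<le> t"
      have "q (c *\<^sub>R x) \<le> p (c *\<^sub>R x + (c * t) *\<^sub>R e) - (c * t) * p e" using c t by (intro le) auto
      also have "c *\<^sub>R x + (c * t) *\<^sub>R e = c *\<^sub>R (x + t *\<^sub>R e)" by (simp add: algebra_simps)
      also have "p (c *\<^sub>R (x + t *\<^sub>R e)) = c * p (x + t *\<^sub>R e)" using c by (intro sublinear_scale[OF p]) simp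
      finally show "q (c *\<^sub>R x) / c \<le> p (x + t *\<^sub>R e) - t * p e" using c by (simp add: field_simps)
    qed
    then show "q (c *\<^sub>R x) \<le> c * q x" using c by (simp add: field_simps)
  next
    show "q 0 = 0"
    proof (rule antisym)
      show "q 0 \<le> 0" using le[of 0 0] by (simp add: sublinear_zero[OF p])
      show "0 \<le> q 0" by (rule ge) (simp add: sublinear_scale[OF p])
    qed
  qed
  have qp: "q x \<le> p x" for x using le[of 0 x] by simp
  have "q (- e) \<le> - p e" using le[of 1 "- e"] by (simp add: sublinear_zero[OF p])
  then have "q (- e) \<le> - q e" using qp[of e] by simp
  moreover have "- q e \<le> q (- e)" using sublinear_minus[OF q, of e] by simp
  ultimately show ?thesis using q qp by (auto intro!: exI[of _ q])
qed

text \<open>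
Linearity along a vector is inherited by sublinear minorants: \<open>r \<le> q\<close> and \<open>q (- e) = - q e\<close> give
\<open>r (- e) + r e \<le> 0\<close>. So the vectors can be treated one after the other.
\<close>

lemma sublinear_linear_along_all:
  fixes e :: "nat \<Rightarrow> 'a::real_vector"
  assumes p: "sublinear p"
  shows "\<exists>q. sublinear q \<and> (\<forall>x. q x \<le> p x) \<and> (\<forall>i<n. q (- e i) = - q (e i))"
proof (induction n)
  case 0 then show ?case using p by auto
next
  case (Suc n)
  then obtain q where q: "sublinear q" "\<And>x. q x \<le> p x" "\<And>i. i < n \<Longrightarrow> q (- e i) = - q (e i)" by blast
  obtain r where r: "sublinear r" "\<And>x. r x \<le> q x" "r (- e n) = - r (e n)"
    using sublinear_linear_along[OF q(1)] by blast
  have "r (- e i) = - r (e i)" if "i < n" for i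
    using r(2)[of "- e i"] r(2)[of "e i"] q(3)[OF that] sublinear_minus[OF r(1), of "e i"] by simp
  with r q(2) show ?case by (intro exI[of _ r]) (auto simp: less_Suc_eq intro: order_trans)
qed

definition unit_fun :: "nat \<Rightarrow> nat \<Rightarrow> real" where
  "unit_fun i = (\<lambda>j. if j = i then 1 else 0)"

lemma sum_unit_fun: "i < n \<Longrightarrow> (\<Sum>j<n. x j *\<^sub>R unit_fun j) i = x i"
  by (simp add: sum_fun_apply unit_fun_def if_distrib[of "\<lambda>u. _ * u"] cong: if_cong)

text \<open>
A sublinear minorant that is linear along each basis vector is linear.
\<close>

lemma finite_dimensional_Hahn_Banach:
  fixes p :: "(nat \<Rightarrow> real) \<Rightarrow> real"
  assumes p: "sublinear p" and null: "\<And>x. \<forall>i<n. x i = 0 \<Longrightarrow> p x \<le> 0"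
  shows "\<exists>a. \<forall>x. (\<Sum>i<n. a i * x i) \<le> p x"
proof -
  obtain q where q: "sublinear q" "\<And>x. q x \<le> p x" "\<And>i. i < n \<Longrightarrow> q (- unit_fun i) = - q (unit_fun i)"
    using sublinear_linear_along_all[OF p, of n unit_fun] by blast
  define a where "a i = q (unit_fun i)" for i
  have q_unit: "q (c *\<^sub>R unit_fun i) = c * a i" if "i < n" for c i
  proof (cases "0 \<le> c")
    case True then show ?thesis by (simp add: sublinear_scale[OF q(1)] a_def)
  next
    case False
    have "q (c *\<^sub>R unit_fun i) = q ((- c) *\<^sub>R (- unit_fun i))" by simp
    also have "\<dots> = c * a i" using False q(3)[OF that] by (subst sublinear_scale[OF q(1)]) (auto simp: a_def)
    finally show ?thesis .
  qed
  have upper: "q (\<Sum>i<m. y i *\<^sub>R unit_fun i) \<le> (\<Sum>i<m. a i * y i)" if "m \<le> n" for y m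
    using that
  proof (induction m)
    case (Suc m)
    have "q (\<Sum>i<Suc m. y i *\<^sub>R unit_fun i) \<le> q (\<Sum>i<m. y i *\<^sub>R unit_fun i) + q (y m *\<^sub>R unit_fun m)"
      unfolding sum.lessThan_Suc by (rule sublinear_add[OF q(1)])
    moreover have "q (\<Sum>i<m. y i *\<^sub>R unit_fun i) \<le> (\<Sum>i<m. a i * y i)"
      using Suc.prems by (intro Suc.IH) (rule Suc_leD)
    moreover have "q (y m *\<^sub>R unit_fun m) = y m * a m" using Suc.prems by (intro q_unit) simp
    ultimately show ?case unfolding sum.lessThan_Suc by (simp only: mult.commute)
  qed (simp add: sublinear_zero[OF q(1)])
  have "(\<Sum>i<n. a i * x i) \<le> p x" for x
  proof -
    define y where "y = (\<Sum>i<n. x i *\<^sub>R unit_fun i)"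
    have "q (- y) \<le> (\<Sum>i<n. a i * (- x i))"
      using upper[of n "\<lambda>i. - x i"] by (simp add: y_def sum_negf)
    then have "(\<Sum>i<n. a i * x i) \<le> - q (- y)" by (simp add: sum_negf)
    also have "\<dots> \<le> q y" by (rule sublinear_minus[OF q(1)])
    also have "\<dots> \<le> q x + q (y - x)" using sublinear_add[OF q(1), of x "y - x"] by simp
    also have "q (y - x) \<le> p (y - x)" by (rule q(2))
    also have "p (y - x) \<le> 0" by (rule null) (simp add: y_def sum_unit_fun)
    also have "q x \<le> p x" by (rule q(2))
    finally show ?thesis by simp
  qed
  then show ?thesis by blast
qed

section \<open>Almost linear functions are near linear ones\<close>

text \<open>
A linear function between \<open>F - K N\<close> and \<open>F + K N\<close> exists by Hahn-Banach as soon as the sublinear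
function generated by \<open>v = F + K N\<close> is finite, that is, as soon as \<open>\<Sum> v y \<ge> 0\<close> whenever the vectors
\<open>y\<close> sum to 0: a linear function below \<open>v\<close> is above \<open>F - K N\<close>, because \<open>F\<close> is odd. A vanishing sum can be replaced
by one with at most \<open>n + 1 \<le> 2 ^ k\<close> terms, and for those the error of additivity is at most
\<open>c k\<close> times the sum of the norms.
\<close>

lemma linear_between:
  fixes F :: "(nat \<Rightarrow> real) \<Rightarrow> real" and N :: "(nat \<Rightarrow> real) \<Rightarrow> real"
  assumes N: "seminorm N" and null: "\<And>x. \<forall>i<n. x i = 0 \<Longrightarrow> N x = 0 \<and> F x = 0"
    and hom: "\<And>c x. 0 \<le> c \<Longrightarrow> F (c *\<^sub>R x) = c * F x" and odd: "\<And>x. F (- x) = - F x"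
    and add: "\<And>x y. \<bar>F (x + y) - F x - F y\<bar> \<le> c * (N x + N y)" and c: "0 \<le> c"
    and k: "n + 1 \<le> 2 ^ k"
  shows "\<exists>a. \<forall>x. \<bar>F x - (\<Sum>i<n. a i * x i)\<bar> \<le> c * real k * N x"
proof -
  interpret seminorm N by (rule N)
  define K where "K = c * real k"
  have K: "0 \<le> K" using c by (simp add: K_def)
  define v where "v x = F x + K * N x" for x
  have vhom: "v (c *\<^sub>R x) = c * v x" if "0 \<le> c" for c x
    using that by (simp add: v_def hom scale algebra_simps)
  have F0: "F 0 = 0" using hom[of 0 0] by simp
  have v0: "v 0 = 0" by (simp add: v_def F0)
  \<comment> \<open>Shortening to n + 1 vectors first is what makes the constant depend on n only.\<close>
  have null_sum: "0 \<le> (\<Sum>x\<leftarrow>xs. v x)" if xs: "\<forall>i<n. sum_list xs i = 0" for xs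
  proof -
    obtain ys where ys: "length ys \<le> n + 1" "\<forall>i<n. sum_list ys i = 0" "(\<Sum>y\<leftarrow>ys. v y) = (\<Sum>x\<leftarrow>xs. v x)"
      using shorten_null_sum[of v n xs, OF vhom xs] by blast
    have "\<bar>F (sum_list ys) - (\<Sum>x\<leftarrow>ys. F x)\<bar> \<le> K * (\<Sum>x\<leftarrow>ys. N x)"
      unfolding K_def using ys(1) k by (intro almost_additive_sum_list add F0 c) auto
    then have "0 \<le> (\<Sum>x\<leftarrow>ys. F x) + K * (\<Sum>x\<leftarrow>ys. N x)" using null[OF ys(2)] by simp
    also have "\<dots> = (\<Sum>y\<leftarrow>ys. v y)" by (simp add: v_def sum_list_addf sum_list_const_mult)
    finally show ?thesis using ys(3) by simp
  qed
  define S where "S x = {\<Sum>y\<leftarrow>ys. v y | ys. sum_list ys = x}" for x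
  \<comment> \<open>The largest sublinear function below v.\<close>
  define p where "p x = Inf (S x)" for x
  have ne: "S x \<noteq> {}" for x by (auto simp: S_def intro!: exI[of _ "[x]"])
  have bdd: "bdd_below (S x)" for x
  proof (rule bdd_belowI[of _ "- v (- x)"])
    fix s assume "s \<in> S x"
    then obtain ys where ys: "sum_list ys = x" and s: "s = (\<Sum>y\<leftarrow>ys. v y)" by (auto simp: S_def)
    from null_sum[of "(- x) # ys"] ys s show "- v (- x) \<le> s" by simp
  qed
  have le: "p (sum_list ys) \<le> (\<Sum>y\<leftarrow>ys. v y)" for ys
    unfolding p_def by (rule cInf_lower[OF _ bdd]) (auto simp: S_def)
  have ge: "a \<le> p x" if "\<And>ys. sum_list ys = x \<Longrightarrow> a \<le> (\<Sum>y\<leftarrow>ys. v y)" for a x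
    unfolding p_def by (rule cInf_greatest[OF ne]) (use that in \<open>auto simp: S_def\<close>)
  have p: "sublinear p"
  proof (rule sublinearI)
    fix x y
    have "p (x + y) - p y \<le> p x"
    proof (rule ge)
      fix xs :: "(nat \<Rightarrow> real) list" assume xs: "sum_list xs = x"
      have "p (x + y) - (\<Sum>y\<leftarrow>xs. v y) \<le> p y"
      proof (rule ge)
        fix ys :: "(nat \<Rightarrow> real) list" assume ys: "sum_list ys = y"
        show "p (x + y) - (\<Sum>y\<leftarrow>xs. v y) \<le> (\<Sum>y\<leftarrow>ys. v y)"
          using le[of "xs @ ys"] xs ys by simp
      qed
      then show "p (x + y) - p y \<le> (\<Sum>y\<leftarrow>xs. v y)" by simp
    qed
    then show "p (x + y) \<le> p x + p y" by simp
  next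
    fix c :: real and x assume c: "0 < c"
    have "p (c *\<^sub>R x) / c \<le> p x"
    proof (rule ge)
      fix xs :: "(nat \<Rightarrow> real) list" assume xs: "sum_list xs = x"
      have "sum_list (map ((*\<^sub>R) c) xs) = c *\<^sub>R x"
        unfolding xs[symmetric] by (induction xs) (auto simp: fun_eq_iff algebra_simps)
      moreover have "(\<Sum>y\<leftarrow>map ((*\<^sub>R) c) xs. v y) = c * (\<Sum>y\<leftarrow>xs. v y)"
        using c by (simp add: o_def vhom sum_list_const_mult)
      ultimately have "p (c *\<^sub>R x) \<le> c * (\<Sum>y\<leftarrow>xs. v y)"
        using le[of "map ((*\<^sub>R) c) xs"] by simp
      then show "p (c *\<^sub>R x) / c \<le> (\<Sum>y\<leftarrow>xs. v y)" using c by (simp add: field_simps)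
    qed
    then show "p (c *\<^sub>R x) \<le> c * p x" using c by (simp add: field_simps)
  next
    show "p 0 = 0"
      using le[of "[]"] ge[of 0 0] null_sum by (intro antisym) auto
  qed
  have pv: "p x \<le> v x" for x using le[of "[x]"] by simp
  have "\<exists>a. \<forall>x. (\<Sum>i<n. a i * x i) \<le> p x"
  proof (rule finite_dimensional_Hahn_Banach[OF p])
    fix x :: "nat \<Rightarrow> real" assume "\<forall>i<n. x i = 0"
    then show "p x \<le> 0" using pv[of x] null[of x] by (simp add: v_def)
  qed
  then obtain a where a: "\<And>x. (\<Sum>i<n. a i * x i) \<le> p x" by blast
  have "\<bar>F x - (\<Sum>i<n. a i * x i)\<bar> \<le> K * N x" for x
  proof -
    have "(\<Sum>i<n. a i * x i) \<le> F x + K * N x" using a[of x] pv[of x] by (simp add: v_def)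
    moreover have "- (\<Sum>i<n. a i * x i) \<le> - F x + K * N x"
      using a[of "- x"] pv[of "- x"] by (simp add: v_def odd sum_negf)
    ultimately show ?thesis by (simp add: abs_le_iff)
  qed
  then show ?thesis unfolding K_def by blast
qed

lemma ln2_ge_half: "1 / 2 \<le> ln (2::real)"
proof -
  have "exp (1 / 2 :: real) ^ 2 \<le> 2 ^ 2"
    using exp_le by (simp flip: exp_of_nat_mult)
  then have "exp (1 / 2 :: real) \<le> 2" by (rule power2_le_imp_le) simp
  then have "1 / 2 \<le> ln (2::real)" by (subst ln_ge_iff) auto
  then show ?thesis .
qed

lemma ln_power_bound:
  assumes "1 \<le> n"
  shows "\<exists>k. n + 1 \<le> 2 ^ k \<and> real k \<le> 4 * ln (real n + 1)"
proof -
  define k where "k = nat \<lceil>log 2 (real n + 1)\<rceil>"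
  have pos: "0 < log 2 (real n + 1)" using assms by simp
  have k1: "log 2 (real n + 1) \<le> real k" and k2: "real k \<le> log 2 (real n + 1) + 1"
    unfolding k_def using pos by linarith+
  have "real n + 1 = 2 powr (log 2 (real n + 1))" by simp
  also have "\<dots> \<le> 2 powr (real k)" using k1 by (intro powr_mono) auto
  also have "\<dots> = 2 ^ k" by (simp add: powr_realpow)
  finally have "real (n + 1) \<le> real (2 ^ k)" by simp
  then have 1: "n + 1 \<le> 2 ^ k" by (simp only: of_nat_le_iff)
  have ln2: "1 / 2 \<le> ln (2::real)" by (rule ln2_ge_half)
  have lnn: "ln 2 \<le> ln (real n + 1)" using assms by simp
  have "log 2 (real n + 1) = ln (real n + 1) / ln 2" by (simp add: log_def)
  also have "\<dots> \<le> ln (real n + 1) / (1 / 2)" using ln2 assms by (intro divide_left_mono) auto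
  finally have "log 2 (real n + 1) \<le> 2 * ln (real n + 1)" by simp
  moreover have "1 \<le> 2 * ln (real n + 1)" using ln2 lnn by linarith
  ultimately show ?thesis using 1 k2 by (intro exI[of _ k]) auto
qed

text \<open>
The logarithm is the depth of a binary tree with \<open>n + 1\<close> leaves.
\<close>

theorem almost_linear_near_linear:
  fixes N :: "(nat \<Rightarrow> real) \<Rightarrow> real"
  assumes "almost_linear N h D" and null: "\<And>x. \<forall>i<n. x i = 0 \<Longrightarrow> N x = 0" and n: "1 \<le> n"
  shows "\<exists>a. \<forall>x. N x \<le> 1 \<longrightarrow> \<bar>h x - (\<Sum>i<n. a i * x i)\<bar> \<le> 46 * D * ln (real n + 1)"
proof -
  interpret almost_linear N h D by fact
  obtain k where k: "n + 1 \<le> 2 ^ k" "real k \<le> 4 * ln (real n + 1)"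
    using ln_power_bound[OF n] by blast
  obtain a where a: "\<And>x. \<bar>homogenization x - (\<Sum>i<n. a i * x i)\<bar> \<le> 10 * D * real k * N x"
  proof -
    have "\<exists>a. \<forall>x. \<bar>homogenization x - (\<Sum>i<n. a i * x i)\<bar> \<le> 10 * D * real k * N x"
      by (rule linear_between[OF seminorm_axioms _ homogenization_scale homogenization_minus
          homogenization_almost_additive _ k(1)])
         (simp_all add: assms(2) homogenization_null D_nonneg)
    then show ?thesis using that by blast
  qed
  have "1 / 2 \<le> ln (2::real)" by (rule ln2_ge_half)
  also have "ln 2 \<le> ln (real n + 1)" using n by simp
  finally have l: "1 / 2 \<le> ln (real n + 1)" .
  have "\<bar>h x - (\<Sum>i<n. a i * x i)\<bar> \<le> 46 * D * ln (real n + 1)" if x: "N x \<le> 1" for x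
  proof -
    have "10 * D * real k * N x \<le> 10 * D * real k * 1"
      using D_nonneg x by (intro mult_left_mono) auto
    also have "\<dots> \<le> 10 * D * (4 * ln (real n + 1))"
      using D_nonneg k(2) by (simp only: mult_1_right) (intro mult_left_mono, auto)
    finally have 1: "\<bar>homogenization x - (\<Sum>i<n. a i * x i)\<bar> \<le> 40 * D * ln (real n + 1)"
      using a[of x] by linarith
    have "3 * D = D * 3" by simp
    also have "\<dots> \<le> D * (6 * ln (real n + 1))" using D_nonneg l by (intro mult_left_mono) auto
    finally have "3 * D \<le> 6 * D * ln (real n + 1)" by simp
    with 1 homogenization_close[OF x] show ?thesis by linarith
  qed
  then show ?thesis by blast
qed

section \<open>Linear expansions with small coefficients\<close>

text \<open>
Sylvester's determinant identity in rank one: the product of the block matrices \<open>M\<close> and \<open>U\<close>, taken in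
both orders, is block triangular, with \<open>1 + x \<bullet> u\<close> or the given matrix as its essential diagonal block.
\<close>

lemma det_one_plus_rank_one:
  fixes u x :: "nat \<Rightarrow> real"
  shows "det (mat n n (\<lambda>(i, k). (if i = k then 1 else 0) + u i * x k)) = 1 + (\<Sum>i<n. x i * u i)"
proof -
  define c where "c v = mat n 1 (\<lambda>(i, k). v i)" for v :: "nat \<Rightarrow> real"
  define r where "r v = mat 1 n (\<lambda>(i, k). v k)" for v :: "nat \<Rightarrow> real"
  define B where "B = mat n n (\<lambda>(i, k). (if i = k then 1 else 0) + u i * x k)"
  define U where "U = four_block_mat (1\<^sub>m n) (c u) (0\<^sub>m 1 n) (1\<^sub>m 1)"
  define M where "M = four_block_mat (1\<^sub>m n) (c (\<lambda>i. - u i)) (r x) (1\<^sub>m 1)"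
  have cr [simp]: "c v \<in> carrier_mat n (Suc 0)" "r v \<in> carrier_mat (Suc 0) n" for v
    by (auto simp: c_def r_def)
  have B: "B \<in> carrier_mat n n" by (simp add: B_def)
  have U: "U \<in> carrier_mat (n + 1) (n + 1)" and M: "M \<in> carrier_mat (n + 1) (n + 1)"
    unfolding U_def M_def by (intro four_block_carrier_mat; simp)+
  have 1: "M * U = four_block_mat (1\<^sub>m n) (0\<^sub>m n 1) (r x) (mat 1 1 (\<lambda>_. 1 + (\<Sum>i<n. x i * u i)))"
  proof -
    have "M * U = four_block_mat (1\<^sub>m n * 1\<^sub>m n + c (\<lambda>i. - u i) * 0\<^sub>m 1 n) (1\<^sub>m n * c u + c (\<lambda>i. - u i) * 1\<^sub>m 1)
       (r x * 1\<^sub>m n + 1\<^sub>m 1 * 0\<^sub>m 1 n) (r x * c u + 1\<^sub>m 1 * 1\<^sub>m 1)"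
      unfolding M_def U_def by (rule mult_four_block_mat[of _ n n _ 1 _ 1 _ _ n _ 1]) simp_all
    moreover have "1\<^sub>m n * 1\<^sub>m n + c (\<lambda>i. - u i) * 0\<^sub>m 1 n = 1\<^sub>m n"
      "1\<^sub>m n * c u + c (\<lambda>i. - u i) * 1\<^sub>m 1 = 0\<^sub>m n 1"
      "r x * 1\<^sub>m n + 1\<^sub>m 1 * 0\<^sub>m 1 n = r x"
      "r x * c u + 1\<^sub>m 1 * 1\<^sub>m 1 = mat 1 1 (\<lambda>_. 1 + (\<Sum>i<n. x i * u i))"
      by (auto simp: c_def r_def scalar_prod_def lessThan_atLeast0 intro!: eq_matI)
    ultimately show ?thesis by simp
  qed
  have 2: "U * M = four_block_mat B (0\<^sub>m n 1) (r x) (1\<^sub>m 1)"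
  proof -
    have "U * M = four_block_mat (1\<^sub>m n * 1\<^sub>m n + c u * r x) (1\<^sub>m n * c (\<lambda>i. - u i) + c u * 1\<^sub>m 1)
       (0\<^sub>m 1 n * 1\<^sub>m n + 1\<^sub>m 1 * r x) (0\<^sub>m 1 n * c (\<lambda>i. - u i) + 1\<^sub>m 1 * 1\<^sub>m 1)"
      unfolding M_def U_def by (rule mult_four_block_mat[of _ n n _ 1 _ 1 _ _ n _ 1]) simp_all
    moreover have "1\<^sub>m n * 1\<^sub>m n + c u * r x = B"
      "1\<^sub>m n * c (\<lambda>i. - u i) + c u * 1\<^sub>m 1 = 0\<^sub>m n 1"
      "0\<^sub>m 1 n * 1\<^sub>m n + 1\<^sub>m 1 * r x = r x"
      "0\<^sub>m 1 n * c (\<lambda>i. - u i) + 1\<^sub>m 1 * 1\<^sub>m 1 = 1\<^sub>m 1"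
      by (auto simp: c_def r_def B_def scalar_prod_def intro!: eq_matI)
    ultimately show ?thesis by simp
  qed
  have "transpose_mat (c u) = r u" by (auto simp: c_def r_def intro!: eq_matI)
  then have "transpose_mat U = four_block_mat (1\<^sub>m n) (0\<^sub>m n 1) (r u) (1\<^sub>m 1)"
    unfolding U_def by (subst transpose_four_block_mat[of _ n n _ 1 _ 1]) simp_all
  then have "det (transpose_mat U) = det (four_block_mat (1\<^sub>m n) (0\<^sub>m n 1) (r u) (1\<^sub>m 1))" by simp
  also have "\<dots> = 1" by (subst det_four_block_mat_upper_right_zero_col[of _ n]) auto
  finally have detU: "det U = 1" using det_transpose[OF U] by simp
  have "det M = det (M * U)" using det_mult[OF M U] detU by simp
  also have "\<dots> = 1 + (\<Sum>i<n. x i * u i)"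
    unfolding 1 by (subst det_four_block_mat_upper_right_zero_col[of _ n]) (auto simp: det_single)
  finally have "det M = 1 + (\<Sum>i<n. x i * u i)" .
  moreover have "det M = det (U * M)" using det_mult[OF U M] detU by simp
  moreover have "\<dots> = det B"
    unfolding 2 by (subst det_four_block_mat_upper_right_zero_col[OF B]) auto
  ultimately show ?thesis by (simp add: B_def)
qed

lemma abs_det_le:
  fixes A :: "real mat"
  assumes A: "A \<in> carrier_mat n n" and b: "\<And>i k. i < n \<Longrightarrow> k < n \<Longrightarrow> \<bar>A $$ (i, k)\<bar> \<le> b"
  shows "\<bar>det A\<bar> \<le> fact n * b ^ n"
proof -
  let ?P = "{p. p permutes {0..<n}}"
  have "\<bar>det A\<bar> \<le> (\<Sum>p\<in>?P. \<bar>signof p * (\<Prod>i = 0..<n. A $$ (i, p i))\<bar>)"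
    unfolding det_def'[OF A] by (rule sum_abs)
  also have "\<dots> \<le> (\<Sum>p\<in>?P. b ^ n)"
  proof (rule sum_mono)
    fix p assume "p \<in> ?P"
    then have p: "p i < n" if "i < n" for i using that by (auto dest: permutes_in_image[of p _ i])
    have "\<bar>signof p * (\<Prod>i = 0..<n. A $$ (i, p i))\<bar> = (\<Prod>i = 0..<n. \<bar>A $$ (i, p i)\<bar>)"
      by (simp add: abs_mult sign_def abs_prod)
    also have "\<dots> \<le> (\<Prod>i = 0..<n. b)" by (intro prod_mono) (auto intro!: b p)
    finally show "\<bar>signof p * (\<Prod>i = 0..<n. A $$ (i, p i))\<bar> \<le> b ^ n" by simp
  qed
  also have "\<dots> = fact n * b ^ n" by (simp add: card_permutations[of _ n])
  finally show ?thesis .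
qed

lemma seminorm_line_minimum:
  assumes "seminorm N" and e: "N e \<noteq> 0"
  shows "\<exists>t0. \<forall>t. N (x + t0 *\<^sub>R e) \<le> N (x + t *\<^sub>R e)"
proof -
  interpret seminorm N by fact
  define T where "T = 2 * N x / N e"
  have e0: "0 < N e" using e nonneg[of e] by (simp add: less_le)
  have "\<bar>N (x + s *\<^sub>R e) - N (x + t *\<^sub>R e)\<bar> \<le> N e * \<bar>s - t\<bar>" for s t
  proof -
    have "N (x + s *\<^sub>R e) \<le> N (x + t *\<^sub>R e) + \<bar>s - t\<bar> * N e" for s t
    proof -
      have "x + s *\<^sub>R e = (x + t *\<^sub>R e) + (s - t) *\<^sub>R e" by (simp add: algebra_simps)
      then show ?thesis
        using triangle[of "x + t *\<^sub>R e" "(s - t) *\<^sub>R e"] unfolding scale by (simp only:)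
    qed
    from this[of s t] this[of t s] show ?thesis by (simp add: abs_le_iff mult.commute abs_minus_commute)
  qed
  then have lip: "\<bar>N (x + s *\<^sub>R e) - N (x + t *\<^sub>R e)\<bar> \<le> N e * \<bar>s - t\<bar>" for s t .
  have "isCont (\<lambda>t. N (x + t *\<^sub>R e)) t" for t
    unfolding isCont_def
  proof (rule metric_LIM_I)
    fix r :: real assume r: "0 < r"
    show "\<exists>s>0. \<forall>u. u \<noteq> t \<and> dist u t < s \<longrightarrow> dist (N (x + u *\<^sub>R e)) (N (x + t *\<^sub>R e)) < r"
    proof (intro exI[of _ "r / N e"] conjI allI impI)
      fix u assume "u \<noteq> t \<and> dist u t < r / N e"
      then have "N e * \<bar>u - t\<bar> < r" using e0 by (simp add: dist_real_def field_simps)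
      with lip[of u t] show "dist (N (x + u *\<^sub>R e)) (N (x + t *\<^sub>R e)) < r" by (simp add: dist_real_def)
    qed (use r e0 in simp)
  qed
  then have "continuous_on {- T..T} (\<lambda>t. N (x + t *\<^sub>R e))"
    by (intro continuous_at_imp_continuous_on) blast
  moreover have T: "0 \<le> T" using e0 by (simp add: T_def)
  ultimately obtain t0 where t0: "t0 \<in> {- T..T}" "\<And>t. t \<in> {- T..T} \<Longrightarrow> N (x + t0 *\<^sub>R e) \<le> N (x + t *\<^sub>R e)"
    using continuous_attains_inf[of "{- T..T}" "\<lambda>t. N (x + t *\<^sub>R e)"] by auto
  have "N (x + t0 *\<^sub>R e) \<le> N (x + t *\<^sub>R e)" for t
  proof (cases "t \<in> {- T..T}")
    case False
    then have "T < \<bar>t\<bar>" by auto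
    then have "T * N e \<le> \<bar>t\<bar> * N e" using e0 by simp
    then have "2 * N x \<le> \<bar>t\<bar> * N e" using e0 by (simp add: T_def)
    moreover have "\<bar>t\<bar> * N e \<le> N (x + t *\<^sub>R e) + N x"
      using triangle_diff[of "x + t *\<^sub>R e" x] by (simp add: scale)
    moreover have "N (x + t0 *\<^sub>R e) \<le> N x" using t0(2)[of 0] T by simp
    ultimately show ?thesis by linarith
  qed (use t0 in blast)
  then show ?thesis by blast
qed

text \<open>
All norms on a finite-dimensional space are equivalent. By induction on the dimension, it suffices
that the quotient seminorm modulo the last basis vector is again definite, and this holds because
the infimum over a line is attained.
\<close>

lemma coordinates_bounded:
  fixes N :: "(nat \<Rightarrow> real) \<Rightarrow> real"
  assumes "seminorm N" and "\<And>x. N x = 0 \<longleftrightarrow> (\<forall>i<n. x i = 0)"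
  shows "\<exists>R. \<forall>x. \<forall>i<n. \<bar>x i\<bar> \<le> R * N x"
  using assms
proof (induction n arbitrary: N)
  case (Suc n)
  interpret seminorm N by fact
  let ?e = "unit_fun n"
  have Ne: "0 < N ?e" using Suc.prems(2)[of ?e] nonneg[of ?e] by (force simp: unit_fun_def less_le)
  \<comment> \<open>The quotient seminorm modulo the last basis vector; attainment of the infimum keeps it definite on the remaining coordinates.\<close>
  define M where "M x = (INF t. N (x + t *\<^sub>R ?e))" for x
  have att: "\<exists>t. M x = N (x + t *\<^sub>R ?e)" for x
  proof -
    obtain t0 where t0: "\<And>t. N (x + t0 *\<^sub>R ?e) \<le> N (x + t *\<^sub>R ?e)"
      using seminorm_line_minimum[OF Suc.prems(1), of ?e x] Ne less_imp_neq by metis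
    have "M x = N (x + t0 *\<^sub>R ?e)" unfolding M_def
      by (rule cInf_eq_minimum) (use t0 in auto)
    then show ?thesis by blast
  qed
  have le: "M x \<le> N (x + t *\<^sub>R ?e)" for x t
    unfolding M_def by (rule cINF_lower) (auto intro!: bdd_belowI[of _ 0])
  have M: "seminorm M"
  proof
    fix x y
    obtain s t where "M x = N (x + s *\<^sub>R ?e)" "M y = N (y + t *\<^sub>R ?e)" using att by meson
    then show "M (x + y) \<le> M x + M y"
      using le[of "x + y" "s + t"] triangle[of "x + s *\<^sub>R ?e" "y + t *\<^sub>R ?e"]
      by (simp only: scaleR_add_left add_ac)
  next
    fix c x
    have 1: "M (c *\<^sub>R x) \<le> \<bar>c\<bar> * M x" for c x
    proof -
      obtain t where "M x = N (x + t *\<^sub>R ?e)" using att by blast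
      then show ?thesis using le[of "c *\<^sub>R x" "c * t"] scale[of c "x + t *\<^sub>R ?e"]
        by (simp only: scaleR_add_right scaleR_scaleR)
    qed
    show "M (c *\<^sub>R x) = \<bar>c\<bar> * M x"
    proof (cases "c = 0")
      case True
      then show ?thesis using 1[of 0 x] att[of "c *\<^sub>R x"] nonneg by (auto intro!: antisym)
    next
      case False
      have "\<bar>c\<bar> * M x \<le> \<bar>c\<bar> * (\<bar>inverse c\<bar> * M (c *\<^sub>R x))"
        using 1[of "inverse c" "c *\<^sub>R x"] False by (intro mult_left_mono) auto
      also have "\<dots> = M (c *\<^sub>R x)" using False by (simp flip: mult.assoc abs_mult)
      finally have "\<bar>c\<bar> * M x \<le> M (c *\<^sub>R x)" .
      with 1[of c x] show ?thesis by simp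
    qed
  qed
  have "M x = 0 \<longleftrightarrow> (\<forall>i<n. x i = 0)" for x
  proof
    assume "M x = 0"
    then obtain t where "N (x + t *\<^sub>R ?e) = 0" using att by metis
    then have "\<forall>i<Suc n. (x + t *\<^sub>R ?e) i = 0" using Suc.prems(2) by blast
    then show "\<forall>i<n. x i = 0" by (auto simp: unit_fun_def dest: less_SucI)
  next
    assume "\<forall>i<n. x i = 0"
    then have "N (x + (- x n) *\<^sub>R ?e) = 0" by (subst Suc.prems(2)) (auto simp: unit_fun_def less_Suc_eq)
    then have "M x \<le> 0" using le[of x "- x n"] by (simp only:)
    moreover have "0 \<le> M x" using att[of x] nonneg by metis
    ultimately show "M x = 0" by simp
  qed
  from Suc.IH[OF M this] obtain R where R: "\<And>x i. i < n \<Longrightarrow> \<bar>x i\<bar> \<le> R * M x" by blast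
  have M0: "0 \<le> M x" for x using att[of x] nonneg by metis
  have MN: "M x \<le> N x" for x using le[of x 0] by simp
  define K where "K = \<bar>R\<bar> + (1 + (\<Sum>i<n. \<bar>R\<bar> * N (unit_fun i))) / N ?e"
  have R': "\<bar>x i\<bar> \<le> \<bar>R\<bar> * N x" if "i < n" for x i
  proof -
    have "\<bar>x i\<bar> \<le> R * M x" by (rule R[OF that])
    also have "\<dots> \<le> \<bar>R\<bar> * M x" using M0 by (intro mult_right_mono) auto
    also have "\<dots> \<le> \<bar>R\<bar> * N x" by (intro mult_left_mono MN) simp
    finally show ?thesis .
  qed
  have "\<bar>x i\<bar> \<le> K * N x" if "i < Suc n" for x i
  proof (cases "i = n")
    case False
    then have "\<bar>x i\<bar> \<le> \<bar>R\<bar> * N x" using that R' by simp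
    also have "\<dots> \<le> K * N x" unfolding K_def using Ne
      by (intro mult_right_mono) (auto intro!: divide_nonneg_nonneg add_nonneg_nonneg sum_nonneg)
    finally show ?thesis .
  next
    case True
    have "N (x n *\<^sub>R ?e) = N (x - (\<Sum>i<n. x i *\<^sub>R unit_fun i))"
    proof (rule eq_if_null_diff, subst Suc.prems(2), intro allI impI)
      fix i assume "i < Suc n"
      have "(\<Sum>j<Suc n. x j *\<^sub>R unit_fun j) i = x i" by (rule sum_unit_fun) fact
      then show "(x n *\<^sub>R ?e - (x - (\<Sum>i<n. x i *\<^sub>R unit_fun i))) i = 0" by simp
    qed
    also have "\<dots> \<le> N x + N (\<Sum>i<n. x i *\<^sub>R unit_fun i)" by (rule triangle_diff)
    also have "N (\<Sum>i<n. x i *\<^sub>R unit_fun i) \<le> (\<Sum>i<n. N (x i *\<^sub>R unit_fun i))" by (rule sum_le)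
    also have "\<dots> = (\<Sum>i<n. \<bar>x i\<bar> * N (unit_fun i))" by (simp only: scale)
    also have "\<dots> \<le> (\<Sum>i<n. (\<bar>R\<bar> * N x) * N (unit_fun i))"
      by (intro sum_mono mult_right_mono R') auto
    also have "\<dots> = (\<Sum>i<n. \<bar>R\<bar> * N (unit_fun i)) * N x"
      unfolding sum_distrib_right by (intro sum.cong refl) (simp only: mult_ac)
    finally have "\<bar>x n\<bar> * N ?e \<le> (1 + (\<Sum>i<n. \<bar>R\<bar> * N (unit_fun i))) * N x"
      by (simp only: scale) (simp add: algebra_simps)
    then have "\<bar>x n\<bar> \<le> (1 + (\<Sum>i<n. \<bar>R\<bar> * N (unit_fun i))) / N ?e * N x"
      using Ne by (simp add: field_simps)
    also have "\<dots> \<le> K * N x" unfolding K_def by (intro mult_right_mono) auto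
    finally show ?thesis using True by simp
  qed
  then show ?case by blast
qed auto

text \<open>
In dual form this is the theorem of Kadec and Snobar, that an \<open>n\<close>-dimensional subspace of a space of
bounded functions is the range of a projection of norm at most \<open>\<surd>n\<close>, up to the constant. The proof
uses optimal designs. For points \<open>y j\<close> of the unit ball with weights \<open>c j\<close> of sum 1, let \<open>G\<close> be the
matrix \<open>\<Sum> c j y j (y j)\<^sup>T\<close>, and choose the design so that \<open>det G\<close> is more than half of the supremum. Moving
some weight to a further point \<open>x\<close> multiplies the determinant by a factor that the rank one formula
computes, and it follows that \<open>w x = x\<^sup>T G\<^sup>-\<^sup>1 x\<close> is at most \<open>6 n\<close>. The identity \<open>x = G G\<^sup>-\<^sup>1 x\<close> reads
\<open>x = \<Sum> c j (b x j) y j\<close> with \<open>b x j = x\<^sup>T G\<^sup>-\<^sup>1 y j\<close> and \<open>\<Sum> c j (b x j)\<^sup>2 = w x\<close>, so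
\<open>\<Sum> c j \<bar>b x j\<bar>\<close> is at most \<open>3 \<surd>n\<close>.
\<close>

theorem short_linear_expansions:
  fixes N :: "(nat \<Rightarrow> real) \<Rightarrow> real"
  assumes "seminorm N" and null: "\<And>x. N x = 0 \<longleftrightarrow> (\<forall>i<n. x i = 0)" and n: "1 \<le> n"
  shows "\<exists>m y A. (\<forall>j<m::nat. N (y j) \<le> 1) \<and>
    (\<forall>x. \<forall>i<n. x i = (\<Sum>j<m. (\<Sum>k<n. A j k * x k) * y j i)) \<and>
    (\<forall>x. N x \<le> 1 \<longrightarrow> (\<Sum>j<m. \<bar>\<Sum>k<n. A j k * x k\<bar>) \<le> 3 * sqrt (real n))"
proof -
  interpret seminorm N by fact
  obtain R where R: "\<And>x i. i < n \<Longrightarrow> \<bar>x i\<bar> \<le> R * N x"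
    using coordinates_bounded[OF assms(1) null] by blast
  define adm where "adm m y c \<longleftrightarrow> (\<forall>j<m::nat. N (y j) \<le> 1 \<and> 0 \<le> c j) \<and> (\<Sum>j<m. c j) = (1::real)" for m and y :: "nat \<Rightarrow> nat \<Rightarrow> real" and c
  define G where "G m y c i k = (\<Sum>j<m::nat. c j * y j i * y j k)" for m and y :: "nat \<Rightarrow> nat \<Rightarrow> real" and c and i k :: nat
  define dt where "dt g = det (mat n n (\<lambda>(i, k). g i k))" for g :: "nat \<Rightarrow> nat \<Rightarrow> real"
  define S where "S = {dt (G m y c) | m y c. adm m y c}"
  have bdd: "bdd_above S"
  proof (rule bdd_aboveI)
    fix s assume "s \<in> S"
    then obtain m y c where a: "adm m y c" and s: "s = dt (G m y c)" by (auto simp: S_def)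
    have "\<bar>G m y c i k\<bar> \<le> \<bar>R\<bar> * \<bar>R\<bar>" if "i < n" "k < n" for i k
    proof -
      have yR: "\<bar>y j i\<bar> \<le> \<bar>R\<bar>" if "j < m" "i < n" for j i
      proof -
        have "\<bar>y j i\<bar> \<le> R * N (y j)" using R that by blast
        also have "\<dots> \<le> \<bar>R\<bar> * N (y j)" by (intro mult_right_mono) auto
        also have "\<dots> \<le> \<bar>R\<bar> * 1" using a that by (intro mult_left_mono) (auto simp: adm_def)
        finally show ?thesis by simp
      qed
      have "\<bar>G m y c i k\<bar> \<le> (\<Sum>j<m. \<bar>c j * y j i * y j k\<bar>)" unfolding G_def by (rule sum_abs)
      also have "\<dots> \<le> (\<Sum>j<m. c j * (\<bar>R\<bar> * \<bar>R\<bar>))"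
        unfolding abs_mult mult.assoc using a that
        by (intro sum_mono mult_mono) (auto simp: adm_def intro!: yR mult_nonneg_nonneg)
      also have "\<dots> = \<bar>R\<bar> * \<bar>R\<bar>" using a by (simp add: adm_def flip: sum_distrib_right)
      finally show ?thesis .
    qed
    then have "\<bar>s\<bar> \<le> fact n * (\<bar>R\<bar> * \<bar>R\<bar>) ^ n"
      unfolding s dt_def by (intro abs_det_le) auto
    then show "s \<le> fact n * (\<bar>R\<bar> * \<bar>R\<bar>) ^ n" by simp
  qed
  have "\<exists>s\<in>S. 0 < s"
  proof -
    define y where "y j = inverse (N (unit_fun j)) *\<^sub>R unit_fun j" for j
    define c where "c j = 1 / real n" for j :: nat
    have Ne: "0 < N (unit_fun j)" if "j < n" for j
      using null[of "unit_fun j"] nonneg[of "unit_fun j"] that by (force simp: unit_fun_def less_le)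
    have "N (y j) = 1" if "j < n" for j using Ne[OF that] by (simp only: y_def scale) simp
    then have a: "adm n y c" using n by (auto simp: adm_def c_def)
    have yji: "y j i = (if i = j then inverse (N (unit_fun j)) else 0)" for i j
      by (simp add: y_def unit_fun_def)
    have Gd: "G n y c i k = (if i = k then c i * (inverse (N (unit_fun i)))\<^sup>2 else 0)" if "i < n" "k < n" for i k
      using that by (auto simp: G_def yji power2_eq_square if_distrib[of "\<lambda>u. _ * u"] mult.assoc cong: if_cong)
    let ?A = "mat n n (\<lambda>(i, k). G n y c i k)"
    have "dt (G n y c) = prod_list (diag_mat ?A)" unfolding dt_def
      by (rule det_upper_triangular[of _ n]) (auto simp: upper_triangular_def Gd)
    also have "\<dots> = (\<Prod>i<n. G n y c i i)"
      by (simp add: diag_mat_def prod.distinct_set_conv_list[symmetric] lessThan_atLeast0)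
    also have "\<dots> > 0"
    proof (rule prod_pos)
      fix i assume "i \<in> {..<n}"
      then show "0 < G n y c i i" using n Ne[of i] by (simp add: Gd c_def)
    qed
    finally show ?thesis using a by (auto simp: S_def)
  qed
  then have Spos: "0 < Sup S" using cSup_upper[OF _ bdd] by fastforce
  then obtain s where "s \<in> S" and s: "Sup S / 2 < s"
    using less_cSupD[of S "Sup S / 2"] \<open>\<exists>s\<in>S. 0 < s\<close> by auto
  then obtain m y c where a: "adm m y c" and sG: "s = dt (G m y c)" by (auto simp: S_def)
  define g where "g = G m y c"
  let ?g = "mat n n (\<lambda>(i, k). g i k)"
  have g: "?g \<in> carrier_mat n n" by simp
  have "det ?g \<noteq> 0" using s Spos sG by (simp add: dt_def g_def)
  from det_non_zero_imp_unit[OF g this, of "()"]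
  obtain H where H: "H \<in> carrier_mat n n" "H * ?g = 1\<^sub>m n"
    unfolding Units_def ring_mat_def by auto
  have Hg: "(\<Sum>l<n. H $$ (i, l) * g l k) = (if i = k then 1 else 0)" if "i < n" "k < n" for i k
  proof -
    have "(H * ?g) $$ (i, k) = (\<Sum>l<n. H $$ (i, l) * g l k)"
      using that H(1) by (simp add: scalar_prod_def lessThan_atLeast0)
    then show ?thesis using H(2) that by simp
  qed
  define z where "z x l = (\<Sum>k<n. x k * H $$ (k, l))" for x :: "nat \<Rightarrow> real" and l
  have zg: "(\<Sum>l<n. z x l * g l i) = x i" if "i < n" for x i
  proof -
    have "(\<Sum>l<n. z x l * g l i) = (\<Sum>l<n. \<Sum>k<n. x k * (H $$ (k, l) * g l i))"
      by (simp add: z_def sum_distrib_right mult.assoc)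
    also have "\<dots> = (\<Sum>k<n. x k * (\<Sum>l<n. H $$ (k, l) * g l i))"
      by (subst sum.swap) (simp add: sum_distrib_left)
    also have "\<dots> = (\<Sum>k<n. x k * (if k = i then 1 else 0))" using that by (simp add: Hg)
    also have "\<dots> = x i" using that by (simp add: if_distrib[of "\<lambda>u. _ * u"] cong: if_cong)
    finally show ?thesis .
  qed
  define w where "w x = (\<Sum>l<n. z x l * x l)" for x
  have rank_one: "dt (\<lambda>i k. g i k + t * x i * x k) = (1 + t * w x) * dt g" for t x
  proof -
    let ?B = "mat n n (\<lambda>(i, k). (if i = k then 1 else 0) + (t * x i) * z x k)"
    have "mat n n (\<lambda>(i, k). g i k + t * x i * x k) = ?B * ?g"
    proof (rule eq_matI)
      fix i k assume "i < dim_row (?B * ?g)" "k < dim_col (?B * ?g)"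
      then have ik: "i < n" "k < n" by auto
      have "(?B * ?g) $$ (i, k) = (\<Sum>l<n. ((if i = l then 1 else 0) + (t * x i) * z x l) * g l k)"
        using ik by (simp add: scalar_prod_def lessThan_atLeast0)
      also have "\<dots> = (\<Sum>l<n. (if i = l then 1 else 0) * g l k) + (t * x i) * (\<Sum>l<n. z x l * g l k)"
        by (simp add: algebra_simps sum.distrib sum_distrib_left)
      also have "\<dots> = g i k + t * x i * x k"
        using ik by (simp add: zg if_distrib[of "\<lambda>u. u * _"] cong: if_cong)
      finally show "mat n n (\<lambda>(i, k). g i k + t * x i * x k) $$ (i, k) = (?B * ?g) $$ (i, k)"
        using ik by simp
    qed auto
    then have "dt (\<lambda>i k. g i k + t * x i * x k) = det ?B * det ?g"
      unfolding dt_def by (simp add: det_mult[of _ n])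
    then show ?thesis unfolding det_one_plus_rank_one
      by (simp add: dt_def w_def sum_distrib_left mult_ac)
  qed
  have w: "w x \<le> 6 * real n" if x: "N x \<le> 1" for x
  proof -
    \<comment> \<open>Mixing the point x into the design with this weight costs a factor of at most 2 in the determinant, by Bernoulli.\<close>
    define t where "t = 1 / (2 * real n)"
    have t: "0 < t" "t \<le> 1 / 2" using n by (auto simp: t_def field_simps)
    define y' where "y' j = (if j < m then y j else x)" for j
    define c' where "c' j = (if j < m then (1 - t) * c j else t)" for j
    have "(\<Sum>j<m. c' j) = (1 - t) * (\<Sum>j<m. c j)" by (simp add: c'_def sum_distrib_left)
    then have "adm (Suc m) y' c'"
      using a x t by (auto simp: adm_def y'_def c'_def)
    then have leS: "dt (G (Suc m) y' c') \<le> Sup S" by (intro cSup_upper[OF _ bdd]) (auto simp: S_def)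
    have Gk: "G (Suc m) y' c' i k = (1 - t) * (g i k + t / (1 - t) * x i * x k)" for i k
    proof -
      have "(\<Sum>j<m. c' j * y' j i * y' j k) = (1 - t) * g i k"
        by (simp add: c'_def y'_def g_def G_def sum_distrib_left mult.assoc)
      moreover have "(1 - t) * (t / (1 - t)) = t" using t by simp
      then have "(1 - t) * (g i k + t / (1 - t) * x i * x k) = (1 - t) * g i k + t * x i * x k"
        by (simp only: distrib_left mult.assoc[symmetric])
      ultimately show ?thesis by (simp add: G_def c'_def y'_def)
    qed
    have dtk: "dt (\<lambda>i k. (1 - t) * (g i k + t / (1 - t) * x i * x k)) = 
       (1 - t) ^ n * ((1 + t / (1 - t) * w x) * dt g)"
    proof -
      have "mat n n (\<lambda>(i, k). (1 - t) * (g i k + t / (1 - t) * x i * x k)) =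
        (1 - t) \<cdot>\<^sub>m mat n n (\<lambda>(i, k). g i k + t / (1 - t) * x i * x k)" by (intro eq_matI) auto
      then show ?thesis using rank_one[of "t / (1 - t)" x] by (simp add: dt_def)
    qed
    note leS
    moreover note dtk
    moreover have "G (Suc m) y' c' = (\<lambda>i k. (1 - t) * (g i k + t / (1 - t) * x i * x k))"
      using Gk by (intro ext)
    ultimately have le: "(1 - t) ^ n * ((1 + t / (1 - t) * w x) * dt g) \<le> Sup S" by (simp only:)
    have dg: "0 < dt g" "Sup S < 2 * dt g" using s sG Spos by (simp_all add: g_def)
    show ?thesis
    proof (rule ccontr)
      assume "\<not> w x \<le> 6 * real n"
      then have wn: "6 * real n < w x" by simp
      have "1 + real n * (- t) \<le> (1 + (- t)) ^ n" by (rule Bernoulli_inequality) (use t in auto)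
      then have half: "1 / 2 \<le> (1 - t) ^ n" using n by (simp add: t_def)
      have "3 = t * (6 * real n)" using n by (simp add: t_def)
      also have "\<dots> \<le> t * w x" using wn t by (intro mult_left_mono) auto
      also have "\<dots> \<le> t / (1 - t) * w x"
        using t wn by (intro mult_right_mono) (auto simp: field_simps)
      finally have "4 \<le> 1 + t / (1 - t) * w x" by simp
      then have "4 * dt g \<le> (1 + t / (1 - t) * w x) * dt g" using dg by (intro mult_right_mono) auto
      then have "1 / 2 * (4 * dt g) \<le> (1 - t) ^ n * ((1 + t / (1 - t) * w x) * dt g)"
        using half dg by (intro mult_mono) auto
      with le dg show False by linarith
    qed
  qed
  define b where "b x j = (\<Sum>l<n. z x l * y j l)" for x j
  define A where "A j k = c j * (\<Sum>l<n. H $$ (k, l) * y j l)" for j k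
  have Ab: "(\<Sum>k<n. A j k * x k) = c j * b x j" for j x
  proof -
    have "(\<Sum>k<n. A j k * x k) = c j * (\<Sum>k<n. \<Sum>l<n. x k * H $$ (k, l) * y j l)"
      by (simp add: A_def sum_distrib_left sum_distrib_right mult_ac)
    also have "(\<Sum>k<n. \<Sum>l<n. x k * H $$ (k, l) * y j l) = b x j"
      by (subst sum.swap) (simp add: b_def z_def sum_distrib_right)
    finally show ?thesis .
  qed
  have rep: "(\<Sum>j<m. c j * b x j * y j i) = x i" if "i < n" for x i
  proof -
    have "(\<Sum>j<m. c j * b x j * y j i) = (\<Sum>j<m. \<Sum>l<n. z x l * (c j * y j l * y j i))"
      by (simp add: b_def sum_distrib_left sum_distrib_right mult_ac)
    also have "\<dots> = (\<Sum>l<n. z x l * g l i)"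
      by (subst sum.swap) (simp add: g_def G_def sum_distrib_left)
    finally show ?thesis using zg[OF that] by simp
  qed
  have sq: "(\<Sum>j<m. c j * (b x j)\<^sup>2) = w x" for x
  proof -
    have "(\<Sum>j<m. c j * (b x j)\<^sup>2) = (\<Sum>j<m. c j * b x j * (\<Sum>l<n. z x l * y j l))"
      by (simp add: power2_eq_square mult.assoc b_def[symmetric])
    also have "\<dots> = (\<Sum>j<m. \<Sum>l<n. z x l * (c j * b x j * y j l))"
      by (simp add: sum_distrib_left mult_ac)
    also have "\<dots> = (\<Sum>l<n. z x l * (\<Sum>j<m. c j * b x j * y j l))"
      by (subst sum.swap) (simp add: sum_distrib_left)
    finally show ?thesis by (simp add: w_def rep)
  qed
  have bound: "(\<Sum>j<m. \<bar>c j * b x j\<bar>) \<le> 3 * sqrt (real n)" if x: "N x \<le> 1" for x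
  proof -
    define r where "r = 3 * sqrt (real n)"
    have r: "0 < r" "r * r = 9 * real n" using n by (auto simp: r_def)
    have am: "\<bar>v\<bar> \<le> (v\<^sup>2 / r + r) / 2" for v
    proof -
      have "0 \<le> (\<bar>v\<bar> - r)\<^sup>2" by simp
      then have "2 * \<bar>v\<bar> * r \<le> v\<^sup>2 + r * r" by (simp add: power2_diff power2_eq_square[of r])
      then show ?thesis using r by (simp add: field_simps)
    qed
    have "(\<Sum>j<m. \<bar>c j * b x j\<bar>) = (\<Sum>j<m. c j * \<bar>b x j\<bar>)"
      using a by (intro sum.cong) (auto simp: adm_def abs_mult)
    also have "\<dots> \<le> (\<Sum>j<m. c j * (((b x j)\<^sup>2 / r + r) / 2))"
      using a by (intro sum_mono mult_left_mono am) (auto simp: adm_def)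
    also have "\<dots> = ((\<Sum>j<m. c j * (b x j)\<^sup>2) / r + r * (\<Sum>j<m. c j)) / 2"
      by (simp add: sum_distrib_left sum_divide_distrib algebra_simps add_divide_distrib sum.distrib)
    also have "\<dots> = (w x / r + r) / 2" using a by (simp add: sq adm_def)
    also have "\<dots> \<le> r"
    proof -
      have "w x \<le> r * r" using w[OF x] r(2) by simp
      then have "w x / r \<le> r" using r(1) by (simp add: field_simps)
      then show ?thesis by simp
    qed
    finally show ?thesis by (simp add: r_def)
  qed
  show ?thesis
    by (rule exI[of _ m], rule exI[of _ y], rule exI[of _ A])
       (use a in \<open>auto simp: Ab rep bound adm_def\<close>)
qed

section \<open>Functions with small third differences are near quadratic polynomials\<close>

locale finite_dim_norm = seminorm N for N :: "(nat \<Rightarrow> real) \<Rightarrow> real" +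
  fixes n :: nat
  assumes null_iff: "N x = 0 \<longleftrightarrow> (\<forall>i<n. x i = 0)" and dim_pos: "1 \<le> n"
begin

abbreviation dual :: "(nat \<Rightarrow> real) \<Rightarrow> (nat \<Rightarrow> real) \<Rightarrow> real" where
  "dual a x \<equiv> \<Sum>i<n. a i * x i"

lemma ln_ge_half: "1 / 2 \<le> ln (real n + 1)"
proof -
  have "ln 2 \<le> ln (real n + 1)" using dim_pos by simp
  with ln2_ge_half show ?thesis by linarith
qed

lemma sqrt_ge_one: "1 \<le> sqrt (real n)"
  using dim_pos by simp

end

locale quadratic_like = finite_dim_norm N n + small_third_difference N f
  for N :: "(nat \<Rightarrow> real) \<Rightarrow> real" and n f +
  assumes respects_null: "N (x - y) = 0 \<Longrightarrow> f x = f y"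
    and segment_bounded: "(\<And>t. 0 \<le> t \<Longrightarrow> t \<le> 1 \<Longrightarrow> N (u + t *\<^sub>R x) \<le> 1) \<Longrightarrow>
      \<exists>B. \<forall>t. 0 \<le> t \<longrightarrow> t \<le> 1 \<longrightarrow> \<bar>f (u + t *\<^sub>R x)\<bar> \<le> B"
begin

lemma quadratic_like_reflect: "quadratic_like N n (\<lambda>x. f (- x))"
proof unfold_locales
  fix x h assume a: "N x \<le> 1" "N (x + h) \<le> 1" "N (x + 2 *\<^sub>R h) \<le> 1" "N (x + 3 *\<^sub>R h) \<le> 1"
  have "third_difference (\<lambda>x. f (- x)) h x = third_difference f (- h) (- x)"
    by (simp add: third_difference_def)
  moreover have "\<bar>third_difference f (- h) (- x)\<bar> \<le> 1"
  proof (rule third_difference_bound)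
    have "- x + 3 *\<^sub>R - h = - (x + 3 *\<^sub>R h)" by simp
    then show "N (- x + 3 *\<^sub>R - h) \<le> 1" using a(4) by (simp only: minus)
  qed (use a in simp)
  ultimately show "\<bar>third_difference (\<lambda>x. f (- x)) h x\<bar> \<le> 1" by simp
next
  fix x y assume "N (x - y) = 0"
  moreover have "- x - - y = - (x - y)" by simp
  ultimately have "N (- x - - y) = 0" by (simp only: minus)
  then show "f (- x) = f (- y)" by (rule respects_null)
next
  fix u x assume u: "\<And>t. 0 \<le> t \<Longrightarrow> t \<le> 1 \<Longrightarrow> N (u + t *\<^sub>R x) \<le> 1"
  have eq: "- u + t *\<^sub>R (- x) = - (u + t *\<^sub>R x)" for t by simp
  have "N (- u + t *\<^sub>R (- x)) \<le> 1" if "0 \<le> t" "t \<le> 1" for t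
    using u[OF that] unfolding eq minus .
  from segment_bounded[OF this] show "\<exists>B. \<forall>t. 0 \<le> t \<longrightarrow> t \<le> 1 \<longrightarrow> \<bar>f (- (u + t *\<^sub>R x))\<bar> \<le> B"
    unfolding eq .
qed

lemma quadratic_like_average:
  assumes "quadratic_like N n f'" and c: "\<bar>c\<bar> \<le> 1"
  shows "quadratic_like N n (\<lambda>x. (f x + c * f' x) / 2 + d)"
proof -
  interpret f': quadratic_like N n f' by fact
  show ?thesis
  proof unfold_locales
    fix x h assume "N x \<le> 1" "N (x + h) \<le> 1" "N (x + 2 *\<^sub>R h) \<le> 1" "N (x + 3 *\<^sub>R h) \<le> 1"
    then have "\<bar>third_difference f h x\<bar> \<le> 1" "\<bar>third_difference f' h x\<bar> \<le> 1"
      using third_difference_le f'.third_difference_le by blast+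
    moreover from this(2) have "\<bar>c * third_difference f' h x\<bar> \<le> 1"
      using c unfolding abs_mult by (rule mult_le_one[rotated 2]) auto
    moreover have eq: "third_difference (\<lambda>x. (f x + c * f' x) / 2 + d) h x =
      (third_difference f h x + c * third_difference f' h x) / 2"
      by (simp add: third_difference_def field_simps)
    ultimately show "\<bar>third_difference (\<lambda>x. (f x + c * f' x) / 2 + d) h x\<bar> \<le> 1"
      unfolding eq using abs_triangle_ineq[of "third_difference f h x" "c * third_difference f' h x"] by simp
  next
    fix x y assume "N (x - y) = 0"
    then have "f x = f y" "f' x = f' y" using respects_null f'.respects_null by blast+
    then show "(f x + c * f' x) / 2 + d = (f y + c * f' y) / 2 + d" by simp
  next
    fix u x assume u: "\<And>t. 0 \<le> t \<Longrightarrow> t \<le> 1 \<Longrightarrow> N (u + t *\<^sub>R x) \<le> 1"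
    obtain B where B: "\<And>t. 0 \<le> t \<Longrightarrow> t \<le> 1 \<Longrightarrow> \<bar>f (u + t *\<^sub>R x)\<bar> \<le> B"
      using segment_bounded[OF u] by blast
    obtain B' where B': "\<And>t. 0 \<le> t \<Longrightarrow> t \<le> 1 \<Longrightarrow> \<bar>f' (u + t *\<^sub>R x)\<bar> \<le> B'"
      using f'.segment_bounded[OF u] by blast
    have "\<bar>(f (u + t *\<^sub>R x) + c * f' (u + t *\<^sub>R x)) / 2 + d\<bar> \<le> B + B' + \<bar>d\<bar>" if "0 \<le> t" "t \<le> 1" for t
    proof -
      have "\<bar>c * f' (u + t *\<^sub>R x)\<bar> \<le> 1 * B'"
        unfolding abs_mult using c B'[OF that] by (intro mult_mono) auto
      moreover have "\<lbrakk>\<bar>p\<bar> \<le> B; \<bar>q\<bar> \<le> 1 * B'\<rbrakk> \<Longrightarrow> \<bar>(p + q) / 2 + d\<bar> \<le> B + B' + \<bar>d\<bar>" for p q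
      proof -
        assume "\<bar>p\<bar> \<le> B" "\<bar>q\<bar> \<le> 1 * B'"
        moreover have "\<bar>(p + q) / 2 + d\<bar> \<le> \<bar>p + q\<bar> / 2 + \<bar>d\<bar>"
          using abs_triangle_ineq[of "(p + q) / 2" d] by simp
        ultimately show ?thesis
          using abs_triangle_ineq[of p q] abs_ge_zero[of p] abs_ge_zero[of q] by linarith
      qed
      ultimately show ?thesis using B[OF that] by blast
    qed
    then show "\<exists>B. \<forall>t. 0 \<le> t \<longrightarrow> t \<le> 1 \<longrightarrow> \<bar>(f (u + t *\<^sub>R x) + c * f' (u + t *\<^sub>R x)) / 2 + d\<bar> \<le> B" by blast
  qed
qed

lemma eighth_segment_bounded:
  assumes x: "N x \<le> 1" and y: "N y \<le> 1"
  shows "\<exists>B. \<forall>t. 0 \<le> t \<longrightarrow> t \<le> 1 \<longrightarrow> \<bar>f ((1/8) *\<^sub>R (t *\<^sub>R x + y))\<bar> \<le> B"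
proof -
  have eq: "(1/8) *\<^sub>R (t *\<^sub>R x + y) = (1/8) *\<^sub>R y + t *\<^sub>R ((1/8) *\<^sub>R x)" for t
    by (simp add: algebra_simps)
  have "N ((1/8) *\<^sub>R y + t *\<^sub>R ((1/8) *\<^sub>R x)) \<le> 1" if t: "0 \<le> t" "t \<le> 1" for t
  proof -
    have "N ((1/8) *\<^sub>R y + t *\<^sub>R ((1/8) *\<^sub>R x)) \<le> N ((1/8) *\<^sub>R y) + N (t *\<^sub>R ((1/8) *\<^sub>R x))" by (rule triangle)
    also have "\<dots> = 1/8 * N y + t * (1/8 * N x)" using t by (simp add: scale)
    also have "t * (1/8 * N x) \<le> 1 * (1/8 * N x)" using t by (intro mult_right_mono) auto
    finally show ?thesis using x y by simp
  qed
  from segment_bounded[OF this] show ?thesis unfolding eq .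
qed

text \<open>
For odd \<open>f\<close>, the mixed difference with steps \<open>u\<close>, \<open>v\<close>, \<open>u + v\<close> at \<open>- (u + v)\<close> is twice
\<open>f (u + v) - f u - f v\<close>. So \<open>f\<close> is almost additive near the centre, and doubling three times leads
from the ball of radius \<open>1/8\<close> to the unit ball.
\<close>

lemma odd_near_linear:
  assumes odd: "\<And>x. f (- x) = - f x"
  shows "\<exists>a. \<forall>x. N x \<le> 1 \<longrightarrow> \<bar>f x - dual a x\<bar> \<le> 1302 * ln (real n + 1)"
proof -
  have f0: "f 0 = 0" using odd[of 0] by simp
  have "almost_linear N (\<lambda>x. f ((1/8) *\<^sub>R x)) (7/2)"
  proof unfold_locales
    show "f ((1/8) *\<^sub>R (- x)) = - f ((1/8) *\<^sub>R x)" for x by (simp add: odd)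
  next
    fix x y assume xy: "N x \<le> 1" "N y \<le> 1"
    define u v where "u = (1/8) *\<^sub>R x" and "v = (1/8) *\<^sub>R y"
    have N: "N u \<le> 1/8" "N v \<le> 1/8" using xy by (simp_all add: u_def v_def scale)
    have "N (- (u + v)) + 2 * N u + N v + N (u + v) \<le> 1"
      using triangle[of u v] N unfolding minus by linarith
    from mixed_difference_bound[OF this] have "\<bar>mixed_difference f u v (u + v) (- (u + v))\<bar> \<le> 7" .
    moreover have "mixed_difference f u v (u + v) (- (u + v)) = 2 * (f (u + v) - f u - f v)"
    proof -
      have "- (u + v) + u + v + (u + v) = u + v" "- (u + v) + u + v = 0" "- (u + v) + u + (u + v) = u"
        "- (u + v) + v + (u + v) = v" "- (u + v) + u = - v" "- (u + v) + v = - u" "- (u + v) + (u + v) = 0"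
        by simp_all
      then show ?thesis unfolding mixed_difference_def by (simp only: odd f0) simp
    qed
    moreover have "\<bar>2 * w\<bar> \<le> 7 \<Longrightarrow> \<bar>w\<bar> \<le> 7/2" for w :: real by simp
    ultimately have "\<bar>f (u + v) - f u - f v\<bar> \<le> 7/2" by metis
    then show "\<bar>f ((1/8) *\<^sub>R (x + y)) - f ((1/8) *\<^sub>R x) - f ((1/8) *\<^sub>R y)\<bar> \<le> 7/2"
      by (simp only: u_def v_def scaleR_add_right)
  next
    fix x assume "N x \<le> 1"
    from eighth_segment_bounded[OF this, of 0]
    show "\<exists>B. \<forall>t. 0 \<le> t \<longrightarrow> t \<le> 1 \<longrightarrow> \<bar>f ((1/8) *\<^sub>R (t *\<^sub>R x))\<bar> \<le> B" by (simp only: zero add_0_right zero_le_one)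
  next
    fix x assume "N x = 0"
    then have "N ((1/8) *\<^sub>R x - 0) = 0" by (simp only: diff_0_right scale mult_zero_right)
    from respects_null[OF this] show "f ((1/8) *\<^sub>R x) = 0" by (simp only: f0)
  qed
  from almost_linear_near_linear[OF this _ dim_pos] null_iff
  obtain a where a: "\<And>x. N x \<le> 1 \<Longrightarrow> \<bar>f ((1/8) *\<^sub>R x) - dual a x\<bar> \<le> 46 * (7/2) * ln (real n + 1)"
    by blast
  have double: "\<bar>f (2 *\<^sub>R u) - 2 * f u\<bar> \<le> 1" if "N (2 *\<^sub>R u) \<le> 1" for u
    using doubling_bound[OF that] by (simp add: odd f0)
  have "\<bar>f x - dual (\<lambda>i. 8 * a i) x\<bar> \<le> 1302 * ln (real n + 1)" if x: "N x \<le> 1" for x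
  proof -
    have d: "\<bar>f (c *\<^sub>R x) - 2 * f ((c/2) *\<^sub>R x)\<bar> \<le> 1" if "0 \<le> c" "c \<le> 1" for c
    proof -
      have "N (2 *\<^sub>R ((c/2) *\<^sub>R x)) \<le> 1" using that x by (simp add: scale mult_le_one)
      from double[OF this] show ?thesis by simp
    qed
    have "dual (\<lambda>i. 8 * a i) x = 8 * dual a x" by (simp add: sum_distrib_left mult.assoc)
    moreover have "\<bar>f x - 2 * f ((1/2) *\<^sub>R x)\<bar> \<le> 1" using d[of 1] by simp
    moreover have "\<bar>f ((1/2) *\<^sub>R x) - 2 * f ((1/4) *\<^sub>R x)\<bar> \<le> 1" using d[of "1/2"] by simp
    moreover have "\<bar>f ((1/4) *\<^sub>R x) - 2 * f ((1/8) *\<^sub>R x)\<bar> \<le> 1" using d[of "1/4"] by simp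
    ultimately show ?thesis using a[OF x] ln_ge_half by linarith
  qed
  then show ?thesis by (intro exI[of _ "\<lambda>i. 8 * a i"] allI impI)
qed

text \<open>
The polarization \<open>b\<close> is symmetric and almost additive in each variable, so \<open>b x y\<close> is within \<open>K\<close>
of \<open>T y x\<close> with \<open>T y\<close> linear and \<open>K\<close> of order \<open>ln (n + 1)\<close>. Expanding \<open>y = \<Sum> \<alpha>\<^sub>j(y) y\<^sub>j\<close> with linear
coefficients gives the bilinear form \<open>\<Sum> \<alpha>\<^sub>j(y) T y\<^sub>j x\<close>. It is close to \<open>b x y\<close>: by symmetry \<open>T y\<^sub>j x\<close> is
within \<open>2 K\<close> of \<open>T x y\<^sub>j\<close>, and \<open>\<Sum> \<alpha>\<^sub>j(y) T x y\<^sub>j = T x y\<close> by linearity of \<open>T x\<close>. The errors are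
multiplied only by \<open>\<Sum> \<bar>\<alpha>\<^sub>j(y)\<bar> \<le> 3 \<surd>n\<close>, which is the source of the square root in the upper bound.
\<close>

lemma even_near_quadratic:
  assumes even: "\<And>x. f (- x) = f x" and f0: "f 0 = 0"
  shows "\<exists>a. \<forall>x. N x \<le> 1 \<longrightarrow>
    \<bar>f x - (\<Sum>i<n. \<Sum>k<n. a i k * x i * x k)\<bar> \<le> 36100 * sqrt (real n) * ln (real n + 1)"
proof -
  \<comment> \<open>The polarization of f, taken at scale 1/8 so that every point of the mixed difference below lies in the ball.\<close>
  define b where "b x y = (f ((1/8) *\<^sub>R (x + y)) - f ((1/8) *\<^sub>R (x - y))) / 4" for x y
  define K where "K = 46 * (7/4) * ln (real n + 1)"
  have b_sym: "b x y = b y x" for x y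
  proof -
    have "(1/8) *\<^sub>R (x - y) = - ((1/8) *\<^sub>R (y - x))" by (simp add: algebra_simps)
    then show ?thesis unfolding b_def by (simp only: even add.commute)
  qed
  have "\<exists>a. \<forall>x. N x \<le> 1 \<longrightarrow> \<bar>b x y - dual a x\<bar> \<le> K" if y: "N y \<le> 1" for y
    unfolding K_def
  proof (rule almost_linear_near_linear[OF _ _ dim_pos])
    show "almost_linear N (\<lambda>x. b x y) (7/4)"
    proof unfold_locales
      fix x
      have "(1/8) *\<^sub>R (- x + y) = - ((1/8) *\<^sub>R (x - y))" "(1/8) *\<^sub>R (- x - y) = - ((1/8) *\<^sub>R (x + y))"
        by (simp_all add: algebra_simps)
      then show "b (- x) y = - b x y" unfolding b_def by (simp only: even minus_divide_left minus_diff_eq)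
    next
      fix x x' assume xx: "N x \<le> 1" "N x' \<le> 1"
      define u u' v where "u = (1/8) *\<^sub>R x" and "u' = (1/8) *\<^sub>R x'" and "v = (1/8) *\<^sub>R y"
      have N: "N u \<le> 1/8" "N u' \<le> 1/8" "N v \<le> 1/8"
        using xx y by (simp_all add: u_def u'_def v_def scale)
      have "N (- v) + 2 * N u + N u' + N (2 *\<^sub>R v) \<le> 1"
        using N unfolding minus scale by simp
      from mixed_difference_bound[OF this] have "\<bar>mixed_difference f u u' (2 *\<^sub>R v) (- v)\<bar> \<le> 7" .
      moreover have "mixed_difference f u u' (2 *\<^sub>R v) (- v) = 4 * (b (x + x') y - b x y - b x' y)"
      proof -
        have eq: "f (- v + u + u' + 2 *\<^sub>R v) = f (u + u' + v)" "f (- v + u + u') = f (u + u' - v)"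
          "f (- v + u + 2 *\<^sub>R v) = f (u + v)" "f (- v + u' + 2 *\<^sub>R v) = f (u' + v)"
          "f (- v + u) = f (u - v)" "f (- v + u') = f (u' - v)" "f (- v + 2 *\<^sub>R v) = f v"
          by (simp_all add: scaleR_2 algebra_simps)
        have eq': "(1/8) *\<^sub>R (x + x' + y) = u + u' + v" "(1/8) *\<^sub>R (x + x' - y) = u + u' - v"
          "(1/8) *\<^sub>R (x + y) = u + v" "(1/8) *\<^sub>R (x - y) = u - v"
          "(1/8) *\<^sub>R (x' + y) = u' + v" "(1/8) *\<^sub>R (x' - y) = u' - v"
          by (simp_all add: u_def u'_def v_def scaleR_add_right scaleR_diff_right)
        show ?thesis unfolding mixed_difference_def b_def eq eq' even by argo
      qed
      moreover have "\<bar>4 * w\<bar> \<le> 7 \<Longrightarrow> \<bar>w\<bar> \<le> 7/4" for w :: real by simp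
      ultimately show "\<bar>b (x + x') y - b x y - b x' y\<bar> \<le> 7/4" by metis
    next
      fix x assume x: "N x \<le> 1"
      obtain B where B: "\<And>t. 0 \<le> t \<Longrightarrow> t \<le> 1 \<Longrightarrow> \<bar>f ((1/8) *\<^sub>R (t *\<^sub>R x + y))\<bar> \<le> B"
        using eighth_segment_bounded[OF x y] by blast
      obtain B' where B': "\<And>t. 0 \<le> t \<Longrightarrow> t \<le> 1 \<Longrightarrow> \<bar>f ((1/8) *\<^sub>R (t *\<^sub>R x + - y))\<bar> \<le> B'"
        using eighth_segment_bounded[OF x, of "- y"] y minus by metis
      have "\<bar>b (t *\<^sub>R x) y\<bar> \<le> B + B'" if "0 \<le> t" "t \<le> 1" for t
        using B[OF that] B'[OF that] unfolding b_def by simp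
      then show "\<exists>B. \<forall>t. 0 \<le> t \<longrightarrow> t \<le> 1 \<longrightarrow> \<bar>b (t *\<^sub>R x) y\<bar> \<le> B" by blast
    next
      fix x assume x: "N x = 0"
      have "(1/8) *\<^sub>R (x + y) - (1/8) *\<^sub>R (y - x) = (1/4) *\<^sub>R x" by (simp add: fun_eq_iff algebra_simps)
      then have "N ((1/8) *\<^sub>R (x + y) - (1/8) *\<^sub>R (y - x)) = 0" using x by (simp only: scale mult_zero_right)
      then have "f ((1/8) *\<^sub>R (x + y)) = f ((1/8) *\<^sub>R (y - x))" by (rule respects_null)
      also have "(1/8) *\<^sub>R (y - x) = - ((1/8) *\<^sub>R (x - y))" by (simp add: algebra_simps)
      finally show "b x y = 0" unfolding b_def by (simp only: even) simp
    qed
  qed (use null_iff in blast)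
  then obtain T where T: "\<And>x y. N x \<le> 1 \<Longrightarrow> N y \<le> 1 \<Longrightarrow> \<bar>b x y - dual (T y) x\<bar> \<le> K" by metis
  obtain m y A where y: "\<And>j. j < m \<Longrightarrow> N (y j) \<le> 1"
    and rep: "\<And>x i. i < n \<Longrightarrow> x i = (\<Sum>j<m::nat. dual (A j) x * y j i)"
    and A: "\<And>x. N x \<le> 1 \<Longrightarrow> (\<Sum>j<m. \<bar>dual (A j) x\<bar>) \<le> 3 * sqrt (real n)"
    using short_linear_expansions[OF seminorm_axioms null_iff dim_pos] by blast
  \<comment> \<open>The functionals T y need not depend linearly on y; expanding y over the points y j makes them do so.\<close>
  define q where "q x = (\<Sum>j<m. dual (A j) x * dual (T (y j)) x)" for x
  have K: "0 \<le> K" using ln_ge_half by (simp add: K_def)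
  have q: "\<bar>q x - b x x\<bar> \<le> 7 * sqrt (real n) * K" if x: "N x \<le> 1" for x
  proof -
    \<comment> \<open>The linear functional T x commutes with the expansion of x, so only the differences between the two values below are summed.\<close>
    have "dual (T x) x = (\<Sum>i<n. \<Sum>j<m. T x i * (dual (A j) x * y j i))"
      by (intro sum.cong refl) (simp add: rep[symmetric] flip: sum_distrib_left)
    also have "\<dots> = (\<Sum>j<m. dual (A j) x * dual (T x) (y j))"
      by (subst sum.swap) (simp add: sum_distrib_left mult_ac)
    finally have Txx: "dual (T x) x = (\<Sum>j<m. dual (A j) x * dual (T x) (y j))" .
    have "\<bar>q x - dual (T x) x\<bar> = \<bar>\<Sum>j<m. dual (A j) x * (dual (T (y j)) x - dual (T x) (y j))\<bar>"
      unfolding Txx q_def by (simp add: right_diff_distrib sum_subtractf)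
    also have "\<dots> \<le> (\<Sum>j<m. \<bar>dual (A j) x * (dual (T (y j)) x - dual (T x) (y j))\<bar>)" by (rule sum_abs)
    also have "\<dots> \<le> (\<Sum>j<m. \<bar>dual (A j) x\<bar> * (2 * K))"
      unfolding abs_mult
    proof (intro sum_mono mult_left_mono)
      fix j assume "j \<in> {..<m}"
      then have j: "N (y j) \<le> 1" using y by simp
      show "\<bar>dual (T (y j)) x - dual (T x) (y j)\<bar> \<le> 2 * K"
        using T[OF x j] T[OF j x] b_sym[of x "y j"] by linarith
    qed simp
    also have "\<dots> = (\<Sum>j<m. \<bar>dual (A j) x\<bar>) * (2 * K)" by (simp add: sum_distrib_right)
    also have "\<dots> \<le> (3 * sqrt (real n)) * (2 * K)" using A[OF x] K by (intro mult_right_mono) auto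
    finally have "\<bar>q x - dual (T x) x\<bar> \<le> 6 * (sqrt (real n) * K)" by simp
    moreover have "\<bar>b x x - dual (T x) x\<bar> \<le> K" by (rule T[OF x x])
    moreover have "1 * K \<le> sqrt (real n) * K" using K sqrt_ge_one by (intro mult_right_mono) auto
    ultimately show ?thesis by linarith
  qed
  have double: "\<bar>f (2 *\<^sub>R u) - 4 * f u\<bar> \<le> 1" if "N (2 *\<^sub>R u) \<le> 1" for u
    using doubling_bound[OF that] by (simp add: even f0)
  \<comment> \<open>The factor is 4 * 16: b x x is f at x/4 divided by 4, and two doublings lead from x/4 to x.\<close>
  define a where "a i k = 64 * (\<Sum>j<m. A j i * T (y j) k)" for i k
  have a: "(\<Sum>i<n. \<Sum>k<n. a i k * x i * x k) = 64 * q x" for x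
  proof -
    have "q x = (\<Sum>j<m. \<Sum>i<n. \<Sum>k<n. A j i * T (y j) k * x i * x k)"
      by (simp add: q_def sum_product mult_ac)
    also have "\<dots> = (\<Sum>i<n. \<Sum>j<m. \<Sum>k<n. A j i * T (y j) k * x i * x k)" by (rule sum.swap)
    also have "\<dots> = (\<Sum>i<n. \<Sum>k<n. \<Sum>j<m. A j i * T (y j) k * x i * x k)"
      by (intro sum.cong refl sum.swap)
    finally show ?thesis by (simp add: a_def sum_distrib_left sum_distrib_right mult_ac)
  qed
  have "\<bar>f x - (\<Sum>i<n. \<Sum>k<n. a i k * x i * x k)\<bar> \<le> 36100 * sqrt (real n) * ln (real n + 1)"
    if x: "N x \<le> 1" for x
  proof -
    have d: "\<bar>f (c *\<^sub>R x) - 4 * f ((c/2) *\<^sub>R x)\<bar> \<le> 1" if "0 \<le> c" "c \<le> 1" for c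
    proof -
      have "N (2 *\<^sub>R ((c/2) *\<^sub>R x)) \<le> 1" using that x by (simp add: scale mult_le_one)
      from double[OF this] show ?thesis by simp
    qed
    have "(1/8) *\<^sub>R (x + x) = (1/4) *\<^sub>R x" by (simp add: fun_eq_iff)
    then have "b x x = f ((1/4) *\<^sub>R x) / 4" unfolding b_def by (simp add: f0)
    moreover have "\<bar>f x - 4 * f ((1/2) *\<^sub>R x)\<bar> \<le> 1" using d[of 1] by simp
    moreover have "\<bar>f ((1/2) *\<^sub>R x) - 4 * f ((1/4) *\<^sub>R x)\<bar> \<le> 1" using d[of "1/2"] by simp
    ultimately have 1: "\<bar>f x - 64 * b x x\<bar> \<le> 5" by linarith
    have "1 * (1 / 2) \<le> sqrt (real n) * ln (real n + 1)"
      using sqrt_ge_one ln_ge_half by (intro mult_mono) auto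
    then have "5 \<le> 10 * (sqrt (real n) * ln (real n + 1))" by simp
    moreover have "7 * sqrt (real n) * K = 1127 / 2 * (sqrt (real n) * ln (real n + 1))"
      by (simp add: K_def)
    ultimately show ?thesis using 1 q[OF x] unfolding a mult.assoc[of 36100] by linarith
  qed
  then show ?thesis by blast
qed

theorem near_quadratic:
  "\<exists>c b a. \<forall>x. N x \<le> 1 \<longrightarrow>
    \<bar>f x - (c + (\<Sum>i<n. b i * x i) + (\<Sum>i<n. \<Sum>k<n. a i k * x i * x k))\<bar>
      \<le> 38000 * sqrt (real n) * ln (real n + 1)"
proof -
  interpret o: quadratic_like N n "\<lambda>x. (f x + (- 1) * f (- x)) / 2 + 0"
    by (rule quadratic_like_average[OF quadratic_like_reflect]) simp
  interpret e: quadratic_like N n "\<lambda>x. (f x + 1 * f (- x)) / 2 + (- f 0)"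
    by (rule quadratic_like_average[OF quadratic_like_reflect]) simp
  obtain b where b: "\<And>x. N x \<le> 1 \<Longrightarrow> \<bar>(f x + (- 1) * f (- x)) / 2 + 0 - dual b x\<bar> \<le> 1302 * ln (real n + 1)"
  proof -
    have "(f (- x) + (- 1) * f (- (- x))) / 2 + 0 = - ((f x + (- 1) * f (- x)) / 2 + 0)" for x
      by (simp add: field_simps)
    from o.odd_near_linear[OF this] show ?thesis using that by blast
  qed
  obtain a where a: "\<And>x. N x \<le> 1 \<Longrightarrow> \<bar>(f x + 1 * f (- x)) / 2 + (- f 0) - (\<Sum>i<n. \<Sum>k<n. a i k * x i * x k)\<bar>
      \<le> 36100 * sqrt (real n) * ln (real n + 1)"
  proof -
    have "(f (- x) + 1 * f (- (- x))) / 2 + (- f 0) = (f x + 1 * f (- x)) / 2 + (- f 0)" for x by simp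
    moreover have "(f 0 + 1 * f (- 0)) / 2 + (- f 0) = 0" by simp
    ultimately show ?thesis using e.even_near_quadratic that by blast
  qed
  have "1 * ln (real n + 1) \<le> sqrt (real n) * ln (real n + 1)"
    using sqrt_ge_one by (intro mult_right_mono) auto
  then have *: "1302 * ln (real n + 1) + 36100 * sqrt (real n) * ln (real n + 1)
      \<le> 38000 * sqrt (real n) * ln (real n + 1)" using ln_ge_half unfolding mult.assoc by linarith
  then have "\<bar>f x - (f 0 + dual b x + (\<Sum>i<n. \<Sum>k<n. a i k * x i * x k))\<bar>
      \<le> 38000 * sqrt (real n) * ln (real n + 1)" if x: "N x \<le> 1" for x
  proof -
    let ?o = "(f x + (- 1) * f (- x)) / 2 + 0 - dual b x"
    let ?e = "(f x + 1 * f (- x)) / 2 + (- f 0) - (\<Sum>i<n. \<Sum>k<n. a i k * x i * x k)"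
    have "A - (C + L + Q) = ((A + (- 1) * B) / 2 + 0 - L) + ((A + 1 * B) / 2 + (- C) - Q)" for A B C L Q :: real
      by (simp add: field_simps)
    then have "\<bar>f x - (f 0 + dual b x + (\<Sum>i<n. \<Sum>k<n. a i k * x i * x k))\<bar> = \<bar>?o + ?e\<bar>"
      by (rule arg_cong)
    also have "\<dots> \<le> \<bar>?o\<bar> + \<bar>?e\<bar>" by (rule abs_triangle_ineq)
    also have "\<dots> \<le> 1302 * ln (real n + 1) + 36100 * sqrt (real n) * ln (real n + 1)"
      by (rule add_mono[OF b[OF x] a[OF x]])
    also note *
    finally show ?thesis .
  qed
  then show ?thesis by (intro exI[of _ "f 0"] exI[of _ b] exI[of _ a] allI impI)
qed

end

section \<open>Polynomials of degree at most two\<close>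

lemma polynomialsI:
  "p = (\<lambda>x. \<Sum>\<alpha>\<in>multi_indices n d. a \<alpha> * (\<Prod>i<n. (x $ i) ^ \<alpha> i)) \<Longrightarrow> p \<in> polynomials n d"
  by (auto simp: polynomials_def)

lemma polynomials_add:
  assumes "p \<in> polynomials n d" "q \<in> polynomials n d"
  shows "(\<lambda>x. p x + q x) \<in> polynomials n d"
proof -
  obtain a b where "p = (\<lambda>x. \<Sum>\<alpha>\<in>multi_indices n d. a \<alpha> * (\<Prod>i<n. (x $ i) ^ \<alpha> i))"
    "q = (\<lambda>x. \<Sum>\<alpha>\<in>multi_indices n d. b \<alpha> * (\<Prod>i<n. (x $ i) ^ \<alpha> i))"
    using assms by (auto simp: polynomials_def)
  then have "(\<lambda>x. p x + q x) = (\<lambda>x. \<Sum>\<alpha>\<in>multi_indices n d. (a \<alpha> + b \<alpha>) * (\<Prod>i<n. (x $ i) ^ \<alpha> i))"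
    by (simp add: distrib_right sum.distrib)
  then show ?thesis by (rule polynomialsI)
qed

lemma polynomials_scale:
  assumes "p \<in> polynomials n d"
  shows "(\<lambda>x. c * p x) \<in> polynomials n d"
proof -
  obtain a where "p = (\<lambda>x. \<Sum>\<alpha>\<in>multi_indices n d. a \<alpha> * (\<Prod>i<n. (x $ i) ^ \<alpha> i))"
    using assms by (auto simp: polynomials_def)
  then have "(\<lambda>x. c * p x) = (\<lambda>x. \<Sum>\<alpha>\<in>multi_indices n d. (c * a \<alpha>) * (\<Prod>i<n. (x $ i) ^ \<alpha> i))"
    by (simp add: sum_distrib_left mult.assoc)
  then show ?thesis by (rule polynomialsI)
qed

lemma polynomials_monomial:
  assumes "\<alpha> \<in> multi_indices n d"
  shows "(\<lambda>x. \<Prod>i<n. (x $ i) ^ \<alpha> i) \<in> polynomials n d"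
proof -
  have "(\<lambda>x. \<Prod>i<n. (x $ i) ^ \<alpha> i) =
    (\<lambda>x. \<Sum>\<beta>\<in>multi_indices n d. (if \<beta> = \<alpha> then 1 else 0) * (\<Prod>i<n. ((x :: real vec) $ i) ^ \<beta> i))"
    using assms by (intro ext) (simp add: finite_multi_indices if_distrib[of "\<lambda>u. u * _"] cong: if_cong)
  then show ?thesis by (rule polynomialsI)
qed

lemma polynomials_sum:
  assumes "finite I" "\<And>i. i \<in> I \<Longrightarrow> p i \<in> polynomials n d"
  shows "(\<lambda>x. \<Sum>i\<in>I. p i x) \<in> polynomials n d"
  using assms
proof (induction I rule: finite_induct)
  case empty
  have "(\<lambda>x :: real vec. 0) = (\<lambda>x. \<Sum>\<alpha>\<in>multi_indices n d. 0 * (\<Prod>i<n. (x $ i) ^ \<alpha> i))" by simp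
  then show ?case unfolding sum.empty by (rule polynomialsI)
next
  case (insert i I)
  then have "(\<lambda>x. p i x + (\<Sum>i\<in>I. p i x)) \<in> polynomials n d" by (intro polynomials_add) auto
  with insert.hyps show ?case by simp
qed

lemma quadratic_mem_polynomials:
  "(\<lambda>x. c + (\<Sum>i<n. b i * x $ i) + (\<Sum>i<n. \<Sum>k<n. a i k * x $ i * x $ k)) \<in> polynomials n 2"
proof -
  have 0: "(\<lambda>x. 1) \<in> polynomials n 2"
    using polynomials_monomial[of "\<lambda>_. 0" n 2] by (simp add: multi_indices_def)
  have delta: "(\<Prod>j<n. (x $ j) ^ (if j = i then 1 else 0)) = x $ i" if "i < n" for i and x :: "real vec"
    using that by (simp add: if_distrib[of "\<lambda>e. _ ^ e"] cong: if_cong)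
  have 1: "(\<lambda>x. x $ i) \<in> polynomials n 2" if "i < n" for i
  proof -
    have "(\<lambda>j. if j = i then 1 else 0) \<in> multi_indices n 2" using that by (simp add: multi_indices_def)
    from polynomials_monomial[OF this] show ?thesis unfolding delta[OF that] .
  qed
  have 2: "(\<lambda>x. x $ i * x $ k) \<in> polynomials n 2" if "i < n" "k < n" for i k
  proof -
    have "(\<lambda>j. (if j = i then 1 else 0) + (if j = k then 1 else 0)) \<in> multi_indices n 2"
      using that by (simp add: multi_indices_def sum.distrib)
    from polynomials_monomial[OF this] show ?thesis
      unfolding power_add prod.distrib delta[OF that(1)] delta[OF that(2)] .
  qed
  have "(\<lambda>x. c * 1 + (\<Sum>i\<in>{..<n}. b i * x $ i) + (\<Sum>i\<in>{..<n}. \<Sum>k\<in>{..<n}. a i k * (x $ i * x $ k))) \<in> polynomials n 2"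
    by (intro polynomials_add polynomials_sum polynomials_scale 0 1 2) auto
  then show ?thesis by (simp add: mult.assoc)
qed

definition quadratic :: "nat \<Rightarrow> (real vec \<Rightarrow> real) \<Rightarrow> bool" where
  "quadratic n p \<longleftrightarrow> (\<exists>c b a. \<forall>x. p x = c + (\<Sum>i<n. b i * x $ i) + (\<Sum>i<n. \<Sum>k<n. a i k * x $ i * x $ k))"

lemma quadratic_zero: "quadratic n (\<lambda>x. 0)"
  unfolding quadratic_def
  by (rule exI[of _ 0], rule exI[of _ "\<lambda>_. 0"], rule exI[of _ "\<lambda>_ _. 0"]) simp

lemma quadratic_add:
  assumes "quadratic n p" "quadratic n q"
  shows "quadratic n (\<lambda>x. p x + q x)"
proof -
  obtain c b a where p: "\<And>x. p x = c + (\<Sum>i<n. b i * x $ i) + (\<Sum>i<n. \<Sum>k<n. a i k * x $ i * x $ k)"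
    using assms(1) unfolding quadratic_def by blast
  obtain c' b' a' where q: "\<And>x. q x = c' + (\<Sum>i<n. b' i * x $ i) + (\<Sum>i<n. \<Sum>k<n. a' i k * x $ i * x $ k)"
    using assms(2) unfolding quadratic_def by blast
  show ?thesis unfolding quadratic_def
    by (rule exI[of _ "c + c'"], rule exI[of _ "\<lambda>i. b i + b' i"], rule exI[of _ "\<lambda>i k. a i k + a' i k"])
       (simp add: p q distrib_right sum.distrib)
qed

lemma quadratic_scale:
  assumes "quadratic n p"
  shows "quadratic n (\<lambda>x. r * p x)"
proof -
  obtain c b a where p: "\<And>x. p x = c + (\<Sum>i<n. b i * x $ i) + (\<Sum>i<n. \<Sum>k<n. a i k * x $ i * x $ k)"
    using assms(1) unfolding quadratic_def by blast
  show ?thesis unfolding quadratic_def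
    by (rule exI[of _ "r * c"], rule exI[of _ "\<lambda>i. r * b i"], rule exI[of _ "\<lambda>i k. r * a i k"])
       (simp add: p distrib_left sum_distrib_left mult.assoc)
qed

text \<open>
Splitting off one variable at a time replaces a classification of the multi-indices of degree 2.
\<close>

lemma monomial_cases:
  fixes \<alpha> :: "nat \<Rightarrow> nat"
  assumes "(\<Sum>i<n. \<alpha> i) = Suc d"
  shows "\<exists>i<n. \<exists>\<beta>. (\<Sum>j<n. \<beta> j) = d \<and>
    (\<forall>x::real vec. (\<Prod>j<n. (x $ j) ^ \<alpha> j) = x $ i * (\<Prod>j<n. (x $ j) ^ \<beta> j))"
proof -
  obtain i where i: "i < n" "0 < \<alpha> i"
  proof -
    have "\<not> (\<forall>i<n. \<alpha> i = 0)"
    proof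
      assume "\<forall>i<n. \<alpha> i = 0"
      then have "(\<Sum>i<n. \<alpha> i) = 0" by simp
      with assms show False by simp
    qed
    then show ?thesis using that by auto
  qed
  define \<beta> where "\<beta> = \<alpha>(i := \<alpha> i - 1)"
  have \<alpha>: "\<alpha> j = (if j = i then 1 else 0) + \<beta> j" for j using i by (simp add: \<beta>_def)
  have "(\<Sum>j<n. \<alpha> j) = 1 + (\<Sum>j<n. \<beta> j)" unfolding \<alpha> sum.distrib using i by simp
  then have "(\<Sum>j<n. \<beta> j) = d" using assms by simp
  moreover have "(\<Prod>j<n. (x $ j) ^ \<alpha> j) = x $ i * (\<Prod>j<n. (x $ j) ^ \<beta> j)" for x :: "real vec"
    unfolding \<alpha> power_add prod.distrib using i(1)
    by (simp add: if_distrib[of "\<lambda>e. _ ^ e"] cong: if_cong)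
  ultimately show ?thesis using i(1) by blast
qed

lemma quadratic_monomial:
  assumes "\<alpha> \<in> multi_indices n 2"
  shows "quadratic n (\<lambda>x. \<Prod>i<n. (x $ i) ^ \<alpha> i)"
proof -
  have const: "(\<Prod>j<n. (x $ j) ^ \<beta> j) = 1" if "(\<Sum>j<n. \<beta> j) = 0" for \<beta> and x :: "real vec"
    using that by (intro prod.neutral) auto
  consider "(\<Sum>i<n. \<alpha> i) = 0" | "(\<Sum>i<n. \<alpha> i) = Suc 0" | "(\<Sum>i<n. \<alpha> i) = Suc (Suc 0)"
    using assms by (fastforce simp: multi_indices_def)
  then show ?thesis
  proof cases
    case 1
    show ?thesis unfolding quadratic_def
      by (rule exI[of _ 1], rule exI[of _ "\<lambda>_. 0"], rule exI[of _ "\<lambda>_ _. 0"]) (simp add: const[OF 1])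
  next
    case 2
    then obtain i \<beta> where i: "i < n" and \<beta>: "(\<Sum>j<n. \<beta> j) = 0"
      "\<And>x::real vec. (\<Prod>j<n. (x $ j) ^ \<alpha> j) = x $ i * (\<Prod>j<n. (x $ j) ^ \<beta> j)"
      using monomial_cases[OF 2] by blast
    show ?thesis unfolding quadratic_def
      by (rule exI[of _ 0], rule exI[of _ "\<lambda>j. if j = i then 1 else 0"], rule exI[of _ "\<lambda>_ _. 0"])
         (use i in \<open>simp add: \<beta>(2) const[OF \<beta>(1)] if_distrib[of "\<lambda>u. u * _"] cong: if_cong\<close>)
  next
    case 3
    then obtain i \<beta> where i: "i < n" and \<beta>: "(\<Sum>j<n. \<beta> j) = Suc 0"
      "\<And>x::real vec. (\<Prod>j<n. (x $ j) ^ \<alpha> j) = x $ i * (\<Prod>j<n. (x $ j) ^ \<beta> j)"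
      using monomial_cases[OF 3] by blast
    obtain k \<gamma> where k: "k < n" and \<gamma>: "(\<Sum>j<n. \<gamma> j) = 0"
      "\<And>x::real vec. (\<Prod>j<n. (x $ j) ^ \<beta> j) = x $ k * (\<Prod>j<n. (x $ j) ^ \<gamma> j)"
      using monomial_cases[OF \<beta>(1)] by blast
    have "(\<Sum>j<n. \<Sum>l<n. (if j = i then if l = k then 1 else 0 else 0) * x $ j * x $ l) = x $ i * x $ k"
      for x :: "real vec"
    proof -
      have "(\<Sum>j<n. \<Sum>l<n. (if j = i then if l = k then 1 else 0 else 0) * x $ j * x $ l) =
        (\<Sum>j<n. \<Sum>l<n. if l = k then (if j = i then x $ j * x $ l else 0) else 0)"
        by (intro sum.cong refl) auto
      then show ?thesis using i k by simp
    qed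
    then show ?thesis unfolding quadratic_def
      by (intro exI[of _ 0] exI[of _ "\<lambda>_. 0"] exI[of _ "\<lambda>j l. if j = i then if l = k then 1 else 0 else 0"])
         (simp add: \<beta>(2) \<gamma>(2) const[OF \<gamma>(1)])
  qed
qed

lemma polynomials_quadratic:
  assumes "p \<in> polynomials n 2"
  shows "quadratic n p"
proof -
  obtain a where p: "p = (\<lambda>x. \<Sum>\<alpha>\<in>multi_indices n 2. a \<alpha> * (\<Prod>i<n. (x $ i) ^ \<alpha> i))"
    using assms by (auto simp: polynomials_def)
  have "quadratic n (\<lambda>x. \<Sum>\<alpha>\<in>A. a \<alpha> * (\<Prod>i<n. (x $ i) ^ \<alpha> i))" if "A \<subseteq> multi_indices n 2" for A
    using finite_subset[OF that finite_multi_indices] that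
  proof (induction A rule: finite_induct)
    case empty then show ?case by (simp add: quadratic_zero)
  next
    case (insert \<alpha> A)
    then have "quadratic n (\<lambda>x. a \<alpha> * (\<Prod>i<n. (x $ i) ^ \<alpha> i) + (\<Sum>\<alpha>\<in>A. a \<alpha> * (\<Prod>i<n. (x $ i) ^ \<alpha> i)))"
      by (intro quadratic_add quadratic_scale quadratic_monomial) auto
    with insert.hyps show ?case by simp
  qed
  then show ?thesis unfolding p by blast
qed

section \<open>The upper bound\<close>

lemma vec_add: "vec n (x + y) = vec n x + vec n y"
  and vec_scaleR: "vec n (c *\<^sub>R x) = c \<cdot>\<^sub>v vec n x" for x y :: "nat \<Rightarrow> real"
  by (auto intro!: eq_vecI)

lemma vec_index_id: "v \<in> carrier_vec n \<Longrightarrow> vec n (\<lambda>i. v $ i) = v"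
  by (auto intro!: eq_vecI)

lemma Delta3_expand: "Delta3 f h x = f (x + 3 \<cdot>\<^sub>v h) - 3 * f (x + 2 \<cdot>\<^sub>v h) + 3 * f (x + 1 \<cdot>\<^sub>v h) - f (x + 0 \<cdot>\<^sub>v h)"
  by (simp add: Delta3_def numeral_3_eq_3 numeral_2_eq_2)

lemma norm_on_seminorm:
  assumes "norm_on n N"
  shows "seminorm (\<lambda>x. N (vec n x))"
  using assms by unfold_locales (simp_all add: norm_on_def vec_add vec_scaleR)

lemma norm_on_finite_dim_norm:
  assumes N: "norm_on n N" and n: "1 \<le> n"
  shows "finite_dim_norm (\<lambda>x. N (vec n x)) n"
proof -
  interpret seminorm "\<lambda>x. N (vec n x)" by (rule norm_on_seminorm[OF N])
  show ?thesis
  proof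
    fix x
    have "N (vec n x) = 0 \<longleftrightarrow> vec n x = 0\<^sub>v n" using N by (simp add: norm_on_def)
    also have "\<dots> \<longleftrightarrow> (\<forall>i<n. x i = 0)" by (auto simp: vec_eq_iff)
    finally show "N (vec n x) = 0 \<longleftrightarrow> (\<forall>i<n. x i = 0)" .
  qed (rule n)
qed

text \<open>
Continuity enters the upper bound through this boundedness, which excludes irregular solutions of
the additive and quadratic functional equations.
\<close>

lemma cont_on_ball_segment_bounded:
  assumes N: "norm_on n N" and f: "cont_on_ball n N f"
    and seg: "\<And>t. 0 \<le> t \<Longrightarrow> t \<le> 1 \<Longrightarrow> N (vec n (u + t *\<^sub>R x)) \<le> 1"
  shows "\<exists>B. \<forall>t. 0 \<le> t \<longrightarrow> t \<le> 1 \<longrightarrow> \<bar>f (vec n (u + t *\<^sub>R x))\<bar> \<le> B"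
proof -
  interpret seminorm "\<lambda>x. N (vec n x)" by (rule norm_on_seminorm[OF N])
  define g where "g t = f (vec n (u + t *\<^sub>R x))" for t
  have "continuous_on {0..1} g"
    unfolding continuous_on_def
  proof (intro ballI tendstoI)
    fix t e :: real assume t: "t \<in> {0..1}" and e: "0 < e"
    have ball: "vec n (u + s *\<^sub>R x) \<in> unit_ball n N" if "s \<in> {0..1}" for s
      using seg that by (simp add: unit_ball_def)
    obtain d where d: "0 < d" "\<And>y. y \<in> unit_ball n N \<Longrightarrow> N (y - vec n (u + t *\<^sub>R x)) < d \<Longrightarrow> \<bar>f y - g t\<bar> < e"
      using f ball[OF t] e unfolding cont_on_ball_def g_def by meson
    have Nx: "0 \<le> N (vec n x)" by (rule nonneg)
    have "\<bar>g s - g t\<bar> < e" if s: "s \<in> {0..1}" "\<bar>s - t\<bar> < d / (N (vec n x) + 1)" for s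
      unfolding g_def[of s]
    proof (rule d(2)[OF ball[OF s(1)]])
      have "vec n (u + s *\<^sub>R x) - vec n (u + t *\<^sub>R x) = vec n ((s - t) *\<^sub>R x)"
        by (auto intro!: eq_vecI simp: algebra_simps)
      then have "N (vec n (u + s *\<^sub>R x) - vec n (u + t *\<^sub>R x)) = \<bar>s - t\<bar> * N (vec n x)"
        by (simp only: scale)
      also have "\<dots> \<le> \<bar>s - t\<bar> * (N (vec n x) + 1)" by (intro mult_left_mono) auto
      also have "\<dots> < d" using s(2) Nx by (simp add: field_simps)
      finally show "N (vec n (u + s *\<^sub>R x) - vec n (u + t *\<^sub>R x)) < d" .
    qed
    moreover have "0 < d / (N (vec n x) + 1)" using d(1) Nx by (intro divide_pos_pos add_nonneg_pos) auto
    ultimately show "eventually (\<lambda>s. dist (g s) (g t) < e) (at t within {0..1})"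
      unfolding eventually_at dist_real_def
      by (intro exI[of _ "d / (N (vec n x) + 1)"]) auto
  qed
  then have "continuous_on {0..1} (\<lambda>t. \<bar>g t\<bar>)" by (intro continuous_intros)
  then have "\<exists>t0\<in>{0..1}. \<forall>t\<in>{0..1}. \<bar>g t\<bar> \<le> \<bar>g t0\<bar>"
    by (intro continuous_attains_sup) auto
  then obtain t0 where "\<forall>t\<in>{0..1}. \<bar>g t\<bar> \<le> \<bar>g t0\<bar>" by blast
  then show ?thesis unfolding g_def by (intro exI[of _ "\<bar>f (vec n (u + t0 *\<^sub>R x))\<bar>"]) auto
qed

lemma omega3_quadratic_like:
  assumes N: "norm_on n N" and f: "cont_on_ball n N f" and w: "omega3 n N f \<le> 1" and n: "1 \<le> n"
  shows "quadratic_like (\<lambda>x. N (vec n x)) n (\<lambda>x. f (vec n x))"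
proof -
  interpret finite_dim_norm "\<lambda>x. N (vec n x)" n by (rule norm_on_finite_dim_norm[OF N n])
  show ?thesis
  proof
    fix x h
    assume a: "N (vec n x) \<le> 1" "N (vec n (x + h)) \<le> 1" "N (vec n (x + 2 *\<^sub>R h)) \<le> 1" "N (vec n (x + 3 *\<^sub>R h)) \<le> 1"
    have eq: "vec n x + 3 \<cdot>\<^sub>v vec n h = vec n (x + 3 *\<^sub>R h)" "vec n x + 2 \<cdot>\<^sub>v vec n h = vec n (x + 2 *\<^sub>R h)"
      "vec n x + 1 \<cdot>\<^sub>v vec n h = vec n (x + h)" "vec n x + 0 \<cdot>\<^sub>v vec n h = vec n x"
      by (auto intro!: eq_vecI)
    have "vec n x + real j \<cdot>\<^sub>v vec n h \<in> unit_ball n N" if "j \<in> {0..3}" for j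
    proof -
      consider "j = 0" | "j = 1" | "j = 2" | "j = 3" using \<open>j \<in> {0..3}\<close> by fastforce
      then show ?thesis by cases (use a eq in \<open>auto simp: unit_ball_def\<close>)
    qed
    then have "ereal \<bar>Delta3 f (vec n h) (vec n x)\<bar> \<le> omega3 n N f"
      unfolding omega3_def by (intro SUP_upper2[of "(vec n x, vec n h)"]) auto
    also note w
    finally have "\<bar>Delta3 f (vec n h) (vec n x)\<bar> \<le> 1" by simp
    then show "\<bar>third_difference (\<lambda>x. f (vec n x)) h x\<bar> \<le> 1"
      unfolding Delta3_expand eq third_difference_def .
  next
    fix x y assume "N (vec n (x - y)) = 0"
    then have "\<forall>i<n. (x - y) i = 0" by (simp only: null_iff)
    then have "vec n x = vec n y" by (auto intro!: eq_vecI)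
    then show "f (vec n x) = f (vec n y)" by simp
  qed (rule cont_on_ball_segment_bounded[OF N f])
qed

theorem w3s_upper:
  assumes n: "1 \<le> n"
  shows "w3s n \<le> ereal (38000 * sqrt (real n) * ln (real n + 1))"
  unfolding w3s_def w3_def
proof (intro Sup_least, clarify, intro Sup_least, clarify)
  fix N f assume N: "norm_on n N" and f: "cont_on_ball n N f" "omega3 n N f \<le> 1"
  interpret quadratic_like "\<lambda>x. N (vec n x)" n "\<lambda>x. f (vec n x)"
    by (rule omega3_quadratic_like[OF N f n])
  obtain c b a where abc: "\<And>x. N (vec n x) \<le> 1 \<Longrightarrow>
    \<bar>f (vec n x) - (c + (\<Sum>i<n. b i * x i) + (\<Sum>i<n. \<Sum>k<n. a i k * x i * x k))\<bar>
      \<le> 38000 * sqrt (real n) * ln (real n + 1)"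
    using near_quadratic by blast
  show "E3 n N f \<le> ereal (38000 * sqrt (real n) * ln (real n + 1))"
    unfolding E3_def
  proof (rule INF_lower2[OF quadratic_mem_polynomials[where c = c and b = b and a = a]], rule SUP_least)
    fix x assume x: "x \<in> unit_ball n N"
    then have v: "vec n (\<lambda>i. x $ i) = x" by (intro vec_index_id) (simp add: unit_ball_def)
    from x have "N (vec n (\<lambda>i. x $ i)) \<le> 1" unfolding v by (simp add: unit_ball_def)
    from abc[OF this] show "ereal \<bar>f x - (c + (\<Sum>i<n. b i * x $ i) + (\<Sum>i<n. \<Sum>k<n. a i k * x $ i * x $ k))\<bar>
      \<le> ereal (38000 * sqrt (real n) * ln (real n + 1))" unfolding v by simp
  qed
qed

section \<open>The discrete sine transform\<close>

text \<open>
Multiplication by \<open>2 sin a\<close>, where \<open>2 a\<close> is the basic angle, makes the sum telescope.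
\<close>

lemma sum_cos_multiples:
  fixes n m :: nat
  assumes m: "0 < m" "m < 2 * (n + 1)"
  shows "(\<Sum>k<n. cos (real m * real (k + 1) * (pi / real (n + 1)))) = (- ((- 1) ^ m) - 1) / 2"
proof -
  define a where "a = real m * (pi / real (n + 1)) / 2"
  have sin_a: "sin a \<noteq> 0"
  proof -
    have "0 < a" using m by (simp add: a_def)
    moreover have "a < pi"
    proof -
      have "real m / real (2 * (n + 1)) < 1" using m by simp
      then have "pi * (real m / real (2 * (n + 1))) < pi * 1" by (intro mult_strict_left_mono) auto
      then show ?thesis by (simp add: a_def field_simps)
    qed
    ultimately show ?thesis using sin_gt_zero by fastforce
  qed
  have tele: "2 * sin a * (\<Sum>k<l. cos (2 * real (k + 1) * a)) = sin ((2 * real l + 1) * a) - sin a" for l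
  proof (induction l)
    case (Suc l)
    have "2 * sin a * cos (2 * real (l + 1) * a) = sin (2 * real (l + 1) * a + a) - sin (2 * real (l + 1) * a - a)"
      by (simp add: sin_add sin_diff)
    also have "2 * real (l + 1) * a + a = (2 * real (Suc l) + 1) * a" by (simp add: algebra_simps)
    also have "2 * real (l + 1) * a - a = (2 * real l + 1) * a" by (simp add: algebra_simps)
    finally show ?case using Suc by (simp add: distrib_left)
  qed simp
  have "(2 * real n + 1) * a = real m * pi - a" by (simp add: a_def field_simps)
  then have "sin ((2 * real n + 1) * a) = - ((- 1) ^ m * sin a)"
    by (simp add: sin_diff)
  with tele[of n] have "2 * sin a * (\<Sum>k<n. cos (2 * real (k + 1) * a)) = sin a * (- ((- 1) ^ m) - 1)"
    by (simp only: right_diff_distrib mult_minus_right mult_1_right) (simp only: mult.commute)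
  then have "sin a * (2 * (\<Sum>k<n. cos (2 * real (k + 1) * a))) = sin a * (- ((- 1) ^ m) - 1)"
    by (simp only: mult_ac)
  then have "2 * (\<Sum>k<n. cos (2 * real (k + 1) * a)) = - ((- 1) ^ m) - 1"
    using mult_left_cancel[OF sin_a] by blast
  then have "(\<Sum>k<n. cos (2 * real (k + 1) * a)) = (- ((- 1) ^ m) - 1) / 2" by simp
  moreover have "2 * real (k + 1) * a = real m * real (k + 1) * (pi / real (n + 1))" for k
  proof -
    have "2 * a = real m * (pi / real (n + 1))" unfolding a_def by (rule nonzero_mult_div_cancel_left[THEN trans[OF times_divide_eq_right]]) simp
    then show ?thesis by (metis mult.assoc mult.commute)
  qed
  ultimately show ?thesis by simp
qed

text \<open>
The product of sines is half the difference of the cosines with the frequencies \<open>i - j\<close> and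
\<open>i + j + 2\<close>. These have the same parity, so their cosine sums agree unless \<open>i = j\<close>, when they are \<open>n\<close> and \<open>- 1\<close>.
\<close>

lemma sine_orthogonality:
  fixes n i j :: nat
  assumes ij: "i < n" "j < n"
  defines "\<theta> \<equiv> pi / real (n + 1)"
  shows "(\<Sum>k<n. sin (real ((i + 1) * (k + 1)) * \<theta>) * sin (real ((k + 1) * (j + 1)) * \<theta>))
    = (if i = j then real (n + 1) / 2 else 0)"
proof -
  define C where "C m = (\<Sum>k<n. cos (real m * real (k + 1) * \<theta>))" for m :: nat
  have C: "C m = (- ((- 1) ^ m) - 1) / 2" if "0 < m" "m < 2 * (n + 1)" for m
    unfolding C_def \<theta>_def by (rule sum_cos_multiples[OF that])
  have prod: "(\<Sum>k<n. sin (real ((i + 1) * (k + 1)) * \<theta>) * sin (real ((k + 1) * (j + 1)) * \<theta>))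
      = (C (i - j) - C (i + j + 2)) / 2" if "j \<le> i" for i j
  proof -
    have "sin (real ((i + 1) * (k + 1)) * \<theta>) * sin (real ((k + 1) * (j + 1)) * \<theta>) =
        (cos (real (i - j) * real (k + 1) * \<theta>) - cos (real (i + j + 2) * real (k + 1) * \<theta>)) / 2" for k
    proof -
      have "real (i - j) * real (k + 1) * \<theta> = real ((i + 1) * (k + 1)) * \<theta> - real ((k + 1) * (j + 1)) * \<theta>"
        using that by (simp add: of_nat_diff algebra_simps)
      moreover have "real (i + j + 2) * real (k + 1) * \<theta> = real ((i + 1) * (k + 1)) * \<theta> + real ((k + 1) * (j + 1)) * \<theta>"
        by (simp add: algebra_simps)
      ultimately show ?thesis by (simp only: sin_times_sin)
    qed
    then show ?thesis unfolding C_def by (simp only: sum_subtractf sum_divide_distrib diff_divide_distrib)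
  qed
  have off: "C (i - j) = C (i + j + 2)" if "j < i" "i < n" for i j
  proof -
    have "even (i - j) \<longleftrightarrow> even (i + j + 2)" using that by auto
    then have "(- 1 :: real) ^ (i - j) = (- 1) ^ (i + j + 2)" by (simp only: minus_one_power_iff)
    then show ?thesis using that by (simp add: C)
  qed
  consider "i = j" | "j < i" | "i < j" by linarith
  then show ?thesis
  proof cases
    case 1
    have "C 0 = real n" by (simp add: C_def)
    moreover have "C (i + i + 2) = - 1" using ij by (subst C) auto
    ultimately show ?thesis using prod[of i i] 1 by simp
  next
    case 2
    then show ?thesis using prod[of j i] off[of j i] ij by simp
  next
    case 3
    have "(\<Sum>k<n. sin (real ((i + 1) * (k + 1)) * \<theta>) * sin (real ((k + 1) * (j + 1)) * \<theta>)) =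
      (\<Sum>k<n. sin (real ((j + 1) * (k + 1)) * \<theta>) * sin (real ((k + 1) * (i + 1)) * \<theta>))"
      by (intro sum.cong refl) (simp only: mult.commute)
    also have "\<dots> = 0" using 3 prod[of i j] off[of i j] ij by simp
    finally show ?thesis using 3 by simp
  qed
qed

section \<open>The space generated by a flat orthogonal reflection\<close>

text \<open>
\<open>W\<close> is symmetric and orthogonal, so \<open>V\<close> is a reflection and \<open>P\<close>, \<open>Q\<close> below are the orthogonal
projections to its eigenspaces for \<open>- 1\<close> and \<open>1\<close>. Its entries are as small as possible up to a
constant if \<open>s\<close> is of order \<open>\<surd>n\<close>; this flatness makes the two eigenspaces badly complemented with
respect to the maximum norm.
\<close>

locale reflection =
  fixes n :: nat and W :: "nat \<Rightarrow> nat \<Rightarrow> real" and s :: real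
  assumes sym: "W i j = W j i"
    and involution: "i < n \<Longrightarrow> j < n \<Longrightarrow> (\<Sum>k<n. W i k * W k j) = (if i = j then 1 else 0)"
    and s_ge_one: "1 \<le> s" and entry_le: "\<bar>W i j\<bar> \<le> 1 / s"
begin

definition V :: "(nat \<Rightarrow> real) \<Rightarrow> nat \<Rightarrow> real" where
  "V x = (\<lambda>i. \<Sum>j<n. W i j * x j)"

definition P :: "(nat \<Rightarrow> real) \<Rightarrow> nat \<Rightarrow> real" where
  "P x = (\<lambda>i. if i < n then (x i - V x i) / 2 else 0)"

definition Q :: "(nat \<Rightarrow> real) \<Rightarrow> nat \<Rightarrow> real" where
  "Q x = (\<lambda>i. if i < n then (x i + V x i) / 2 else 0)"

definition ip :: "(nat \<Rightarrow> real) \<Rightarrow> (nat \<Rightarrow> real) \<Rightarrow> real" where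
  "ip x y = (\<Sum>i<n. x i * y i)"

lemma V_add: "V (x + y) i = V x i + V y i"
  by (simp add: V_def algebra_simps sum.distrib)

lemma V_scale: "V (c *\<^sub>R x) i = c * V x i"
  by (simp add: V_def sum_distrib_left mult_ac)

lemma V_cong: "(\<And>i. i < n \<Longrightarrow> x i = y i) \<Longrightarrow> V x = V y"
  by (simp add: V_def)

lemma V_V: "i < n \<Longrightarrow> V (V x) i = x i"
proof -
  assume i: "i < n"
  have "V (V x) i = (\<Sum>j<n. \<Sum>k<n. W i j * W j k * x k)"
    by (simp add: V_def sum_distrib_left mult.assoc)
  also have "\<dots> = (\<Sum>k<n. (\<Sum>j<n. W i j * W j k) * x k)"
    by (subst sum.swap) (simp add: sum_distrib_right)
  also have "\<dots> = (\<Sum>k<n. (if i = k then 1 else 0) * x k)" using i by (simp add: involution)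
  also have "\<dots> = x i" using i by (simp add: if_distrib[of "\<lambda>u. u * _"] cong: if_cong)
  finally show ?thesis .
qed

lemma linear_P: "linear P"
  by (rule linearI) (auto simp: P_def V_add V_scale fun_eq_iff field_simps)

lemma linear_Q: "linear Q"
  by (rule linearI) (auto simp: Q_def V_add V_scale fun_eq_iff field_simps)

lemma P_plus_Q: "i < n \<Longrightarrow> P x i + Q x i = x i"
  by (simp add: P_def Q_def field_simps)

lemma V_P:
  assumes "i < n"
  shows "V (P x) i = - P x i"
proof -
  have "V (P x) = V ((1/2) *\<^sub>R (x + (- 1) *\<^sub>R V x))" by (rule V_cong) (simp add: P_def)
  then have "V (P x) i = (V x i - V (V x) i) / 2" by (simp only: V_scale V_add) simp
  then show ?thesis using assms by (simp add: P_def V_V field_simps)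
qed

lemma V_Q:
  assumes "i < n"
  shows "V (Q x) i = Q x i"
proof -
  have "V (Q x) = V ((1/2) *\<^sub>R (x + V x))" by (rule V_cong) (simp add: Q_def)
  then have "V (Q x) i = (V x i + V (V x) i) / 2" by (simp add: V_scale V_add)
  then show ?thesis using assms by (simp add: Q_def V_V field_simps)
qed

lemma P_P: "P (P x) = P x"
proof
  fix i show "P (P x) i = P x i"
    by (cases "i < n") (simp_all add: P_def[of "P x"] V_P, simp add: P_def)
qed

lemma P_Q: "P (Q x) = 0"
proof
  fix i show "P (Q x) i = 0 i" by (simp add: P_def[of "Q x"] V_Q)
qed

lemma P_cong: "(\<And>i. i < n \<Longrightarrow> x i = y i) \<Longrightarrow> P x = P y"
  using V_cong[of x y] by (simp add: P_def fun_eq_iff)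

lemma ip_V: "ip (V x) y = ip x (V y)"
proof -
  have "ip (V x) y = (\<Sum>i<n. \<Sum>j<n. W i j * x j * y i)"
    by (simp add: ip_def V_def sum_distrib_right)
  also have "\<dots> = (\<Sum>j<n. \<Sum>i<n. W i j * x j * y i)" by (rule sum.swap)
  also have "\<dots> = (\<Sum>j<n. x j * (\<Sum>i<n. W j i * y i))"
    by (intro sum.cong refl) (simp add: sum_distrib_left sym[of _ j for j] mult_ac)
  finally show ?thesis by (simp add: ip_def V_def)
qed

lemma ip_P: "ip (P x) y = ip x (P y)"
proof -
  have 1: "ip (P x) y = (ip x y - ip (V x) y) / 2" for x y
    by (simp add: ip_def P_def left_diff_distrib sum_subtractf flip: sum_divide_distrib)
  have 2: "ip x (P y) = (ip x y - ip x (V y)) / 2" for x y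
    by (simp add: ip_def P_def right_diff_distrib sum_subtractf flip: sum_divide_distrib)
  show ?thesis by (simp only: 1 2 ip_V)
qed

lemma ip_add: "ip (x + y) z = ip x z + ip y z"
  and ip_scale: "ip (c *\<^sub>R x) z = c * ip x z"
  by (simp_all add: ip_def algebra_simps sum.distrib sum_distrib_left)

lemma ip_cong: "(\<And>i. i < n \<Longrightarrow> x i = y i) \<Longrightarrow> ip x z = ip y z"
  by (simp add: ip_def)

text \<open>
A vector in the kernel of \<open>P\<close> is fixed by \<open>Q\<close>, and \<open>P\<close> and \<open>Q\<close> are self-adjoint.
\<close>

lemma ip_Q_null:
  assumes "P d = 0"
  shows "ip (P y + Q z) d = ip z d"
proof -
  have "ip z d = ip (P z + Q z) d" by (rule ip_cong) (simp add: P_plus_Q)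
  moreover have "ip (P x) d = 0" for x unfolding ip_P assms by (simp add: ip_def)
  ultimately show ?thesis by (simp add: ip_add)
qed

text \<open>
The gauge \<open>N\<close> has as its unit ball the sum of the image of the cube under \<open>P\<close>
and of the image of the cross-polytope under \<open>Q\<close>. Thus the range of \<open>P\<close> carries the quotient norm of
the maximum norm, and the range of \<open>Q\<close> is the dual of the kernel of \<open>P\<close> with the maximum norm.
\<close>

definition dominated :: "(nat \<Rightarrow> real) \<Rightarrow> real \<Rightarrow> bool" where
  "dominated x r \<longleftrightarrow> 0 \<le> r \<and> (\<exists>y z. (\<forall>i<n. \<bar>y i\<bar> \<le> r) \<and> (\<Sum>i<n. \<bar>z i\<bar>) \<le> r \<and> (\<forall>i<n. x i = (P y + Q z) i))"

definition N :: "(nat \<Rightarrow> real) \<Rightarrow> real" where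
  "N x = Inf {r. dominated x r}"

lemma dominated_exists: "dominated x (\<Sum>i<n. \<bar>x i\<bar>)"
  unfolding dominated_def
proof (intro conjI exI[of _ x])
  show "\<forall>i<n. \<bar>x i\<bar> \<le> (\<Sum>i<n. \<bar>x i\<bar>)"
    by (auto intro: member_le_sum[of _ "{..<n}" "\<lambda>i. \<bar>x i\<bar>"])
qed (auto simp: P_plus_Q sum_nonneg)

lemma dominated_add:
  assumes "dominated x r" "dominated x' r'"
  shows "dominated (x + x') (r + r')"
proof -
  obtain y z where 1: "0 \<le> r" "\<And>i. i < n \<Longrightarrow> \<bar>y i\<bar> \<le> r" "(\<Sum>i<n. \<bar>z i\<bar>) \<le> r" "\<And>i. i < n \<Longrightarrow> x i = (P y + Q z) i"
    using assms(1) unfolding dominated_def by blast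
  obtain y' z' where 2: "0 \<le> r'" "\<And>i. i < n \<Longrightarrow> \<bar>y' i\<bar> \<le> r'" "(\<Sum>i<n. \<bar>z' i\<bar>) \<le> r'" "\<And>i. i < n \<Longrightarrow> x' i = (P y' + Q z') i"
    using assms(2) unfolding dominated_def by blast
  have "\<bar>(y + y') i\<bar> \<le> r + r'" if "i < n" for i
    using abs_triangle_ineq[of "y i" "y' i"] 1(2)[OF that] 2(2)[OF that] by simp
  moreover have "(\<Sum>i<n. \<bar>(z + z') i\<bar>) \<le> r + r'"
  proof -
    have "(\<Sum>i<n. \<bar>(z + z') i\<bar>) \<le> (\<Sum>i<n. \<bar>z i\<bar> + \<bar>z' i\<bar>)" by (intro sum_mono) (simp add: abs_triangle_ineq)
    then show ?thesis using 1(3) 2(3) by (simp add: sum.distrib)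
  qed
  moreover have "(x + x') i = (P (y + y') + Q (z + z')) i" if "i < n" for i
    using 1(4)[OF that] 2(4)[OF that] by (simp add: linear_add[OF linear_P] linear_add[OF linear_Q])
  ultimately show ?thesis unfolding dominated_def using 1(1) 2(1) by (intro conjI exI[of _ "y + y'"] exI[of _ "z + z'"]) auto
qed

lemma dominated_scale:
  assumes "dominated x r"
  shows "dominated (c *\<^sub>R x) (\<bar>c\<bar> * r)"
proof -
  obtain y z where 1: "0 \<le> r" "\<And>i. i < n \<Longrightarrow> \<bar>y i\<bar> \<le> r" "(\<Sum>i<n. \<bar>z i\<bar>) \<le> r" "\<And>i. i < n \<Longrightarrow> x i = (P y + Q z) i"
    using assms(1) unfolding dominated_def by blast
  have "(\<Sum>i<n. \<bar>(c *\<^sub>R z) i\<bar>) = \<bar>c\<bar> * (\<Sum>i<n. \<bar>z i\<bar>)" by (simp add: abs_mult sum_distrib_left)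
  then show ?thesis unfolding dominated_def using 1
    by (intro conjI exI[of _ "c *\<^sub>R y"] exI[of _ "c *\<^sub>R z"])
       (auto simp: abs_mult mult_left_mono linear_scale[OF linear_P] linear_scale[OF linear_Q] distrib_left)
qed

lemma dominated_mono: "dominated x r \<Longrightarrow> r \<le> r' \<Longrightarrow> dominated x r'"
  unfolding dominated_def by (meson order_trans)

lemma dominated_zero: "dominated 0 0"
  unfolding dominated_def
  by (intro conjI exI[of _ 0]) (auto simp: linear_0[OF linear_P] linear_0[OF linear_Q])

lemma dominated_coordinate:
  assumes "dominated x r" "i < n"
  shows "\<bar>x i\<bar> \<le> (real n + 2) * r"
proof -
  obtain y z where 1: "0 \<le> r" "\<And>i. i < n \<Longrightarrow> \<bar>y i\<bar> \<le> r" "(\<Sum>i<n. \<bar>z i\<bar>) \<le> r" "\<And>i. i < n \<Longrightarrow> x i = (P y + Q z) i"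
    using assms(1) unfolding dominated_def by blast
  have z: "\<bar>z j\<bar> \<le> r" if "j < n" for j
    using member_le_sum[of j "{..<n}" "\<lambda>i. \<bar>z i\<bar>"] that 1(3) by simp
  have V: "\<bar>V u i\<bar> \<le> real n * r" if "\<And>j. j < n \<Longrightarrow> \<bar>u j\<bar> \<le> r" for u
  proof -
    have "\<bar>V u i\<bar> \<le> (\<Sum>j<n. \<bar>W i j * u j\<bar>)" unfolding V_def by (rule sum_abs)
    also have "\<dots> \<le> (\<Sum>j<n. 1 * r)"
    proof (intro sum_mono)
      fix j assume "j \<in> {..<n}"
      moreover have "1 / s \<le> 1" using s_ge_one by simp
      then have "\<bar>W i j\<bar> \<le> 1" using entry_le[of i j] by linarith
      ultimately show "\<bar>W i j * u j\<bar> \<le> 1 * r" unfolding abs_mult using that by (intro mult_mono) auto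
    qed
    finally show ?thesis by simp
  qed
  have "2 * x i = (y i - V y i) + (z i + V z i)" 
    using 1(4)[OF assms(2)] assms(2) by (simp add: P_def Q_def field_simps)
  then have "2 * \<bar>x i\<bar> \<le> 2 * (r + real n * r)"
  proof -
    have V': "\<bar>V y i\<bar> \<le> real n * r" "\<bar>V z i\<bar> \<le> real n * r" using V[of y] V[of z] 1(2) z by blast+
    have "2 * \<bar>x i\<bar> = \<bar>2 * x i\<bar>" by (simp add: abs_mult)
    also have "\<dots> \<le> \<bar>y i\<bar> + \<bar>V y i\<bar> + (\<bar>z i\<bar> + \<bar>V z i\<bar>)"
      unfolding \<open>2 * x i = _\<close>
      by (rule order_trans[OF abs_triangle_ineq add_mono[OF abs_triangle_ineq4 abs_triangle_ineq]])
    also have "\<dots> \<le> r + real n * r + (r + real n * r)"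
      using 1(2) z assms(2) V' by (intro add_mono) auto
    finally show ?thesis by (simp add: algebra_simps)
  qed
  then show ?thesis using 1(1) by (simp add: algebra_simps)
qed

lemma N_le: "dominated x r \<Longrightarrow> N x \<le> r"
  unfolding N_def by (rule cInf_lower) (auto simp: dominated_def intro: bdd_belowI[of _ 0])

lemma N_greatest: "(\<And>r. dominated x r \<Longrightarrow> a \<le> r) \<Longrightarrow> a \<le> N x"
  unfolding N_def using dominated_exists by (intro cInf_greatest) blast+

lemma dominated_if_N_less: "N x < r \<Longrightarrow> dominated x r"
proof -
  assume "N x < r"
  then obtain r' where "dominated x r'" "r' < r"
    unfolding N_def using cInf_lessD[of "{r. dominated x r}" r] dominated_exists by auto
  then show ?thesis using dominated_mono by force
qed

sublocale seminorm N
proof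
  fix x y
  have "N (x + y) - N y \<le> N x"
  proof (rule N_greatest)
    fix r assume r: "dominated x r"
    have "N (x + y) - r \<le> N y"
    proof (rule N_greatest)
      fix r' assume "dominated y r'"
      from N_le[OF dominated_add[OF r this]] show "N (x + y) - r \<le> r'" by simp
    qed
    then show "N (x + y) - N y \<le> r" by simp
  qed
  then show "N (x + y) \<le> N x + N y" by simp
next
  have le: "N (c *\<^sub>R x) \<le> \<bar>c\<bar> * N x" if "c \<noteq> 0" for c x
  proof -
    have "N (c *\<^sub>R x) / \<bar>c\<bar> \<le> N x"
    proof (rule N_greatest)
      fix r assume "dominated x r"
      from N_le[OF dominated_scale[OF this, of c]] show "N (c *\<^sub>R x) / \<bar>c\<bar> \<le> r"
        using that by (simp add: field_simps)
    qed
    then show ?thesis using that by (simp add: field_simps)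
  qed
  fix c x
  show "N (c *\<^sub>R x) = \<bar>c\<bar> * N x"
  proof (cases "c = 0")
    case True
    have "N 0 \<le> 0" by (rule N_le[OF dominated_zero])
    moreover have "0 \<le> N 0" by (rule N_greatest) (simp add: dominated_def)
    ultimately show ?thesis using True by simp
  next
    case False
    have "\<bar>c\<bar> * N x \<le> \<bar>c\<bar> * (\<bar>inverse c\<bar> * N (c *\<^sub>R x))"
      using le[of "inverse c" "c *\<^sub>R x"] False by (intro mult_left_mono) auto
    also have "\<dots> = N (c *\<^sub>R x)" using False by (simp flip: mult.assoc abs_mult)
    finally show ?thesis using le[OF False, of x] by simp
  qed
qed

lemma coordinate_le: "i < n \<Longrightarrow> \<bar>x i\<bar> \<le> (real n + 2) * N x"
proof -
  assume i: "i < n"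
  have "\<bar>x i\<bar> / (real n + 2) \<le> N x"
  proof (rule N_greatest)
    fix r assume "dominated x r"
    from dominated_coordinate[OF this i] show "\<bar>x i\<bar> / (real n + 2) \<le> r" by (simp add: field_simps)
  qed
  then show ?thesis by (simp add: field_simps)
qed

lemma N_eq_0_iff: "N x = 0 \<longleftrightarrow> (\<forall>i<n. x i = 0)"
proof
  assume "N x = 0" then show "\<forall>i<n. x i = 0" using coordinate_le[of _ x] by auto
next
  assume "\<forall>i<n. x i = 0"
  then have "dominated x 0" using dominated_exists[of x] by simp
  then show "N x = 0" using N_le[of x 0] nonneg[of x] by simp
qed

end

section \<open>A continuous selection of bounded representatives\<close>

lemma finite_grid:
  fixes n m :: nat
  assumes m: "0 < m"
  shows "\<exists>G. finite G \<and> (\<forall>g\<in>G. \<forall>i<n. \<bar>g i\<bar> \<le> (2::real)) \<and>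
    (\<forall>y. (\<forall>i<n. \<bar>y i\<bar> \<le> 2) \<longrightarrow> (\<exists>g\<in>G. \<forall>i<n. \<bar>y i - g i\<bar> \<le> 1 / real m))"
proof -
  define Z where "Z = {k. \<forall>i. (i \<in> {..<n} \<longrightarrow> k i \<in> {- 2 * int m..2 * int m}) \<and> (i \<notin> {..<n} \<longrightarrow> k i = (0::int))}"
  define G where "G = (\<lambda>k i. real_of_int (k i) / real m) ` Z"
  have "finite Z" unfolding Z_def by (rule finite_set_of_finite_funs) auto
  then have "finite G" by (simp add: G_def)
  moreover have "\<bar>g i\<bar> \<le> 2" if "g \<in> G" "i < n" for g i
  proof -
    obtain k where k: "k \<in> Z" and g: "g = (\<lambda>i. real_of_int (k i) / real m)" using \<open>g \<in> G\<close> by (auto simp: G_def)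
    have "\<bar>k i\<bar> \<le> 2 * int m" using k \<open>i < n\<close> by (auto simp: Z_def abs_le_iff)
    then have "real_of_int \<bar>k i\<bar> \<le> real_of_int (2 * int m)" by (simp only: of_int_le_iff)
    then have "\<bar>real_of_int (k i)\<bar> \<le> 2 * real m" by simp
    then show ?thesis using m by (simp add: g field_simps)
  qed
  moreover have "\<exists>g\<in>G. \<forall>i<n. \<bar>y i - g i\<bar> \<le> 1 / real m" if y: "\<forall>i<n. \<bar>y i\<bar> \<le> 2" for y
  proof -
    define k where "k i = (if i < n then \<lfloor>y i * real m\<rfloor> else 0)" for i
    have "k \<in> Z"
    proof -
      have "k i \<in> {- 2 * int m..2 * int m}" if "i < n" for i
      proof -
        have "\<bar>y i\<bar> * real m \<le> 2 * real m" using y that by (intro mult_right_mono) auto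
        then have "\<bar>y i * real m\<bar> \<le> 2 * real m" by (simp add: abs_mult)
        then have "- 2 * real m \<le> y i * real m" "y i * real m \<le> 2 * real m" by (simp_all add: abs_le_iff)
        then have "- 2 * int m \<le> \<lfloor>y i * real m\<rfloor>" "\<lfloor>y i * real m\<rfloor> \<le> 2 * int m"
          by (simp_all add: le_floor_iff floor_le_iff)
        then show ?thesis using that by (simp add: k_def)
      qed
      then show ?thesis by (auto simp: Z_def k_def)
    qed
    moreover have "\<bar>y i - real_of_int (k i) / real m\<bar> \<le> 1 / real m" if "i < n" for i
    proof -
      have "\<bar>y i * real m - real_of_int (k i)\<bar> \<le> 1" using that by (simp add: k_def abs_le_iff) linarith
      moreover have "y i - real_of_int (k i) / real m = (y i * real m - real_of_int (k i)) / real m"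
        using m by (simp add: field_simps)
      ultimately show ?thesis using m by (simp add: divide_right_mono)
    qed
    ultimately show ?thesis unfolding G_def
      by (intro bexI[of _ "\<lambda>i. real_of_int (k i) / real m"] allI impI) auto
  qed
  ultimately show ?thesis by (intro exI[of _ G] conjI ballI allI impI)
qed

context reflection
begin

lemma dominatedE:
  assumes "dominated x r"
  obtains y z where "0 \<le> r" "\<And>i. i < n \<Longrightarrow> \<bar>y i\<bar> \<le> r" "(\<Sum>i<n. \<bar>z i\<bar>) \<le> r" "\<And>i. i < n \<Longrightarrow> x i = (P y + Q z) i"
  using assms unfolding dominated_def by auto

definition gauge :: "(nat \<Rightarrow> real) \<Rightarrow> real" where
  "gauge v = (\<Sum>i<n. \<bar>P v i\<bar>)"

lemma gauge_le:
  assumes v: "\<And>i. i < n \<Longrightarrow> \<bar>v i\<bar> \<le> \<eta>"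
  shows "gauge v \<le> real n * (real n * \<eta>)"
proof -
  have "\<bar>P v i\<bar> \<le> real n * \<eta>" if i: "i < n" for i
  proof -
    have \<eta>: "0 \<le> \<eta>" using v[OF i] by (meson abs_ge_zero order_trans)
    have "\<bar>V v i\<bar> \<le> (\<Sum>j<n. \<bar>W i j * v j\<bar>)" unfolding V_def by (rule sum_abs)
    also have "\<dots> \<le> (\<Sum>j<n. 1 * \<eta>)"
    proof (intro sum_mono)
      fix j assume "j \<in> {..<n}"
      moreover have "1 / s \<le> 1" using s_ge_one by simp
      then have "\<bar>W i j\<bar> \<le> 1" using entry_le[of i j] by linarith
      ultimately show "\<bar>W i j * v j\<bar> \<le> 1 * \<eta>" unfolding abs_mult using v by (intro mult_mono) auto
    qed
    finally have V: "\<bar>V v i\<bar> \<le> real n * \<eta>" by simp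
    have "1 * \<eta> \<le> real n * \<eta>" using i \<eta> by (intro mult_right_mono) auto
    then have "\<bar>v i - V v i\<bar> \<le> 2 * (real n * \<eta>)"
      using abs_triangle_ineq4[of "v i" "V v i"] V v[OF i] by linarith
    then show ?thesis using i by (simp add: P_def)
  qed
  then have "gauge v \<le> (\<Sum>i<n. real n * \<eta>)" unfolding gauge_def by (intro sum_mono) auto
  then show ?thesis by simp
qed

text \<open>
On the ball each class modulo the kernel of \<open>P\<close> has a representative in the cube of radius 2, and
\<open>l x\<close> chooses one of norm at most 3 continuously. For a grid point \<open>g\<close> whose class is close to that
of \<open>x\<close>, the vector \<open>g + P (x - g)\<close> lies in the class of \<open>x\<close> and is still bounded; a partition of unity
averages these vectors. Continuity is stated for arbitrary filters, so that it can be combined with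
coordinatewise limits of any kind.
\<close>

lemma continuous_selection:
  "\<exists>l. (\<forall>x x'. P x = P x' \<longrightarrow> l x = l x') \<and>
    (\<forall>x. dominated x 2 \<longrightarrow> P (l x) = P x \<and> (\<forall>i<n. \<bar>l x i\<bar> \<le> 3)) \<and>
    (\<forall>x X (F :: 'b filter). dominated x 2 \<longrightarrow> (\<forall>i<n. ((\<lambda>b. X b i) \<longlongrightarrow> x i) F) \<longrightarrow>
      (\<forall>i<n. ((\<lambda>b. l (X b) i) \<longlongrightarrow> l x i) F))"
proof -
  define m where "m = n * n + 1"
  obtain G where G: "finite G" "\<And>g i. g \<in> G \<Longrightarrow> i < n \<Longrightarrow> \<bar>g i\<bar> \<le> 2"
    "\<And>y. (\<And>i. i < n \<Longrightarrow> \<bar>y i\<bar> \<le> 2) \<Longrightarrow> \<exists>g\<in>G. \<forall>i<n. \<bar>y i - g i\<bar> \<le> 1 / real m"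
    using finite_grid[of m n] by (auto simp: m_def)
  \<comment> \<open>A partition of unity over the grid, before division by the sum of its members.\<close>
  define w where "w g x = max 0 (1 - gauge (x - g))" for g x
  define S where "S x = (\<Sum>g\<in>G. w g x)" for x
  define l where "l x = inverse (S x) *\<^sub>R (\<Sum>g\<in>G. w g x *\<^sub>R (g + P (x - g)))" for x
  have w0: "0 \<le> w g x" for g x by (simp add: w_def)
  have P_diff: "P (x - g) = P x - P g" for x g by (rule linear_diff[OF linear_P])
  have S_pos: "0 < S x" if dom: "dominated x 2" for x
  proof -
    obtain y z where y: "\<And>i. i < n \<Longrightarrow> \<bar>y i\<bar> \<le> 2" and x: "\<And>i. i < n \<Longrightarrow> x i = (P y + Q z) i"
      by (rule dominatedE[OF dom]) blast
    have "P x = P (P y + Q z)" by (rule P_cong) (rule x)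
    also have "\<dots> = P y" by (simp add: linear_add[OF linear_P] P_P P_Q)
    finally have Pxy: "P x = P y" .
    have "\<exists>g\<in>G. \<forall>i<n. \<bar>y i - g i\<bar> \<le> 1 / real m" by (rule G(3)) (rule y)
    then obtain g where g: "g \<in> G" "\<And>i. i < n \<Longrightarrow> \<bar>y i - g i\<bar> \<le> 1 / real m" by auto
    have "gauge (x - g) = gauge (y - g)" unfolding gauge_def P_diff Pxy ..
    also have "\<dots> \<le> real n * (real n * (1 / real m))" by (rule gauge_le) (use g(2) in simp)
    also have "\<dots> < 1"
    proof -
      have "real (n * n) < real m" unfolding of_nat_less_iff by (simp add: m_def)
      moreover have "0 < real m" unfolding of_nat_0_less_iff by (simp add: m_def)
      ultimately have "real (n * n) / real m < 1" by (simp add: divide_less_eq)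
      then show ?thesis by simp
    qed
    finally have "0 < w g x" by (simp add: w_def)
    moreover have "w g x \<le> S x" unfolding S_def using w0 g(1) G(1) by (intro member_le_sum) auto
    ultimately show ?thesis by linarith
  qed
  have l_i: "l x i = (\<Sum>g\<in>G. w g x * (g i + P (x - g) i)) / S x" for x i
    by (simp add: l_def sum_fun_apply field_simps)
  have 1: "l x = l x'" if "P x = P x'" for x x'
  proof -
    have "w g x = w g x'" for g using that by (simp add: w_def gauge_def P_diff)
    then show ?thesis using that by (simp add: l_def S_def P_diff)
  qed
  have 2: "P (l x) = P x" if "dominated x 2" for x
  proof -
    have "P (l x) = inverse (S x) *\<^sub>R (\<Sum>g\<in>G. w g x *\<^sub>R P (g + P (x - g)))"
      unfolding l_def linear_scale[OF linear_P] linear_sum[OF linear_P] ..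
    also have "\<dots> = inverse (S x) *\<^sub>R (\<Sum>g\<in>G. w g x *\<^sub>R P x)"
    proof -
      have "P (g + P (x - g)) = P x" for g
        unfolding linear_add[OF linear_P] P_P P_diff by simp
      then show ?thesis by (simp only:)
    qed
    also have "\<dots> = inverse (S x) *\<^sub>R S x *\<^sub>R P x" by (simp only: S_def scaleR_left.sum)
    also have "\<dots> = P x" using S_pos[OF that] by simp
    finally show ?thesis .
  qed
  have 3: "\<bar>l x i\<bar> \<le> 3" if x: "dominated x 2" and i: "i < n" for x i
  proof -
    have "\<bar>\<Sum>g\<in>G. w g x * (g i + P (x - g) i)\<bar> \<le> (\<Sum>g\<in>G. \<bar>w g x * (g i + P (x - g) i)\<bar>)" by (rule sum_abs)
    also have "\<dots> \<le> (\<Sum>g\<in>G. w g x * 3)"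
    proof (intro sum_mono)
      fix g assume g: "g \<in> G"
      show "\<bar>w g x * (g i + P (x - g) i)\<bar> \<le> w g x * 3"
      proof (cases "gauge (x - g) < 1")
        case True
        have "\<bar>P (x - g) i\<bar> \<le> gauge (x - g)" unfolding gauge_def using i by (intro member_le_sum) auto
        then have "\<bar>g i + P (x - g) i\<bar> \<le> 3" using G(2)[OF g i] True by linarith
        then show ?thesis using w0 by (simp add: abs_mult mult_left_mono)
      next
        case False then show ?thesis by (simp add: w_def)
      qed
    qed
    also have "\<dots> = S x * 3" by (simp add: S_def sum_distrib_right)
    finally show ?thesis using S_pos[OF x] by (simp add: l_i field_simps)
  qed
  have 4: "((\<lambda>b. l (X b) i) \<longlongrightarrow> l x i) F"
    if x: "dominated x 2" and X: "\<And>i. i < n \<Longrightarrow> ((\<lambda>b. X b i) \<longlongrightarrow> x i) F" and i: "i < n" for x X i and F :: "'b filter"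
  proof -
    have tP: "((\<lambda>b. P (X b - g) i) \<longlongrightarrow> P (x - g) i) F" if "i < n" for g i
      using that unfolding P_def V_def by (auto intro!: tendsto_intros X)
    have tw: "((\<lambda>b. w g (X b)) \<longlongrightarrow> w g x) F" for g
      unfolding w_def gauge_def by (intro tendsto_intros tP) auto
    have "((\<lambda>b. S (X b)) \<longlongrightarrow> S x) F" unfolding S_def by (intro tendsto_intros tw)
    then show ?thesis unfolding l_i using S_pos[OF x] by (intro tendsto_intros tw tP i) auto
  qed
  show ?thesis by (intro exI[of _ l] conjI allI impI) (rule 1 2 3 4; blast)+
qed

text \<open>
Duality: the \<open>P\<close> part of \<open>x\<close> is orthogonal to \<open>d\<close>, and the \<open>Q\<close> part comes from a vector with absolute
sum at most 2.
\<close>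

lemma ip_bound:
  assumes x: "dominated x 2" and d: "P d = 0" "\<And>i. i < n \<Longrightarrow> \<bar>d i\<bar> \<le> B" and B: "0 \<le> B"
  shows "\<bar>ip x d\<bar> \<le> 2 * B"
proof -
  obtain y z where z: "(\<Sum>i<n. \<bar>z i\<bar>) \<le> 2" and xyz: "\<And>i. i < n \<Longrightarrow> x i = (P y + Q z) i"
    by (rule dominatedE[OF x]) blast
  have "ip x d = ip (P y + Q z) d" by (rule ip_cong) (rule xyz)
  also have "\<dots> = ip z d" by (rule ip_Q_null[OF d(1)])
  finally have "\<bar>ip x d\<bar> = \<bar>ip z d\<bar>" by simp
  also have "\<dots> \<le> (\<Sum>i<n. \<bar>z i * d i\<bar>)" unfolding ip_def by (rule sum_abs)
  also have "\<dots> \<le> (\<Sum>i<n. \<bar>z i\<bar> * B)" unfolding abs_mult using d(2) by (intro sum_mono mult_left_mono) auto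
  also have "\<dots> = (\<Sum>i<n. \<bar>z i\<bar>) * B" by (simp add: sum_distrib_right)
  also have "\<dots> \<le> 2 * B" using z B by (intro mult_right_mono) auto
  finally show ?thesis .
qed

section \<open>A function far from all quadratic polynomials\<close>

text \<open>
On the sum of the two eigenspaces this is the duality pairing of \<open>Q x\<close> with \<open>l x - P x\<close>, which lies in
the kernel of \<open>P\<close> if \<open>l x\<close> is a representative of the class of \<open>x\<close> as above.
\<close>

definition pairing :: "((nat \<Rightarrow> real) \<Rightarrow> nat \<Rightarrow> real) \<Rightarrow> (nat \<Rightarrow> real) \<Rightarrow> real" where
  "pairing l x = ip x (l x - P x)"

text \<open>
The vectors \<open>l x - P x\<close> may be long. But a third difference annihilates products of two affine
functions of the step number, so the part of \<open>l\<close> that interpolates its first two values affinely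
can be subtracted, and \<open>P x\<close> is affine itself. What remains pairs two points of the ball with the
bounded vectors \<open>d2\<close> and \<open>d3\<close> in the kernel of \<open>P\<close>.
\<close>

lemma pairing_third_difference:
  assumes l: "\<And>x. dominated x 2 \<Longrightarrow> P (l x) = P x" "\<And>x i. dominated x 2 \<Longrightarrow> i < n \<Longrightarrow> \<bar>l x i\<bar> \<le> 3"
    and x: "dominated x 2" "dominated (x + h) 2" "dominated (x + 2 *\<^sub>R h) 2" "dominated (x + 3 *\<^sub>R h) 2"
  shows "\<bar>third_difference (pairing l) h x\<bar> \<le> 108"
proof -
  define l0 l1 l2 l3 where "l0 = l x" "l1 = l (x + h)" "l2 = l (x + 2 *\<^sub>R h)" "l3 = l (x + 3 *\<^sub>R h)"
  \<comment> \<open>Both combinations of values of l lie in the kernel of P, because the arguments are in arithmetic progression.\<close>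
  define d2 d3 where "d2 = l2 - 2 *\<^sub>R l1 + l0" and "d3 = l3 - 3 *\<^sub>R l1 + 2 *\<^sub>R l0"
  have Pl: "P l0 = P x" "P l1 = P x + P h" "P l2 = P x + 2 *\<^sub>R P h" "P l3 = P x + 3 *\<^sub>R P h"
    using l(1)[OF x(1)] l(1)[OF x(2)] l(1)[OF x(3)] l(1)[OF x(4)]
    unfolding l0_l1_l2_l3_def linear_add[OF linear_P] linear_scale[OF linear_P] by blast+
  have Pd: "P d2 = 0" "P d3 = 0"
    unfolding d2_def d3_def linear_add[OF linear_P] linear_diff[OF linear_P] linear_scale[OF linear_P] Pl
    by (simp_all add: fun_eq_iff algebra_simps)
  have b: "\<bar>l0 i\<bar> \<le> 3" "\<bar>l1 i\<bar> \<le> 3" "\<bar>l2 i\<bar> \<le> 3" "\<bar>l3 i\<bar> \<le> 3" if "i < n" for i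
    using l(2)[OF x(1) that] l(2)[OF x(2) that] l(2)[OF x(3) that] l(2)[OF x(4) that]
    unfolding l0_l1_l2_l3_def by blast+
  have "\<bar>d2 i\<bar> \<le> 12" "\<bar>d3 i\<bar> \<le> 18" if "i < n" for i
    using b[OF that] by (simp_all add: d2_def d3_def abs_le_iff)
  then have ip: "\<bar>ip (x + 2 *\<^sub>R h) d2\<bar> \<le> 2 * 12" "\<bar>ip (x + 3 *\<^sub>R h) d3\<bar> \<le> 2 * 18"
    by (intro ip_bound x Pd; simp)+
  have "third_difference (pairing l) h x = (\<Sum>i<n.
     (x i + 3 * h i) * (l3 i - (P x i + 3 * P h i)) - 3 * ((x i + 2 * h i) * (l2 i - (P x i + 2 * P h i)))
     + 3 * ((x i + h i) * (l1 i - (P x i + P h i))) - x i * (l0 i - P x i))"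
    unfolding third_difference_def pairing_def ip_def linear_add[OF linear_P] linear_scale[OF linear_P] 
      l0_l1_l2_l3_def[symmetric]
    by (simp add: sum.distrib sum_subtractf sum_distrib_left)
  also have "\<dots> = (\<Sum>i<n. (x i + 3 * h i) * d3 i - 3 * ((x i + 2 * h i) * d2 i))"
    by (intro sum.cong refl) (simp add: d2_def d3_def algebra_simps)
  also have "\<dots> = ip (x + 3 *\<^sub>R h) d3 - 3 * ip (x + 2 *\<^sub>R h) d2"
    by (simp add: ip_def sum_subtractf sum_distrib_left)
  finally have "\<bar>third_difference (pairing l) h x\<bar> \<le> \<bar>ip (x + 3 *\<^sub>R h) d3\<bar> + \<bar>3 * ip (x + 2 *\<^sub>R h) d2\<bar>"
    by (simp only: abs_triangle_ineq4)
  then show ?thesis using ip unfolding abs_mult by simp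
qed

lemma P_V: "P (V x) = - P x"
proof
  fix i show "P (V x) i = (- P x) i"
    by (cases "i < n") (simp_all add: P_def V_V field_simps)
qed

lemma test_point_norm:
  assumes i: "i < n" and c: "\<bar>c\<bar> \<le> 1" "\<bar>c'\<bar> \<le> 1"
  shows "N ((c * s) *\<^sub>R P (unit_fun i) + c' *\<^sub>R Q (unit_fun i)) \<le> 1"
proof (rule N_le)
  have s: "0 < s" using s_ge_one by simp
  \<comment> \<open>P maps V x to - P x, and the entries of s V are at most 1: this replaces a long vector by one in the cube.\<close>
  define y where "y = (- (c * s)) *\<^sub>R V (unit_fun i)"
  define z where "z = c' *\<^sub>R unit_fun i"
  have "P y = (c * s) *\<^sub>R P (unit_fun i)" "Q z = c' *\<^sub>R Q (unit_fun i)"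
    unfolding y_def z_def linear_scale[OF linear_P] linear_scale[OF linear_Q] P_V by simp_all
  moreover have "\<bar>y j\<bar> \<le> 1" for j
  proof -
    have "V (unit_fun i) j = W j i"
      using i by (simp add: V_def unit_fun_def if_distrib[of "\<lambda>u. _ * u"] cong: if_cong)
    then have "\<bar>y j\<bar> = \<bar>c\<bar> * (s * \<bar>W j i\<bar>)" using s by (simp add: y_def abs_mult)
    also have "s * \<bar>W j i\<bar> \<le> 1"
    proof -
      have "s * \<bar>W j i\<bar> \<le> s * (1 / s)" using s entry_le by (intro mult_left_mono) auto
      then show ?thesis using s by simp
    qed
    then have "\<bar>c\<bar> * (s * \<bar>W j i\<bar>) \<le> 1 * 1" using c(1) s by (intro mult_mono) auto
    finally show ?thesis by simp
  qed
  moreover have "(\<Sum>j<n. \<bar>z j\<bar>) \<le> 1"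
  proof -
    have "(\<Sum>j<n. \<bar>z j\<bar>) = (\<Sum>j<n. if j = i then \<bar>c'\<bar> else 0)"
      by (intro sum.cong refl) (simp add: z_def unit_fun_def)
    then show ?thesis using i c(2) by simp
  qed
  ultimately show "dominated ((c * s) *\<^sub>R P (unit_fun i) + c' *\<^sub>R Q (unit_fun i)) 1"
    unfolding dominated_def by (intro conjI exI[of _ y] exI[of _ z] allI impI) auto
qed

text \<open>
The sum is the \<open>(j, k)\<close> entry of \<open>P Q = 0\<close>.
\<close>

lemma bilinear_trace_zero:
  assumes "j < n" "k < n"
  shows "(\<Sum>i<n. P (unit_fun i) j * Q (unit_fun i) k) = 0"
proof -
  have V: "V (unit_fun i) j = W j i" if "i < n" for i j
    using that by (simp add: V_def unit_fun_def if_distrib[of "\<lambda>u. _ * u"] cong: if_cong)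
  have summand: "P (unit_fun i) j * Q (unit_fun i) k =
      ((if j = i then if k = i then 1 else 0 else 0) + (if j = i then W i k else 0)
        - (if k = i then W j i else 0) - W j i * W i k) / 4" if i: "i < n" for i
  proof -
    have Pi: "P (unit_fun i) j = (unit_fun i j - W j i) / 2"
      using assms by (simp add: P_def V[OF i])
    have Qi: "Q (unit_fun i) k = (unit_fun i k + W i k) / 2"
      using assms sym[of k i] by (simp add: Q_def V[OF i])
    show ?thesis unfolding Pi Qi unfolding unit_fun_def by (simp add: field_simps)
  qed
  have "(\<Sum>i<n. P (unit_fun i) j * Q (unit_fun i) k) =
      (\<Sum>i<n. (if j = i then if k = i then 1 else 0 else 0) + (if j = i then W i k else 0)
        - (if k = i then W j i else 0) - W j i * W i k) / 4"
    unfolding sum_divide_distrib by (intro sum.cong refl) (rule summand, simp)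
  also have "\<dots> = ((if k = j then 1 else 0) + W j k - W j k - (if j = k then 1 else 0)) / 4"
    using assms by (simp add: sum_subtractf sum.distrib involution)
  also have "\<dots> = 0" by simp
  finally show ?thesis .
qed

lemma quadratic_four_point:
  fixes a :: "nat \<Rightarrow> nat \<Rightarrow> real" and b :: "nat \<Rightarrow> real" and c :: real
  defines "p \<equiv> \<lambda>x. c + (\<Sum>j<n. b j * x j) + (\<Sum>j<n. \<Sum>k<n. a j k * x j * x k)"
  shows "p (u + z) - p (u - z) - p (- u + z) + p (- u - z) =
    4 * (\<Sum>j<n. \<Sum>k<n. a j k * (u j * z k + z j * u k))"
proof -
  define q where "q x = (\<Sum>j<n. \<Sum>k<n. a j k * x j * x k)" for x :: "nat \<Rightarrow> real"
  define L where "L x = (\<Sum>j<n. b j * x j)" for x :: "nat \<Rightarrow> real"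
  have "L (u + z) - L (u - z) - L (- u + z) + L (- u - z) = 0"
    unfolding L_def sum_subtractf[symmetric] sum.distrib[symmetric] by (intro sum.neutral ballI) (simp add: algebra_simps)
  moreover have "q (u + z) - q (u - z) - q (- u + z) + q (- u - z) =
      4 * (\<Sum>j<n. \<Sum>k<n. a j k * (u j * z k + z j * u k))"
    unfolding q_def sum_subtractf[symmetric] sum.distrib[symmetric] sum_distrib_left
    by (intro sum.cong refl) (simp add: algebra_simps)
  ultimately show ?thesis unfolding p_def q_def[symmetric] L_def[symmetric] by linarith
qed

text \<open>
\<open>l\<close> depends on \<open>P x\<close> only, so its values at the four points are \<open>l u\<close> and \<open>l (- u)\<close>. The pairing
extracts their coordinate \<open>i\<close>, corrected by that of \<open>u\<close>, because \<open>z\<close> is the \<open>Q\<close> part of a basis vector.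
\<close>

lemma pairing_four_point:
  assumes l1: "\<And>x x'. P x = P x' \<Longrightarrow> l x = l x'" and l2: "\<And>x. dominated x 2 \<Longrightarrow> P (l x) = P x"
    and i: "i < n"
  defines "u \<equiv> s *\<^sub>R P (unit_fun i)" and "z \<equiv> Q (unit_fun i)"
  shows "pairing l (u + z) - pairing l (u - z) - pairing l (- u + z) + pairing l (- u - z)
     = 2 * (l u i - l (- u) i) - 4 * u i"
proof -
  have f: "pairing l (c *\<^sub>R u + c' *\<^sub>R z) = c' * (l (c *\<^sub>R u) i - c * u i)"
    if c: "\<bar>c\<bar> \<le> 1" "\<bar>c'\<bar> \<le> 1" for c c'
  proof -
    have Pu: "P (c *\<^sub>R u + c' *\<^sub>R z) = c *\<^sub>R u"
      unfolding u_def z_def linear_add[OF linear_P] linear_scale[OF linear_P] P_P P_Q by simp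
    have Pu': "P (c *\<^sub>R u) = c *\<^sub>R u" unfolding u_def linear_scale[OF linear_P] P_P by simp
    have "N ((c * s) *\<^sub>R P (unit_fun i) + 0 *\<^sub>R Q (unit_fun i)) \<le> 1" using i c(1) by (rule test_point_norm) simp
    then have dom: "dominated (c *\<^sub>R u) 2" by (intro dominated_if_N_less) (simp add: u_def)
    define d where "d = l (c *\<^sub>R u) - c *\<^sub>R u"
    have Pd: "P d = 0" unfolding d_def linear_diff[OF linear_P] l2[OF dom] Pu' by simp
    have "l (c *\<^sub>R u + c' *\<^sub>R z) = l (c *\<^sub>R u)" by (rule l1) (simp only: Pu Pu')
    then have "pairing l (c *\<^sub>R u + c' *\<^sub>R z) = ip (c *\<^sub>R u + c' *\<^sub>R z) d"
      unfolding pairing_def Pu d_def by (simp only:)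
    also have "\<dots> = ip (P ((c * s) *\<^sub>R unit_fun i) + Q (c' *\<^sub>R unit_fun i)) d"
      unfolding u_def z_def linear_scale[OF linear_P] linear_scale[OF linear_Q] by simp
    also have "\<dots> = ip (c' *\<^sub>R unit_fun i) d" by (rule ip_Q_null[OF Pd])
    also have "\<dots> = c' * d i"
      using i by (simp add: ip_scale) (simp add: ip_def unit_fun_def if_distrib[of "\<lambda>u. u * _"] cong: if_cong)
    finally show ?thesis by (simp add: d_def)
  qed
  from f[of 1 1] f[of 1 "-1"] f[of "-1" 1] f[of "-1" "-1"] show ?thesis by simp
qed

text \<open>
The four-point differences at \<open>\<plusminus> u i \<plusminus> z i\<close>, summed over \<open>i\<close>, vanish for every quadratic polynomial. For
the pairing the sum is \<open>- 4 \<Sum> u i i\<close> up to \<open>12 n\<close>, since \<open>l\<close> is bounded by 3, and \<open>\<Sum> u i i\<close>, which is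
\<open>s\<close> times the trace of \<open>P\<close>, is at least \<open>n (s - 1) / 2\<close>. An approximation within \<open>K\<close> changes each
four-point difference by at most \<open>4 K\<close>.
\<close>

lemma pairing_far_from_quadratic:
  assumes l1: "\<And>x x'. P x = P x' \<Longrightarrow> l x = l x'" and l2: "\<And>x. dominated x 2 \<Longrightarrow> P (l x) = P x"
    and l3: "\<And>x i. dominated x 2 \<Longrightarrow> i < n \<Longrightarrow> \<bar>l x i\<bar> \<le> 3" and n: "1 \<le> n"
    and K: "\<And>x. N x \<le> 1 \<Longrightarrow>
      \<bar>pairing l x - (c + (\<Sum>j<n. b j * x j) + (\<Sum>j<n. \<Sum>k<n. a j k * x j * x k))\<bar> \<le> K"
  shows "s - 7 \<le> 2 * K"
proof -
  define p where "p x = c + (\<Sum>j<n. b j * x j) + (\<Sum>j<n. \<Sum>k<n. a j k * x j * x k)" for x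
  define u where "u i = s *\<^sub>R P (unit_fun i)" for i
  define z where "z i = Q (unit_fun i)" for i
  define D where "D i = p (u i + z i) - p (u i - z i) - p (- u i + z i) + p (- u i - z i)" for i
  \<comment> \<open>Only the bilinear part of p survives in D, and its sum over i is a trace that vanishes because P Q = 0.\<close>
  have D0: "(\<Sum>i<n. D i) = 0"
  proof -
    have uz: "(\<Sum>i<n. u i j * z i k) = 0" if "j < n" "k < n" for j k
    proof -
      have "(\<Sum>i<n. u i j * z i k) = s * (\<Sum>i<n. P (unit_fun i) j * Q (unit_fun i) k)"
        by (simp add: u_def z_def sum_distrib_left mult.assoc)
      then show ?thesis using bilinear_trace_zero[OF that] by simp
    qed
    have "(\<Sum>i<n. D i) = (\<Sum>i<n. 4 * (\<Sum>j<n. \<Sum>k<n. a j k * (u i j * z i k + z i j * u i k)))"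
      unfolding D_def p_def by (intro sum.cong refl) (rule quadratic_four_point)
    also have "\<dots> = 4 * (\<Sum>i<n. \<Sum>j<n. \<Sum>k<n. a j k * (u i j * z i k + z i j * u i k))"
      by (simp only: sum_distrib_left)
    also have "(\<Sum>i<n. \<Sum>j<n. \<Sum>k<n. a j k * (u i j * z i k + z i j * u i k)) =
       (\<Sum>j<n. \<Sum>i<n. \<Sum>k<n. a j k * (u i j * z i k + z i j * u i k))" by (rule sum.swap)
    also have "\<dots> = (\<Sum>j<n. \<Sum>k<n. \<Sum>i<n. a j k * (u i j * z i k + z i j * u i k))"
      by (intro sum.cong refl sum.swap)
    also have "\<dots> = (\<Sum>j<n. \<Sum>k<n. a j k * ((\<Sum>i<n. u i j * z i k) + (\<Sum>i<n. u i k * z i j)))"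
      by (simp add: sum_distrib_left sum.distrib distrib_left mult.commute[of "z _ _"])
    also have "\<dots> = 0" using uz by simp
    finally show ?thesis by simp
  qed
  have pt: "\<bar>pairing l ((c1 * s) *\<^sub>R P (unit_fun i) + c2 *\<^sub>R z i) - p ((c1 * s) *\<^sub>R P (unit_fun i) + c2 *\<^sub>R z i)\<bar> \<le> K"
    if "i < n" "\<bar>c1\<bar> \<le> 1" "\<bar>c2\<bar> \<le> 1" for i c1 c2
    unfolding p_def z_def by (rule K, rule test_point_norm) (use that in auto)
  have main: "4 * u i i \<le> 12 + 4 * K - D i" if i: "i < n" for i
  proof -
    have pts: "\<bar>pairing l (u i + z i) - p (u i + z i)\<bar> \<le> K" "\<bar>pairing l (u i - z i) - p (u i - z i)\<bar> \<le> K"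
      "\<bar>pairing l (- u i + z i) - p (- u i + z i)\<bar> \<le> K" "\<bar>pairing l (- u i - z i) - p (- u i - z i)\<bar> \<le> K"
      using pt[OF i, of 1 1] pt[OF i, of 1 "-1"] pt[OF i, of "-1" 1] pt[OF i, of "-1" "-1"]
      by (simp_all add: u_def)
    have dom: "dominated (c1 *\<^sub>R u i) 2" if "\<bar>c1\<bar> \<le> 1" for c1
    proof (rule dominated_if_N_less)
      have "N ((c1 * s) *\<^sub>R P (unit_fun i) + 0 *\<^sub>R Q (unit_fun i)) \<le> 1" using i that by (rule test_point_norm) simp
      then show "N (c1 *\<^sub>R u i) < 2" by (simp add: u_def)
    qed
    have "\<bar>l (u i) i\<bar> \<le> 3" "\<bar>l (- u i) i\<bar> \<le> 3"
      using l3[OF dom[of 1] i] l3[OF dom[of "-1"] i] by simp_all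
    moreover have "pairing l (u i + z i) - pairing l (u i - z i) - pairing l (- u i + z i) + pairing l (- u i - z i)
      = 2 * (l (u i) i - l (- u i) i) - 4 * u i i"
      unfolding u_def z_def by (rule pairing_four_point[OF l1 l2 i])
    ultimately show ?thesis using pts unfolding D_def abs_le_iff right_diff_distrib by linarith
  qed
  \<comment> \<open>The diagonal of P is close to 1/2, because the entries of W are small.\<close>
  have ui: "s - 1 \<le> 2 * u i i" if i: "i < n" for i
  proof -
    have "V (unit_fun i) i = W i i"
      using i by (simp add: V_def unit_fun_def if_distrib[of "\<lambda>u. _ * u"] cong: if_cong)
    then have "2 * u i i = s * (1 - W i i)" using i by (simp add: u_def P_def unit_fun_def)
    moreover have "s * W i i \<le> s * (1 / s)" using entry_le[of i i] s_ge_one by (intro mult_left_mono) auto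
    ultimately show ?thesis using s_ge_one by (simp add: algebra_simps)
  qed
  have "real n * (2 * (s - 1)) = (\<Sum>i<n. 2 * (s - 1))" by simp
  also have "\<dots> \<le> (\<Sum>i<n. 12 + 4 * K - D i)"
  proof (rule sum_mono)
    fix i assume "i \<in> {..<n}"
    then show "2 * (s - 1) \<le> 12 + 4 * K - D i" using main[of i] ui[of i] by simp
  qed
  also have "\<dots> = real n * (12 + 4 * K)" using D0 by (simp add: sum_subtractf sum.distrib distrib_left)
  finally have "2 * (s - 1) \<le> 12 + 4 * K" using n by (simp only: mult_le_cancel_left_pos of_nat_0_less_iff Suc_le_eq One_nat_def)
  then show ?thesis by simp
qed

end

section \<open>The lower bound\<close>

lemma cont_on_ballI:
  assumes N: "norm_on n N" and C: "\<And>x i. x \<in> carrier_vec n \<Longrightarrow> i < n \<Longrightarrow> \<bar>x $ i\<bar> \<le> C * N x"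
    and f: "\<And>x (F :: real vec filter). x \<in> unit_ball n N \<Longrightarrow> (\<And>i. i < n \<Longrightarrow> ((\<lambda>y. y $ i) \<longlongrightarrow> x $ i) F) \<Longrightarrow> (f \<longlongrightarrow> f x) F"
  shows "cont_on_ball n N f"
  unfolding cont_on_ball_def
proof (intro ballI allI impI)
  fix x and \<epsilon> :: real assume x: "x \<in> unit_ball n N" and e: "0 < \<epsilon>"
  define F where "F = inf (filtercomap (\<lambda>y. N (y - x)) (nhds 0)) (principal (unit_ball n N))"
  have xc: "x \<in> carrier_vec n" using x by (simp add: unit_ball_def)
  have lim: "((\<lambda>y. N (y - x)) \<longlongrightarrow> 0) F"
    unfolding F_def by (rule filterlim_mono[OF filterlim_filtercomap order_refl inf_le1])
  have "((\<lambda>y. y $ i) \<longlongrightarrow> x $ i) F" if i: "i < n" for i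
  proof (rule metric_tendsto_imp_tendsto)
    show "((\<lambda>y. C * N (y - x)) \<longlongrightarrow> 0) F" using tendsto_mult_left[OF lim, of C] by simp
    have le: "dist (y $ i) (x $ i) \<le> dist (C * N (y - x)) 0" if "y \<in> unit_ball n N" for y
    proof -
      have y: "y \<in> carrier_vec n" using that by (simp add: unit_ball_def)
      then have "\<bar>(y - x) $ i\<bar> \<le> C * N (y - x)" using xc i by (intro C) auto
      then show ?thesis using xc y i by (simp add: dist_real_def)
    qed
    show "eventually (\<lambda>y. dist (y $ i) (x $ i) \<le> dist (C * N (y - x)) 0) F"
      unfolding F_def eventually_inf_principal by (rule always_eventually) (use le in blast)
  qed
  from f[OF x this] have "eventually (\<lambda>y. dist (f y) (f x) < \<epsilon>) F" using e by (rule tendstoD)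
  then obtain S where "eventually S (nhds 0)" and S: "\<And>y. S (N (y - x)) \<Longrightarrow> y \<in> unit_ball n N \<Longrightarrow> dist (f y) (f x) < \<epsilon>"
    unfolding F_def eventually_inf_principal eventually_filtercomap by auto
  then obtain d where d: "0 < d" "\<And>t. dist t 0 < d \<Longrightarrow> S t" unfolding eventually_nhds_metric by auto
  show "\<exists>\<delta>>0. \<forall>y\<in>unit_ball n N. N (y - x) < \<delta> \<longrightarrow> \<bar>f y - f x\<bar> < \<epsilon>"
  proof (intro exI[of _ d] conjI ballI impI)
    fix y assume y: "y \<in> unit_ball n N" and "N (y - x) < d"
    have "y - x \<in> carrier_vec n" using y xc by (simp add: unit_ball_def)
    then have "0 \<le> N (y - x)" using N by (simp add: norm_on_def)
    then have "S (N (y - x))" using \<open>N (y - x) < d\<close> by (intro d(2)) simp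
    from S[OF this y] show "\<bar>f y - f x\<bar> < \<epsilon>" by (simp add: dist_real_def)
  qed (rule d(1))
qed

lemma omega3_leI:
  assumes "\<And>x h. \<lbrakk>x \<in> carrier_vec n; h \<in> carrier_vec n; N (x + 0 \<cdot>\<^sub>v h) \<le> 1; N (x + 1 \<cdot>\<^sub>v h) \<le> 1;
     N (x + 2 \<cdot>\<^sub>v h) \<le> 1; N (x + 3 \<cdot>\<^sub>v h) \<le> 1\<rbrakk> \<Longrightarrow> \<bar>Delta3 f h x\<bar> \<le> 1"
  shows "omega3 n N f \<le> 1"
  unfolding omega3_def
proof (rule SUP_least, clarify)
  fix x h assume xh: "x \<in> carrier_vec n" "h \<in> carrier_vec n"
    and b: "\<forall>j\<in>{0..3}. x + real j \<cdot>\<^sub>v h \<in> unit_ball n N"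
  have "N (x + real j \<cdot>\<^sub>v h) \<le> 1" if "j \<le> 3" for j
    using b that by (auto simp: unit_ball_def)
  from this[of 0] this[of 1] this[of 2] this[of 3] have "\<bar>Delta3 f h x\<bar> \<le> 1" by (intro assms xh) simp_all
  then show "ereal \<bar>Delta3 f h x\<bar> \<le> 1" by simp
qed

lemma w3s_lowerI:
  assumes N: "norm_on n N" and f: "cont_on_ball n N f" "omega3 n N f \<le> 1"
    and L: "\<And>p K. quadratic n p \<Longrightarrow> (\<And>x. x \<in> unit_ball n N \<Longrightarrow> \<bar>f x - p x\<bar> \<le> K) \<Longrightarrow> L \<le> K"
  shows "ereal L \<le> w3s n"
proof -
  have "ereal L \<le> E3 n N f"
    unfolding E3_def
  proof (rule INF_greatest, rule ccontr)
    fix p assume p: "p \<in> polynomials n 2"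
    assume "\<not> ereal L \<le> (SUP x\<in>unit_ball n N. ereal \<bar>f x - p x\<bar>)"
    then have "(SUP x\<in>unit_ball n N. ereal \<bar>f x - p x\<bar>) < ereal L" by simp
    then obtain r where r: "(SUP x\<in>unit_ball n N. ereal \<bar>f x - p x\<bar>) < ereal r" "ereal r < ereal L"
      using ereal_dense2 by blast
    have "\<bar>f x - p x\<bar> \<le> r" if "x \<in> unit_ball n N" for x
    proof -
      have "ereal \<bar>f x - p x\<bar> \<le> (SUP x\<in>unit_ball n N. ereal \<bar>f x - p x\<bar>)" using that by (rule SUP_upper)
      also note less_imp_le[OF r(1)]
      finally show ?thesis by simp
    qed
    from L[OF polynomials_quadratic[OF p] this] r(2) show False by simp
  qed
  also have "\<dots> \<le> w3 n N" unfolding w3_def using f by (intro Sup_upper) auto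
  also have "\<dots> \<le> w3s n" unfolding w3s_def using N by (intro Sup_upper) auto
  finally show ?thesis .
qed

definition coords :: "nat \<Rightarrow> real vec \<Rightarrow> nat \<Rightarrow> real" where
  "coords n v = (\<lambda>i. if i < n then v $ i else 0)"

lemma coords_add: "v \<in> carrier_vec n \<Longrightarrow> w \<in> carrier_vec n \<Longrightarrow> coords n (v + w) = coords n v + coords n w"
  and coords_smult: "v \<in> carrier_vec n \<Longrightarrow> coords n (c \<cdot>\<^sub>v v) = c *\<^sub>R coords n v"
  by (auto simp: coords_def fun_eq_iff)

lemma (in reflection) w3s_lower:
  assumes n: "1 \<le> n"
  shows "ereal ((s - 7) / 216) \<le> w3s n"
proof -
  obtain l where l: "(\<forall>x x'. P x = P x' \<longrightarrow> l x = l x') \<and>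
    (\<forall>x. dominated x 2 \<longrightarrow> P (l x) = P x \<and> (\<forall>i<n. \<bar>l x i\<bar> \<le> 3)) \<and>
    (\<forall>x X (F :: real vec filter). dominated x 2 \<longrightarrow> (\<forall>i<n. ((\<lambda>b. X b i) \<longlongrightarrow> x i) F) \<longrightarrow>
      (\<forall>i<n. ((\<lambda>b. l (X b) i) \<longlongrightarrow> l x i) F))"
    using continuous_selection[where 'b = "real vec"] by (rule exE)
  have l1: "l x = l x'" if "P x = P x'" for x x'
    using l[THEN conjunct1] that by blast
  have l23: "P (l x) = P x \<and> (\<forall>i<n. \<bar>l x i\<bar> \<le> 3)" if "dominated x 2" for x
    using l[THEN conjunct2, THEN conjunct1] that by blast
  note l4 = l[THEN conjunct2, THEN conjunct2, rule_format]
  have l2: "P (l x) = P x" and l3: "i < n \<Longrightarrow> \<bar>l x i\<bar> \<le> 3" if "dominated x 2" for x i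
    using l23[OF that] by auto
  have dom: "dominated x 2" if "N x \<le> 1" for x using that by (intro dominated_if_N_less) simp
  define N' where "N' v = N (coords n v)" for v
  define f where "f v = pairing l (coords n v) / 108" for v
  have norm: "norm_on n N'"
    unfolding norm_on_def N'_def
  proof (intro conjI ballI allI)
    fix x :: "real vec" assume x: "x \<in> carrier_vec n"
    have "N (coords n x) = 0 \<longleftrightarrow> (\<forall>i<n. x $ i = 0)" by (simp add: N_eq_0_iff coords_def)
    also have "\<dots> \<longleftrightarrow> x = 0\<^sub>v n" using x by (auto simp: vec_eq_iff)
    finally show "N (coords n x) = 0 \<longleftrightarrow> x = 0\<^sub>v n" .
  qed (simp_all add: coords_add coords_smult scale triangle)
  show ?thesis
  proof (rule w3s_lowerI[OF norm, of f])
    show "cont_on_ball n N' f"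
    proof (rule cont_on_ballI[OF norm, of "real n + 2"])
      fix x :: "real vec" and i assume "x \<in> carrier_vec n" "i < n"
      then show "\<bar>x $ i\<bar> \<le> (real n + 2) * N' x"
        using coordinate_le[of i "coords n x"] by (simp add: N'_def coords_def)
    next
      fix x and F :: "real vec filter" assume x: "x \<in> unit_ball n N'"
        and lim: "\<And>i. i < n \<Longrightarrow> ((\<lambda>y. y $ i) \<longlongrightarrow> x $ i) F"
      have 1: "((\<lambda>y. coords n y i) \<longlongrightarrow> coords n x i) F" if "i < n" for i
        using lim[OF that] that by (simp add: coords_def)
      have "dominated (coords n x) 2" using x by (intro dom) (simp add: unit_ball_def N'_def)
      then have 2: "((\<lambda>y. l (coords n y) i) \<longlongrightarrow> l (coords n x) i) F" if "i < n" for i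
        by (rule l4[where X = "coords n" and F = F]) (use 1 that in auto)
      have 3: "((\<lambda>y. P (coords n y) i) \<longlongrightarrow> P (coords n x) i) F" if "i < n" for i
        using that unfolding P_def V_def by (auto intro!: tendsto_intros 1)
      show "(f \<longlongrightarrow> f x) F"
        unfolding f_def pairing_def ip_def fun_diff_def by (intro tendsto_intros 1 2 3) auto
    qed
  next
    show "omega3 n N' f \<le> 1"
    proof (rule omega3_leI)
      fix x h :: "real vec"
      assume xh: "x \<in> carrier_vec n" "h \<in> carrier_vec n"
        and b: "N' (x + 0 \<cdot>\<^sub>v h) \<le> 1" "N' (x + 1 \<cdot>\<^sub>v h) \<le> 1" "N' (x + 2 \<cdot>\<^sub>v h) \<le> 1" "N' (x + 3 \<cdot>\<^sub>v h) \<le> 1"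
      have co: "coords n (x + c \<cdot>\<^sub>v h) = coords n x + c *\<^sub>R coords n h" for c
        using xh by (simp add: coords_add coords_smult)
      have "\<bar>third_difference (pairing l) (coords n h) (coords n x)\<bar> \<le> 108"
      proof (rule pairing_third_difference)
        show "dominated (coords n x) 2" "dominated (coords n x + coords n h) 2"
          "dominated (coords n x + 2 *\<^sub>R coords n h) 2" "dominated (coords n x + 3 *\<^sub>R coords n h) 2"
          using b[unfolded N'_def co, THEN dom] by simp_all
      qed (use l2 l3 in blast)+
      moreover have "Delta3 f h x = third_difference (pairing l) (coords n h) (coords n x) / 108"
        unfolding Delta3_expand f_def co third_difference_def by (simp add: field_simps)
      ultimately show "\<bar>Delta3 f h x\<bar> \<le> 1" by simp
    qed
  next
    fix p K assume "quadratic n p" and K: "\<And>x. x \<in> unit_ball n N' \<Longrightarrow> \<bar>f x - p x\<bar> \<le> K"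
    then obtain c b a where p: "\<And>x. p x = c + (\<Sum>i<n. b i * x $ i) + (\<Sum>i<n. \<Sum>k<n. a i k * x $ i * x $ k)"
      unfolding quadratic_def by blast
    have "s - 7 \<le> 2 * (108 * K)"
    proof (rule pairing_far_from_quadratic[OF l1 l2 l3 n])
      fix x assume x: "N x \<le> 1"
      have "N (coords n (vec n x)) = N x"
        by (rule eq_if_null_diff) (simp add: N_eq_0_iff coords_def)
      then have "vec n x \<in> unit_ball n N'" using x by (simp add: unit_ball_def N'_def)
      from K[OF this] have "\<bar>108 * f (vec n x) - 108 * p (vec n x)\<bar> \<le> 108 * K" by (simp add: abs_le_iff)
      moreover have "108 * f (vec n x) = pairing l x"
      proof -
        have P: "P (coords n (vec n x)) = P x" by (rule P_cong) (simp add: coords_def)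
        have "pairing l (coords n (vec n x)) = pairing l x"
          unfolding pairing_def P l1[OF P] by (rule ip_cong) (simp add: coords_def)
        then show ?thesis by (simp add: f_def)
      qed
      moreover have "108 * p (vec n x) = 108 * c + (\<Sum>j<n. (108 * b j) * x j) + (\<Sum>j<n. \<Sum>k<n. (108 * a j k) * x j * x k)"
        by (simp add: p distrib_left sum_distrib_left mult.assoc)
      ultimately show "\<bar>pairing l x - (108 * c + (\<Sum>j<n. (108 * b j) * x j) + (\<Sum>j<n. \<Sum>k<n. (108 * a j k) * x j * x k))\<bar> \<le> 108 * K"
        by (simp only:)
    qed
    then show "(s - 7) / 216 \<le> K" by (simp add: field_simps)
  qed
qed

lemma w3s_lower_sine:
  assumes n: "1 \<le> n"
  shows "ereal ((sqrt (real (n + 1) / 2) - 7) / 216) \<le> w3s n"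
proof -
  define s where "s = sqrt (real (n + 1) / 2)"
  define \<theta> where "\<theta> = pi / real (n + 1)"
  define W where "W i j = sin (real ((i + 1) * (j + 1)) * \<theta>) / s" for i j :: nat
  have s2: "s * s = real (n + 1) / 2" by (simp add: s_def)
  have s1: "1 \<le> s" unfolding s_def using n by simp
  interpret reflection n W s
  proof
    show "W i j = W j i" for i j by (simp add: W_def mult.commute)
    show "(\<Sum>k<n. W i k * W k j) = (if i = j then 1 else 0)" if "i < n" "j < n" for i j
    proof -
      have "(\<Sum>k<n. W i k * W k j) = (\<Sum>k<n. sin (real ((i + 1) * (k + 1)) * \<theta>) * sin (real ((k + 1) * (j + 1)) * \<theta>)) / (s * s)"
        by (simp add: W_def sum_divide_distrib)
      also have "\<dots> = (if i = j then 1 else 0)"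
        unfolding s2 \<theta>_def sine_orthogonality[OF that] by simp
      finally show ?thesis .
    qed
    show "1 \<le> s" by (rule s1)
    show "\<bar>W i j\<bar> \<le> 1 / s" for i j using s1 by (simp add: W_def divide_right_mono)
  qed
  show ?thesis using w3s_lower[OF n] unfolding s_def .
qed

lemma norm_on_l1: "norm_on n (\<lambda>x. \<Sum>i<n. \<bar>x $ i\<bar>)"
  unfolding norm_on_def
proof (intro conjI ballI allI)
  fix x :: "real vec" assume x: "x \<in> carrier_vec n"
  have "(\<Sum>i<n. \<bar>x $ i\<bar>) = 0 \<longleftrightarrow> (\<forall>i<n. x $ i = 0)" by (subst sum_nonneg_eq_0_iff) auto
  also have "\<dots> \<longleftrightarrow> x = 0\<^sub>v n" using x by (auto simp: vec_eq_iff)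
  finally show "(\<Sum>i<n. \<bar>x $ i\<bar>) = 0 \<longleftrightarrow> x = 0\<^sub>v n" .
next
  fix x y :: "real vec" assume "x \<in> carrier_vec n" "y \<in> carrier_vec n"
  then have "(\<Sum>i<n. \<bar>(x + y) $ i\<bar>) \<le> (\<Sum>i<n. \<bar>x $ i\<bar> + \<bar>y $ i\<bar>)"
    by (intro sum_mono) (auto simp: abs_triangle_ineq)
  then show "(\<Sum>i<n. \<bar>(x + y) $ i\<bar>) \<le> (\<Sum>i<n. \<bar>x $ i\<bar>) + (\<Sum>i<n. \<bar>y $ i\<bar>)" by (simp add: sum.distrib)
qed (auto simp: sum_nonneg abs_mult sum_distrib_left)

lemma quadratic_Delta3_zero:
  assumes "quadratic n p" and xh: "x \<in> carrier_vec n" "h \<in> carrier_vec n"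
  shows "Delta3 p h x = 0"
proof -
  obtain c b a where p: "\<And>x. p x = c + (\<Sum>i<n. b i * x $ i) + (\<Sum>i<n. \<Sum>k<n. a i k * x $ i * x $ k)"
    using assms(1) unfolding quadratic_def by blast
  define L where "L t = (\<Sum>i<n. b i * (x $ i + t * h $ i))" for t
  define q where "q t = (\<Sum>i<n. \<Sum>k<n. a i k * (x $ i + t * h $ i) * (x $ k + t * h $ k))" for t
  have pt: "p (x + t \<cdot>\<^sub>v h) = c + L t + q t" for t
    using xh by (simp add: p L_def q_def)
  have "L 3 - 3 * L 2 + 3 * L 1 - L 0 = 0"
    unfolding L_def sum_distrib_left sum_subtractf[symmetric] sum.distrib[symmetric]
    by (intro sum.neutral ballI) (simp add: algebra_simps)
  moreover have "q 3 - 3 * q 2 + 3 * q 1 - q 0 = 0"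
    unfolding q_def sum_distrib_left sum_subtractf[symmetric] sum.distrib[symmetric]
    by (intro sum.neutral ballI) (simp add: algebra_simps)
  ultimately show ?thesis unfolding Delta3_expand pt distrib_left by linarith
qed

text \<open>
The bound from the sine transform is trivial in small dimensions. There the cube of one coordinate
serves: its third difference over \<open>- 1, - 1/3, 1/3, 1\<close> does not vanish, and that of a quadratic
polynomial does.
\<close>

lemma w3s_lower_cubic:
  assumes n: "1 \<le> n"
  shows "ereal (1 / 9) \<le> w3s n"
proof -
  let ?N = "\<lambda>x :: real vec. \<Sum>i<n. \<bar>x $ i\<bar>"
  define f where "f x = (x $ 0) ^ 3 / 2" for x :: "real vec"
  have coord: "\<bar>x $ i\<bar> \<le> 1 * ?N x" if "i < n" for x :: "real vec" and i
    using that member_le_sum[of i "{..<n}" "\<lambda>i. \<bar>x $ i\<bar>"] by simp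
  have D: "Delta3 f h x = 3 * (h $ 0) ^ 3" if "x \<in> carrier_vec n" "h \<in> carrier_vec n" for x h
    using that n unfolding Delta3_expand f_def by (simp add: field_simps power3_eq_cube)
  show ?thesis
  proof (rule w3s_lowerI[OF norm_on_l1, of n f])
    show "cont_on_ball n ?N f"
    proof (rule cont_on_ballI[OF norm_on_l1, of n 1])
      fix x and F :: "real vec filter" assume "\<And>i. i < n \<Longrightarrow> ((\<lambda>y. y $ i) \<longlongrightarrow> x $ i) F"
      from this[of 0] n show "(f \<longlongrightarrow> f x) F" unfolding f_def by (intro tendsto_intros) auto
    qed (rule coord)
  next
    show "omega3 n ?N f \<le> 1"
    proof (rule omega3_leI)
      fix x h :: "real vec" assume xh: "x \<in> carrier_vec n" "h \<in> carrier_vec n"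
        and b: "?N (x + 0 \<cdot>\<^sub>v h) \<le> 1" "?N (x + 3 \<cdot>\<^sub>v h) \<le> 1"
      have "\<bar>(x + 0 \<cdot>\<^sub>v h) $ 0\<bar> \<le> 1" "\<bar>(x + 3 \<cdot>\<^sub>v h) $ 0\<bar> \<le> 1"
        using coord[of 0 "x + 0 \<cdot>\<^sub>v h"] coord[of 0 "x + 3 \<cdot>\<^sub>v h"] b n by linarith+
      then have "\<bar>x $ 0\<bar> \<le> 1" "\<bar>x $ 0 + 3 * h $ 0\<bar> \<le> 1" using xh n by auto
      then have "3 * h $ 0 \<le> 2" "- 2 \<le> 3 * h $ 0" unfolding abs_le_iff by linarith+
      then have "\<bar>h $ 0\<bar> \<le> 2 / 3" by (simp add: abs_le_iff field_simps)
      then have "\<bar>h $ 0\<bar> ^ 3 \<le> (2 / 3) ^ 3" by (intro power_mono) auto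
      moreover have "\<bar>Delta3 f h x\<bar> = 3 * \<bar>h $ 0\<bar> ^ 3" unfolding D[OF xh] by (simp add: abs_mult power_abs)
      ultimately show "\<bar>Delta3 f h x\<bar> \<le> 1" by (simp add: power3_eq_cube)
    qed
  next
    fix p K assume p: "quadratic n p" and K: "\<And>x. x \<in> unit_ball n ?N \<Longrightarrow> \<bar>f x - p x\<bar> \<le> K"
    define e where "e t = vec n (\<lambda>i. if i = 0 then t else (0 :: real))" for t
    have ec: "e t \<in> carrier_vec n" for t by (simp add: e_def)
    have "e t \<in> unit_ball n ?N" if "\<bar>t\<bar> \<le> 1" for t
    proof -
      have "?N (e t) = (\<Sum>i<n. if i = 0 then \<bar>t\<bar> else 0)" by (intro sum.cong refl) (simp add: e_def)
      then show ?thesis using that n ec by (simp add: unit_ball_def)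
    qed
    then have K': "\<bar>f (e t) - p (e t)\<bar> \<le> K" if "\<bar>t\<bar> \<le> 1" for t using K that by blast
    have eq: "e (- 1) + c \<cdot>\<^sub>v e (2 / 3) = e (- 1 + c * (2 / 3))" for c
      by (auto simp: e_def intro!: eq_vecI)
    have e0: "e (2 / 3) $ 0 = 2 / 3" using n by (simp add: e_def)
    have "Delta3 f (e (2 / 3)) (e (- 1)) = 8 / 9" unfolding D[OF ec ec] e0 by (simp add: power3_eq_cube)
    then have "f (e 1) - 3 * f (e (1 / 3)) + 3 * f (e (- 1 / 3)) - f (e (- 1)) = 8 / 9"
      unfolding Delta3_expand eq by simp
    moreover have "p (e 1) - 3 * p (e (1 / 3)) + 3 * p (e (- 1 / 3)) - p (e (- 1)) = 0"
      using quadratic_Delta3_zero[OF p ec ec, of "2 / 3" "- 1"] unfolding Delta3_expand eq by simp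
    moreover have "f (e t) - p (e t) \<le> K" "- (f (e t) - p (e t)) \<le> K" if "\<bar>t\<bar> \<le> 1" for t
      using K'[OF that] by (simp_all add: abs_le_iff)
    from this(1)[of 1] this(2)[of "1 / 3"] this(1)[of "- 1 / 3"] this(2)[of "- 1"]
    have "f (e 1) - p (e 1) \<le> K" "- (f (e (1 / 3)) - p (e (1 / 3))) \<le> K"
      "f (e (- 1 / 3)) - p (e (- 1 / 3)) \<le> K" "- (f (e (- 1)) - p (e (- 1))) \<le> K" by simp_all
    ultimately have "8 / 9 \<le> 8 * K" by linarith
    then show "1 / 9 \<le> K" by simp
  qed
qed

text \<open>
From \<open>n = 400\<close> on, \<open>s \<ge> 14\<close>, so \<open>s - 7\<close> is at least \<open>s / 2\<close>; below, \<open>\<surd>n < 20\<close>.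
\<close>

lemma w3s_lower_bound:
  assumes n: "1 \<le> n"
  shows "ereal (1 / 700 * sqrt (real n)) \<le> w3s n"
proof (cases "n < 400")
  case True
  have "sqrt (real n) \<le> sqrt 400" using True by (intro real_sqrt_le_mono) simp
  also have "sqrt 400 = 20" by simp
  finally have "ereal (1 / 700 * sqrt (real n)) \<le> ereal (1 / 9)" by simp
  also have "\<dots> \<le> w3s n" by (rule w3s_lower_cubic[OF n])
  finally show ?thesis .
next
  case False
  define s where "s = sqrt (real (n + 1) / 2)"
  have "sqrt (14 ^ 2) \<le> s" unfolding s_def using False by (intro real_sqrt_le_mono) simp
  then have s14: "14 \<le> s" by simp
  have "sqrt (real n) \<le> sqrt ((3 / 2) ^ 2 * (real (n + 1) / 2))"
    by (intro real_sqrt_le_mono) (simp add: power2_eq_square)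
  also have "\<dots> = 3 / 2 * s" unfolding s_def real_sqrt_mult by simp
  finally have "sqrt (real n) \<le> 3 / 2 * s" .
  then have "1 / 700 * sqrt (real n) \<le> (s - 7) / 216" using s14 by (simp add: field_simps)
  then have "ereal (1 / 700 * sqrt (real n)) \<le> ereal ((s - 7) / 216)" by simp
  also have "\<dots> \<le> w3s n" unfolding s_def by (rule w3s_lower_sine[OF n])
  finally show ?thesis .
qed

theorem theorem4p1:
  "\<exists>c C :: real. 0 < c \<and> 0 < C \<and>
     (\<forall>n::nat. 1 \<le> n \<longrightarrow>
        ereal (c * sqrt (real n)) \<le> w3s n \<and>
        w3s n \<le> ereal (C * sqrt (real n) * ln (real n + 1)))"
proof (intro exI conjI allI impI)
  fix n :: nat assume n: "1 \<le> n"
  show "ereal (1 / 700 * sqrt (real n)) \<le> w3s n" by (rule w3s_lower_bound[OF n])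
  show "w3s n \<le> ereal (38000 * sqrt (real n) * ln (real n + 1))" by (rule w3s_upper[OF n])
qed simp_all

end
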